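(* Let $k\ge 1$ and let $F=C_{2k+1}$ be the cycle of length $2k+1$. Then $c_1(F)=1/2$.
   Context: $\mathrm{ex}(n,F)$ is the maximum number of edges in an $n$-vertex graph with no subgraph isomorphic to $F$. $h_F(n,q)$ is the minimum number of subgraphs isomorphic to $F$ in a graph with $n$ vertices and $\mathrm{ex}(n,F)+q$ edges. $t_F(n,q)$ is the smallest number of subgraphs isomorphic to $F$ in a graph obtained by adding $q$ edges to a maximum $F$-free graph on $n$ vertices. Let $q_F(n)=\max\{q: h_F(n,q')=t_F(n,q')\text{ for all } q'\le q\}$ and $c_1(F)=\liminf_{n\to\infty} q_F(n)/n$. *)

theory Defs
  imports "HOL-Analysis.Analysis"
begin

text \<open>Simple graphs are represented by their edge sets; an edge is a 2-element set of
vertices. A graph on n vertices has vertex set {0..<n}.\<close>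

definition graph_on :: "nat \<Rightarrow> nat set set \<Rightarrow> bool" where
  "graph_on n E \<longleftrightarrow> E \<subseteq> {e. \<exists>x y. e = {x, y} \<and> x \<noteq> y \<and> x < n \<and> y < n}"

text \<open>Number of subgraphs of G isomorphic to the (isolated-vertex-free) graph F, i.e. the
number of edge subsets S of G such that S is the image of the edge set of F under an
injective vertex map.\<close>

definition copies :: "nat set set \<Rightarrow> 'b set set \<Rightarrow> nat" where
  "copies G F = card {S. S \<subseteq> G \<and> (\<exists>f. inj_on f (\<Union>F) \<and> S = (\<lambda>e. f ` e) ` F)}"

definition cycle_graph :: "nat \<Rightarrow> nat set set" where
  "cycle_graph L = {{i, (i + 1) mod L} | i. i < L}"

definition ex :: "nat \<Rightarrow> 'b set set \<Rightarrow> nat" where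
  "ex n F = Max {card E | E. graph_on n E \<and> copies E F = 0}"

definition h_F :: "'b set set \<Rightarrow> nat \<Rightarrow> nat \<Rightarrow> nat" where
  "h_F F n q = Min {copies E F | E. graph_on n E \<and> card E = ex n F + q}"

definition t_F :: "'b set set \<Rightarrow> nat \<Rightarrow> nat \<Rightarrow> nat" where
  "t_F F n q = Min {copies (E \<union> A) F | E A. graph_on n E \<and> copies E F = 0 \<and>
      card E = ex n F \<and> graph_on n A \<and> A \<inter> E = {} \<and> card A = q}"

text \<open>q_F(n): the largest q (among those for which a graph with ex(n,F)+q edges on n
vertices exists) such that h_F(n,q') = t_F(n,q') for all q' \<le> q.\<close>

definition q_F :: "'b set set \<Rightarrow> nat \<Rightarrow> nat" where
  "q_F F n = Max {q. q \<le> (n choose 2) - ex n F \<and> (\<forall>q'\<le>q. h_F F n q' = t_F F n q')}"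

definition c1 :: "'b set set \<Rightarrow> ereal" where
  "c1 F = liminf (\<lambda>n. ereal (real (q_F F n) / real n))"

end

theory Submission
  imports Defs
begin

text \<open>Write \<open>c(n)\<close> for the number of copies of \<open>C\<^sub>2\<^sub>k\<^sub>+\<^sub>1\<close> created by one edge added to the larger part of the balanced
  complete bipartite graph \<open>T\<^sub>2(n)\<close>. Adding a star with \<open>q < n/2\<close> edges creates exactly \<open>q c(n)\<close> copies.

  Conversely, let \<open>G\<close> have \<open>\<lfloor>n\<^sup>2/4\<rfloor> + q\<close> edges, \<open>q \<le> (1/2 - \<delta>) n\<close>, and at most \<open>q c(n)\<close> copies. Then almost all
  neighbourhoods span \<open>o(n\<^sup>2)\<close> edges, so some cut \<open>V = N(x) \<union> (V - N(x))\<close> has only \<open>o(n\<^sup>2)\<close> edges inside its parts. Take a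
  maximum cut, with parts of sizes \<open>a, b\<close>, \<open>B\<close> bad edges inside the parts and \<open>M\<close> missing edges across, so that
  \<open>B = q + (\<lfloor>n\<^sup>2/4\<rfloor> - ab) + M\<close>. Counting only cycles with exactly one bad edge, each bad edge yields about \<open>c(n)\<close>
  copies, and a missing edge \<open>xy\<close> destroys about a fraction \<open>2 (d(x) + d(y)) / n\<close> of \<open>c(n)\<close> copies, where \<open>d\<close> is the bad
  degree. As bad degrees stay below \<open>(1 - \<delta>) n / 2\<close> (otherwise one vertex alone gives too many copies), this fraction is
  bounded away from 1 except for a negligible number of missing edges, which leaves at least \<open>q c(n)\<close> copies.

  For \<open>n = 2m\<close>, passing from \<open>K\<^sub>m\<^sub>,\<^sub>m\<close> to \<open>K\<^sub>m\<^sub>+\<^sub>1\<^sub>,\<^sub>m\<^sub>-\<^sub>1\<close> costs one extra edge but multiplies the number of copies per added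
  edge by exactly \<open>1 - 1/m\<close>. This pays off as soon as \<open>q \<ge> (1 + \<epsilon>) m\<close>, whence the constant \<open>1/2\<close>.\<close>

section \<open>Cycles as vertex lists\<close>


text \<open>A lower bound may ignore cycles with several bad edges, the constructions may not. An
  odd cycle has an odd number of bad edges; a star admits only one, and bounded degree makes three
  or more rare. Moving \<open>s\<close> vertices across a balanced cut demands about
  \<open>s^2\<close> further bad edges, while each bad edge then gives fewer cycles by a factor of
  about \<open>1 - 2 * s / n\<close>. The move therefore pays only from \<open>q\<close> about
  \<open>s * n / 2\<close> on, and integrality, \<open>s \<ge> 1\<close>, is what produces the
  threshold. A missing edge likewise demands one further bad edge and pays only if
  \<open>d(x) + d(y) > n / 2\<close>. Once single degrees are capped below \<open>n / 2\<close>,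
  both ends must have bad degree of order \<open>n\<close>, and few vertices have that. The
  assumption of at most \<open>q * c(n)\<close> copies is free of charge in a lower bound and is
  what makes \<open>G\<close> almost bipartite. The extremal number and the extremal graphs are not
  taken from elsewhere: they come out of the same bound for \<open>q = 1\<close> and
  \<open>q = 0\<close>.\<close>

definition cyc :: "nat list \<Rightarrow> nat set set" where
  "cyc xs = {{xs ! i, xs ! ((i + 1) mod length xs)} | i. i < length xs}"

lemma Union_cycle_graph: "L \<ge> 1 \<Longrightarrow> \<Union>(cycle_graph L) = {..<L}"
proof -
  assume L: "L \<ge> 1"
  then have m: "(i + 1) mod L < L" for i by (intro mod_less_divisor) simp
  have "\<Union>(cycle_graph L) = (\<Union>i<L. {i, (i + 1) mod L})" unfolding cycle_graph_def by blast
  also have "... = {..<L}" using m by blast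
  finally show ?thesis .
qed

lemma cyc_map: "cyc (map f [0..<L]) = (\<lambda>e. f ` e) ` cycle_graph L"
proof -
  have "i < L \<Longrightarrow> map f [0..<L] ! ((i + 1) mod L) = f ((i + 1) mod L)" for i
    by (subst nth_map) auto
  then have eq: "{map f [0..<L] ! i, map f [0..<L] ! ((i + 1) mod L)} = f ` {i, (i + 1) mod L}" if "i < L" for i
    using that by simp
  have "cyc (map f [0..<L]) = (\<lambda>i. {map f [0..<L] ! i, map f [0..<L] ! ((i + 1) mod L)}) ` {..<L}"
    unfolding cyc_def length_map length_upt diff_zero by blast
  also have "... = (\<lambda>i. f ` {i, (i + 1) mod L}) ` {..<L}"
    using eq by (intro image_cong) auto
  also have "... = (\<lambda>e. f ` e) ` cycle_graph L"
    unfolding cycle_graph_def by blast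
  finally show ?thesis .
qed

text \<open>A copy is an edge set, whereas counting is done with vertex lists. The image under
  \<open>cyc\<close> forgets starting vertex and direction, so lower bounds need an injectivity
  argument for \<open>cyc\<close> and upper bounds only a covering.\<close>

lemma copies_cycle_graph:
  assumes "L \<ge> 1"
  shows "copies G (cycle_graph L) = card (cyc ` {xs. length xs = L \<and> distinct xs \<and> cyc xs \<subseteq> G})"
proof -
  have "{S. S \<subseteq> G \<and> (\<exists>f::nat\<Rightarrow>nat. inj_on f (\<Union>(cycle_graph L)) \<and> S = (\<lambda>e. f ` e) ` cycle_graph L)}
      = cyc ` {xs. length xs = L \<and> distinct xs \<and> cyc xs \<subseteq> G}" (is "?X = ?Y")
  proof
    show "?X \<subseteq> ?Y"
    proof
      fix S assume "S \<in> ?X"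
      then obtain f :: "nat \<Rightarrow> nat" where f: "S \<subseteq> G" "inj_on f {..<L}" "S = (\<lambda>e. f ` e) ` cycle_graph L"
        by (auto simp: Union_cycle_graph[OF assms])
      then have "S = cyc (map f [0..<L])" by (simp add: cyc_map)
      moreover have "distinct (map f [0..<L])" using f(2) by (simp add: distinct_map atLeast0LessThan)
      ultimately show "S \<in> ?Y" using f(1) by force
    qed
    show "?Y \<subseteq> ?X"
    proof
      fix S assume "S \<in> ?Y"
      then obtain xs where xs: "S = cyc xs" "length xs = L" "distinct xs" "cyc xs \<subseteq> G" by auto
      have "map (\<lambda>i. xs ! i) [0..<L] = xs" using xs(2) map_nth by blast
      then have "S = (\<lambda>e. (\<lambda>i. xs ! i) ` e) ` cycle_graph L" using xs(1) cyc_map by metis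
      moreover have "inj_on (\<lambda>i. xs ! i) {..<L}" using xs by (simp add: inj_on_nth)
      ultimately show "S \<in> ?X" using xs by (auto simp: Union_cycle_graph[OF assms])
    qed
  qed
  then show ?thesis by (simp add: copies_def)
qed

lemma cyc_conv:
  assumes "xs \<noteq> []"
  shows "cyc xs = insert {last xs, hd xs} {{xs ! i, xs ! Suc i} | i. Suc i < length xs}"
proof -
  let ?L = "length xs"
  have L: "?L > 0" using assms by simp
  show ?thesis
  proof (intro set_eqI iffI)
    fix e assume "e \<in> cyc xs"
    then obtain i where i: "i < ?L" "e = {xs ! i, xs ! ((i + 1) mod ?L)}" by (auto simp: cyc_def)
    show "e \<in> insert {last xs, hd xs} {{xs ! i, xs ! Suc i} | i. Suc i < length xs}"
    proof (cases "Suc i < ?L")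
      case True
      then show ?thesis using i by auto
    next
      case False
      then have "i = ?L - 1" using i by simp
      then show ?thesis using i assms L by (simp add: last_conv_nth hd_conv_nth)
    qed
  next
    fix e assume "e \<in> insert {last xs, hd xs} {{xs ! i, xs ! Suc i} | i. Suc i < length xs}"
    then consider "e = {last xs, hd xs}" | i where "Suc i < ?L" "e = {xs ! i, xs ! Suc i}" by auto
    then show "e \<in> cyc xs"
    proof cases
      case 1
      then have "e = {xs ! (?L - 1), xs ! ((?L - 1 + 1) mod ?L)}"
        using assms L by (simp add: last_conv_nth hd_conv_nth)
      then show ?thesis unfolding cyc_def using L by (metis (mono_tags, lifting) diff_less mem_Collect_eq zero_less_one)
    next
      case 2
      then have "e = {xs ! i, xs ! ((i + 1) mod ?L)}" by simp
      then show ?thesis unfolding cyc_def using 2 Suc_lessD by blast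
    qed
  qed
qed

lemma Union_cyc: "\<Union>(cyc xs) = set xs"
proof
  show "\<Union>(cyc xs) \<subseteq> set xs"
  proof
    fix x assume "x \<in> \<Union>(cyc xs)"
    then obtain i where i: "i < length xs" "x \<in> {xs ! i, xs ! ((i + 1) mod length xs)}" by (auto simp: cyc_def)
    then have "(i + 1) mod length xs < length xs" by (intro mod_less_divisor) linarith
    then show "x \<in> set xs" using i by auto
  qed
  show "set xs \<subseteq> \<Union>(cyc xs)"
  proof
    fix x assume "x \<in> set xs"
    then obtain i where i: "i < length xs" "x = xs ! i" by (auto simp: in_set_conv_nth)
    then have "{xs ! i, xs ! ((i + 1) mod length xs)} \<in> cyc xs" unfolding cyc_def by blast
    then show "x \<in> \<Union>(cyc xs)" using i(2) by blast
  qed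
qed

lemma bij_Suc_mod:
  assumes "(L :: nat) > 0"
  shows "bij_betw (\<lambda>i. (i + 1) mod L) {..<L} {..<L}"
proof -
  have "inj_on (\<lambda>i. (i + 1) mod L) {..<L}"
  proof (rule inj_onI)
    fix i j assume ij: "i \<in> {..<L}" "j \<in> {..<L}" "(i + 1) mod L = (j + 1) mod L"
    have m: "(r + 1) mod L = (if r + 1 = L then 0 else r + 1)" if "r < L" for r using that by simp
    have "(if i + 1 = L then 0 else i + 1) = (if j + 1 = L then 0 else j + 1)"
      using ij m[of i] m[of j] by (metis lessThan_iff)
    then show "i = j" by (simp split: if_splits)
  qed
  moreover have "(\<lambda>i. (i + 1) mod L) ` {..<L} \<subseteq> {..<L}" using assms by (auto intro!: mod_less_divisor)
  ultimately show ?thesis by (simp add: bij_betw_def endo_inj_surj)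
qed

lemma cyc_rotate1: "cyc (rotate1 xs) = cyc xs"
proof (cases xs)
  case (Cons x ys)
  show ?thesis
  proof (cases "ys = []")
    case False
    let ?L = "length xs"
    have L: "?L \<ge> 2" using Cons False by (cases ys) auto
    have nth: "rotate1 xs ! i = xs ! (Suc i mod ?L)" if "i < ?L" for i
      using that by (simp add: nth_rotate1)
    have nth2: "rotate1 xs ! ((i + 1) mod ?L) = xs ! ((Suc i mod ?L + 1) mod ?L)" for i
    proof -
      have "(i + 1) mod ?L < ?L" using L by (intro mod_less_divisor) linarith
      then show ?thesis by (simp add: nth)
    qed
    have "cyc (rotate1 xs) = (\<lambda>i. {rotate1 xs ! i, rotate1 xs ! ((i + 1) mod ?L)}) ` {..<?L}"
      by (auto simp: cyc_def)
    also have "... = (\<lambda>i. {xs ! (Suc i mod ?L), xs ! ((Suc i mod ?L + 1) mod ?L)}) ` {..<?L}"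
      by (rule image_cong) (auto simp only: nth nth2 lessThan_iff)
    also have "... = (\<lambda>i. {xs ! i, xs ! ((i + 1) mod ?L)}) ` ((\<lambda>i. Suc i mod ?L) ` {..<?L})"
      by (simp add: image_image)
    also have "(\<lambda>i. Suc i mod ?L) ` {..<?L} = {..<?L}"
      using bij_betw_imp_surj_on[OF bij_Suc_mod[of ?L]] L by fastforce
    finally show ?thesis by (auto simp: cyc_def)
  qed (use Cons in simp)
qed simp

lemma cyc_rotate: "cyc (rotate j xs) = cyc xs"
  by (induction j) (simp_all add: cyc_rotate1)

lemma cyc_rev: "cyc (rev xs) = cyc xs"
proof (cases "xs = []")
  case False
  have sub: "cyc (rev ys) \<subseteq> cyc ys" if ne: "ys \<noteq> []" for ys
  proof
    fix e assume "e \<in> cyc (rev ys)"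
    then consider "e = {hd ys, last ys}" | i where "Suc i < length ys" "e = {rev ys ! i, rev ys ! Suc i}"
      using ne by (auto simp: cyc_conv last_rev hd_rev)
    then show "e \<in> cyc ys"
    proof cases
      case 1
      then show ?thesis using ne by (auto simp: cyc_conv)
    next
      case 2
      define j where "j = length ys - Suc (Suc i)"
      have "e = {ys ! j, ys ! Suc j}" "Suc j < length ys"
        using 2 by (auto simp: rev_nth j_def Suc_diff_Suc insert_commute)
      then show ?thesis using ne by (auto simp: cyc_conv)
    qed
  qed
  show ?thesis using sub[of xs] sub[of "rev xs"] False by auto
qed simp

text \<open>The last and the first entry fix starting point and direction. After that the list can
  be read off the edge set: each vertex lies on two edges, and the one leading back is known.
  \<open>L \<ge> 3\<close> keeps the two neighbours of a vertex apart.\<close>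

lemma cyc_inj:
  assumes "length xs = L" "length ys = L" "distinct xs" "distinct ys" "L \<ge> 3"
    and eq: "cyc xs = cyc ys" and hd: "hd xs = hd ys" and la: "last xs = last ys"
  shows "xs = ys"
proof -
  have ne: "xs \<noteq> []" "ys \<noteq> []" using assms by auto
  have z: "xs ! 0 = ys ! 0" using hd ne by (simp add: hd_conv_nth)
  have l: "xs ! (L - 1) = ys ! (L - 1)" using la ne assms by (simp add: last_conv_nth)
  have "i < L \<Longrightarrow> xs ! i = ys ! i" for i
  proof (induction i rule: less_induct)
    case (less i)
    show ?case
    proof (cases i)
      case 0
      then show ?thesis using z by simp
    next
      case (Suc j)
      have j: "xs ! j = ys ! j" using less Suc by simp
      \<comment> \<open>The cyclic predecessor of \<open>j\<close>; for \<open>j = 0\<close> it is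
        the last position, where the hypothesis on \<open>last\<close> enters.\<close>
      let ?p = "(j + L - 1) mod L"
      have p: "?p = (if j = 0 then L - 1 else j - 1)"
        using less.prems Suc assms(5) by (auto simp: mod_if)
      have xp: "xs ! ?p = ys ! ?p"
        using p l less Suc by auto
      have "{ys ! j, ys ! Suc j} \<in> cyc ys" using Suc less.prems ne assms by (auto simp: cyc_conv)
      then have "{ys ! j, ys ! Suc j} \<in> cyc xs" using eq by simp
      then obtain r where r: "r < L" "{ys ! j, ys ! Suc j} = {xs ! r, xs ! ((r + 1) mod L)}"
        using assms by (auto simp: cyc_def)
      have rm: "(r + 1) mod L < L" using r by auto
      have yne: "ys ! Suc j \<noteq> ys ! ?p"
        using p assms less.prems Suc by (auto simp: nth_eq_iff_index_eq)
      have "r = j \<or> (r + 1) mod L = j"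
        using r(2) j assms(1,3) r(1) rm less.prems Suc by (metis Suc_lessD doubleton_eq_iff nth_eq_iff_index_eq)
      then show ?thesis
      proof
        assume "r = j"
        then have "{ys ! j, ys ! Suc j} = {ys ! j, xs ! Suc j}" using r j less.prems Suc by simp
        then show ?thesis using Suc by (metis doubleton_eq_iff)
      next
        assume a: "(r + 1) mod L = j"
        then have "r = ?p" using r(1) p by (auto simp: mod_if split: if_splits)
        then have "{ys ! j, ys ! Suc j} = {ys ! ?p, ys ! j}" using r(2) j a xp by simp
        then show ?thesis using yne by (metis doubleton_eq_iff)
      qed
    qed
  qed
  then show ?thesis using assms by (auto intro: nth_equalityI)
qed

lemma finite_graph_on: "graph_on n G \<Longrightarrow> finite G"
proof -
  assume "graph_on n G"
  then have "G \<subseteq> Pow {..<n}" by (auto simp: graph_on_def)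
  then show ?thesis by (rule finite_subset) simp
qed

lemma finite_cycles:
  assumes "finite G"
  shows "finite (cyc ` {xs. length xs = L \<and> distinct xs \<and> cyc xs \<subseteq> G})"
  by (rule finite_subset[of _ "Pow G"]) (use assms in auto)

lemma copies_cycle_mono:
  assumes "finite G" "G' \<subseteq> G" "L \<ge> 1"
  shows "copies G' (cycle_graph L) \<le> copies G (cycle_graph L)"
  unfolding copies_cycle_graph[OF assms(3)]
  by (rule card_mono[OF finite_cycles[OF assms(1)]]) (use assms(2) in auto)

lemma graph_onD: "graph_on n G \<Longrightarrow> {u, v} \<in> G \<Longrightarrow> u < n \<and> v < n \<and> u \<noteq> v"
proof -
  assume "graph_on n G" "{u, v} \<in> G"
  then have "{u, v} \<in> {e. \<exists>x y. e = {x, y} \<and> x \<noteq> y \<and> x < n \<and> y < n}" unfolding graph_on_def by blast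
  then show ?thesis by (auto simp: doubleton_eq_iff)
qed

section \<open>Cycles with a single bad edge\<close>


text \<open>Interiors of paths in a complete bipartite graph, with injectivity built in. Swapping
  the two sets at each step and deleting the vertex just used makes the number of choices depend on
  cardinalities alone.\<close>

fun alt :: "nat \<Rightarrow> 'a set \<Rightarrow> 'a set \<Rightarrow> 'a list set" where
  "alt 0 X Y = {[]}"
| "alt (Suc j) X Y = (\<Union>x\<in>X. (#) x ` alt j Y (X - {x}))"

fun altn :: "nat \<Rightarrow> nat \<Rightarrow> nat \<Rightarrow> nat" where
  "altn 0 x y = 1"
| "altn (Suc j) x y = x * altn j y (x - 1)"

text \<open>Falling factorial; truncated subtraction gives 0 for \<open>k > x\<close>.\<close>

definition ff :: "nat \<Rightarrow> nat \<Rightarrow> nat" where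
  "ff x k = (\<Prod>i<k. x - i)"

lemma ff_0 [simp]: "ff x 0 = 1"
  by (simp add: ff_def)

lemma ff_Suc: "ff x (Suc k) = x * ff (x - 1) k"
  unfolding ff_def by (subst prod.lessThan_Suc_shift) simp

text \<open>The \<open>j + 1\<close> even positions are filled from the first set and the
  \<open>j\<close> odd ones from the second, independently of each other.\<close>

lemma altn_odd: "altn (Suc (2 * j)) x y = ff x (Suc j) * ff y j"
proof (induction j arbitrary: x y)
  case (Suc j)
  have "altn (Suc (2 * Suc j)) x y = x * (y * altn (Suc (2 * j)) (x - 1) (y - 1))" by simp
  also have "... = (x * ff (x - 1) (Suc j)) * (y * ff (y - 1) j)" unfolding Suc by simp
  finally show ?case unfolding ff_Suc[of x "Suc j"] ff_Suc[of y j] .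
qed (simp add: ff_Suc)

lemma finite_alt: "finite X \<Longrightarrow> finite Y \<Longrightarrow> finite (alt j X Y)"
  by (induction j arbitrary: X Y) auto

lemma card_Cons_UN:
  assumes "finite N" "\<And>x. x \<in> N \<Longrightarrow> finite (f x)" "\<And>x. x \<in> N \<Longrightarrow> card (f x) = c"
  shows "card (\<Union>x\<in>N. (#) x ` f x) = card N * c"
proof -
  have "card (\<Union>x\<in>N. (#) x ` f x) = (\<Sum>x\<in>N. card ((#) x ` f x))"
    by (rule card_UN_disjoint) (use assms in auto)
  also have "... = (\<Sum>x\<in>N. c)"
    by (rule sum.cong) (auto simp: card_image assms)
  finally show ?thesis by simp
qed

lemma card_alt: "finite X \<Longrightarrow> finite Y \<Longrightarrow> card (alt j X Y) = altn j (card X) (card Y)"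
proof (induction j arbitrary: X Y)
  case (Suc j)
  show ?case unfolding alt.simps altn.simps
    by (rule card_Cons_UN) (use Suc in \<open>auto simp: finite_alt\<close>)
qed simp

text \<open>Disjointness turns deletion from one set at a time into distinctness of the whole
  list.\<close>

lemma alt_iff:
  assumes "X \<inter> Y = {}"
  shows "ys \<in> alt j X Y \<longleftrightarrow> length ys = j \<and> distinct ys \<and> (\<forall>i<j. ys ! i \<in> (if even i then X else Y))"
  using assms
proof (induction j arbitrary: X Y ys)
  case (Suc j)
  show ?case
  proof (cases ys)
    case (Cons x zs)
    have disj: "Y \<inter> (X - {x}) = {}" using Suc.prems by auto
    have "ys \<in> alt (Suc j) X Y \<longleftrightarrow> x \<in> X \<and> zs \<in> alt j Y (X - {x})" using Cons by auto
    also have "... \<longleftrightarrow> x \<in> X \<and> length zs = j \<and> distinct zs \<and> (\<forall>i<j. zs ! i \<in> (if even i then Y else X - {x}))"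
      unfolding Suc.IH[OF disj] ..
    also have "... \<longleftrightarrow> length ys = Suc j \<and> distinct ys \<and> (\<forall>i<Suc j. ys ! i \<in> (if even i then X else Y))"
    proof
      assume a: "x \<in> X \<and> length zs = j \<and> distinct zs \<and> (\<forall>i<j. zs ! i \<in> (if even i then Y else X - {x}))"
      then have "x \<notin> set zs" using Suc.prems by (fastforce simp: in_set_conv_nth split: if_splits)
      then show "length ys = Suc j \<and> distinct ys \<and> (\<forall>i<Suc j. ys ! i \<in> (if even i then X else Y))"
        using a Cons by (auto simp: nth_Cons split: nat.split if_splits)
    next
      assume a: "length ys = Suc j \<and> distinct ys \<and> (\<forall>i<Suc j. ys ! i \<in> (if even i then X else Y))"
      have "zs ! i \<in> (if even i then Y else X - {x})" if "i < j" for i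
      proof -
        have "ys ! Suc i \<in> (if even (Suc i) then X else Y)" using a that by blast
        moreover have "zs ! i \<noteq> x" using a Cons that by (auto simp: in_set_conv_nth)
        ultimately show ?thesis using Cons by (auto split: if_splits)
      qed
      moreover have "x \<in> X" using a Cons by force
      ultimately show "x \<in> X \<and> length zs = j \<and> distinct zs \<and> (\<forall>i<j. zs ! i \<in> (if even i then Y else X - {x}))"
        using a Cons by auto
    qed
    finally show ?thesis .
  qed auto
qed auto

lemma card_alt_hd:
  assumes "finite X" "finite Y" "N \<subseteq> X"
  shows "card {ys \<in> alt (Suc j) X Y. hd ys \<in> N} = card N * altn j (card Y) (card X - 1)"
proof -
  have "{ys \<in> alt (Suc j) X Y. hd ys \<in> N} = (\<Union>x\<in>N. (#) x ` alt j Y (X - {x}))"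
    using assms by auto
  also have "card ... = card N * altn j (card Y) (card X - 1)"
    by (rule card_Cons_UN) (use assms in \<open>auto simp: finite_alt card_alt finite_subset card_Diff_singleton subset_iff\<close>)
  finally show ?thesis .
qed

text \<open>Odd length puts both ends on the same side, so reversal keeps the pattern. It carries
  the count by first entry over to the count by last entry.\<close>

lemma rev_alt:
  assumes "X \<inter> Y = {}" "ys \<in> alt (Suc (2 * j)) X Y"
  shows "rev ys \<in> alt (Suc (2 * j)) X Y"
proof -
  have ys: "length ys = Suc (2 * j)" "distinct ys" "\<forall>i<Suc (2*j). ys ! i \<in> (if even i then X else Y)"
    using assms alt_iff by blast+
  have "rev ys ! i \<in> (if even i then X else Y)" if "i < Suc (2*j)" for i
  proof -
    have "rev ys ! i = ys ! (2 * j - i)" using that ys by (simp add: rev_nth)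
    moreover have "even (2 * j - i) = even i" using that by auto
    moreover have "2 * j - i < Suc (2 * j)" by simp
    ultimately show ?thesis using ys(3) by metis
  qed
  then show ?thesis unfolding alt_iff[OF assms(1)] using ys(1,2) by simp
qed

lemma card_alt_last:
  assumes "finite X" "finite Y" "N \<subseteq> X" "X \<inter> Y = {}"
  shows "card {ys \<in> alt (Suc (2 * j)) X Y. last ys \<in> N} = card N * altn (2 * j) (card Y) (card X - 1)"
proof -
  have "{ys \<in> alt (Suc (2 * j)) X Y. last ys \<in> N} = rev ` {ys \<in> alt (Suc (2 * j)) X Y. hd ys \<in> N}" (is "?L = ?R")
  proof
    show "?L \<subseteq> ?R"
    proof
      fix ys assume ys: "ys \<in> ?L"
      then have "ys \<noteq> []" by auto
      then have "rev ys \<in> {ys \<in> alt (Suc (2 * j)) X Y. hd ys \<in> N}"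
        using ys rev_alt[OF assms(4)] by (auto simp: hd_rev simp del: alt.simps)
      then show "ys \<in> ?R" by (metis image_eqI rev_rev_ident)
    qed
    show "?R \<subseteq> ?L"
    proof
      fix zs assume "zs \<in> ?R"
      then obtain ys where ys: "zs = rev ys" "ys \<in> alt (Suc (2*j)) X Y" "hd ys \<in> N" by blast
      then have "ys \<noteq> []" by auto
      then show "zs \<in> ?L"
        using ys rev_alt[OF assms(4)] by (auto simp: last_rev simp del: alt.simps)
    qed
  qed
  then have "card {ys \<in> alt (Suc (2 * j)) X Y. last ys \<in> N} = card {ys \<in> alt (Suc (2 * j)) X Y. hd ys \<in> N}"
    by (simp add: card_image del: alt.simps)
  then show ?thesis using card_alt_hd[OF assms(1-3)] by metis
qed

text \<open>Alternation and distinctness are dropped on purpose: this serves error terms only, where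
  it suffices that one pair from \<open>R\<close> takes the place of two free entries.\<close>

lemma card_lists_consecutive:
  assumes "finite V" "finite R" "Suc i < J"
  shows "card {ys. length ys = J \<and> set ys \<subseteq> V \<and> (ys ! i, ys ! Suc i) \<in> R} \<le> card R * card V ^ (J - 2)"
proof -
  let ?S = "{ys. length ys = J \<and> set ys \<subseteq> V \<and> (ys ! i, ys ! Suc i) \<in> R}"
  let ?f = "\<lambda>ys. ((ys ! i, ys ! Suc i), take i ys @ drop (i + 2) ys)"
  let ?T = "R \<times> {ys. set ys \<subseteq> V \<and> length ys = J - 2}"
  have dec: "ys = take i ys @ ys ! i # ys ! Suc i # drop (i + 2) ys" if "length ys = J" for ys
    using that assms(3) by (simp add: Cons_nth_drop_Suc)
  have "inj_on ?f ?S"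
  proof (rule inj_onI)
    fix xs ys assume a: "xs \<in> ?S" "ys \<in> ?S" "?f xs = ?f ys"
    then have "take i xs = take i ys" "drop (i + 2) xs = drop (i + 2) ys"
      using assms(3) append_eq_append_conv[of "take i xs" "take i ys"] by auto
    then show "xs = ys" using dec[of xs] dec[of ys] a by (metis (mono_tags, lifting) mem_Collect_eq prod.inject)
  qed
  moreover have "?f ` ?S \<subseteq> ?T"
    using assms(3) set_take_subset set_drop_subset by fastforce
  moreover have fin: "finite ?T" using assms finite_lists_length_eq by auto
  ultimately have "card ?S \<le> card ?T" by (meson card_inj_on_le)
  also have "... = card R * card V ^ (J - 2)"
    using assms by (simp add: card_cartesian_product card_lists_length_eq)
  finally show ?thesis .
qed

text \<open>For a bipartition of the vertices into \<open>A\<close> and its complement, \<open>bn u\<close> are the neighbours of \<open>u\<close> on its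
  own side (``bad'' edges), \<open>mn u\<close> its non-neighbours on the other side (``missing'' edges). \<open>paths k u v\<close> are the interiors of
  the \<open>u\<close>--\<open>v\<close> paths of length \<open>2k\<close> without bad edges; together with the bad edge \<open>uv\<close> each closes to a \<open>C\<^sub>2\<^sub>k\<^sub>+\<^sub>1\<close>
  whose only bad edge is \<open>uv\<close>, so these cycles are distinct for distinct bad edges.\<close>

locale cut =
  fixes n :: nat and G :: "nat set set" and A :: "nat set"
  assumes graph: "graph_on n G" and A: "A \<subseteq> {..<n}"
begin

definition same :: "nat \<Rightarrow> nat set" where "same u = {v \<in> {..<n}. v \<in> A \<longleftrightarrow> u \<in> A}"
definition opp :: "nat \<Rightarrow> nat set" where "opp u = {v \<in> {..<n}. v \<in> A \<longleftrightarrow> u \<notin> A}"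
definition bn :: "nat \<Rightarrow> nat set" where "bn u = {v \<in> same u. {u, v} \<in> G}"
definition mn :: "nat \<Rightarrow> nat set" where "mn u = {v \<in> opp u. {u, v} \<notin> G}"
text \<open>Missing pairs are recorded in both orders, bad edges only once, by \<open>u < v\<close>:
  \<open>card MP\<close> is twice the number of missing edges, \<open>card BP\<close> the number of
  bad edges itself.\<close>

definition MP :: "(nat \<times> nat) set" where "MP = Sigma {..<n} mn"
definition BP :: "(nat \<times> nat) set" where "BP = {(u, v). u < v \<and> u < n \<and> v \<in> bn u}"
definition paths :: "nat \<Rightarrow> nat \<Rightarrow> nat \<Rightarrow> nat list set" where
  "paths k u v = {ys \<in> alt (2 * k - 1) (opp u) (same u - {u, v}).
     \<forall>i<2 * k. {(u # ys @ [v]) ! i, (u # ys @ [v]) ! Suc i} \<in> G}"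

lemma finite_sets [simp]: "finite (same u)" "finite (opp u)" "finite (bn u)" "finite (mn u)" "finite MP" "finite BP"
proof -
  show 1: "finite (same u)" "finite (opp u)" for u by (auto simp: same_def opp_def)
  show 2: "finite (bn u)" "finite (mn u)" for u using 1 by (auto simp: bn_def mn_def)
  show "finite MP" using 2 by (auto simp: MP_def)
  have "BP \<subseteq> {..<n} \<times> {..<n}" by (auto simp: BP_def bn_def same_def)
  then show "finite BP" by (rule finite_subset) simp
qed

lemma card_MP: "card MP = (\<Sum>u<n. card (mn u))"
  by (simp add: MP_def)

lemma same_opp: "same u \<inter> opp u = {}" "same u \<union> opp u = {..<n}"
  by (auto simp: same_def opp_def)

lemma bnD: "v \<in> bn u \<Longrightarrow> u < n \<and> v < n \<and> u \<noteq> v \<and> {u, v} \<in> G \<and> same v = same u \<and> opp v = opp u"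
  using graph_onD[OF graph] by (auto simp: bn_def same_def opp_def)

lemma bn_sym: "v \<in> bn u \<Longrightarrow> u \<in> bn v"
  using graph_onD[OF graph, of u v] by (auto simp: bn_def same_def insert_commute)

lemma mn_sym: "v \<in> mn u \<Longrightarrow> u < n \<Longrightarrow> u \<in> mn v"
  by (auto simp: mn_def opp_def insert_commute)

lemma finite_paths: "finite (paths k u v)"
  unfolding paths_def by (rule finite_subset[OF _ finite_alt[of "opp u" "same u - {u, v}" "2 * k - 1"]]) auto

lemma paths_nth:
  assumes "ys \<in> paths k u v" "v \<in> bn u" "k \<ge> 1"
  shows "length ys = 2 * k - 1" "distinct (u # ys @ [v])"
    "i < 2 * k + 1 \<Longrightarrow> (u # ys @ [v]) ! i \<in> (if even i then same u else opp u)"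
    "cyc (u # ys @ [v]) \<subseteq> G"
proof -
  have "opp u \<inter> (same u - {u,v}) = {}" using same_opp by auto
  then have y: "length ys = 2 * k - 1" "distinct ys" "\<And>i. i < 2 * k - 1 \<Longrightarrow> ys ! i \<in> (if even i then opp u else same u - {u,v})"
    using assms(1) by (auto simp: paths_def alt_iff)
  show "length ys = 2 * k - 1" by fact
  have uv: "u < n" "v < n" "u \<noteq> v" "{u, v} \<in> G" "u \<in> same u" "v \<in> same u" using bnD[OF assms(2)] assms(2) by (auto simp: bn_def same_def)
  have "u \<notin> set ys \<and> v \<notin> set ys"
    using y uv same_opp(1)[of u] by (fastforce simp: in_set_conv_nth split: if_splits)
  then show "distinct (u # ys @ [v])" using y uv by auto
  show "(u # ys @ [v]) ! i \<in> (if even i then same u else opp u)" if il: "i < 2 * k + 1" for i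
  proof -
    consider "i = 0" | "i = 2 * k" "i > 0" | j where "i = Suc j" "j < 2 * k - 1"
      using il assms(3) by (cases i) force+
    then show ?thesis
    proof cases
      case 2
      then have "(u # ys @ [v]) ! i = v" using y(1) by (simp add: nth_Cons' nth_append)
      then show ?thesis using 2 uv by simp
    next
      case 3
      then have "(u # ys @ [v]) ! i = ys ! j" using y(1) by (simp add: nth_append)
      then show ?thesis using y(3)[OF 3(2)] 3 by (auto split: if_splits)
    qed (use uv in simp)
  qed
  have "\<forall>i<2 * k. {(u # ys @ [v]) ! i, (u # ys @ [v]) ! Suc i} \<in> G"
    using assms(1) by (auto simp: paths_def)
  moreover have "length (u # ys @ [v]) = Suc (2 * k)" using y(1) assms(3) by simp
  ultimately show "cyc (u # ys @ [v]) \<subseteq> G"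
    using uv(4) by (subst cyc_conv) (auto simp: insert_commute simp del: nth_Cons_Suc)
qed

lemma copies_ge:
  assumes k: "k \<ge> 1"
  shows "(\<Sum>(u, v)\<in>BP. card (paths k u v)) \<le> copies G (cycle_graph (2 * k + 1))"
proof -
  let ?S = "Sigma BP (\<lambda>(u, v). paths k u v)"
  let ?f = "\<lambda>((u, v), ys). cyc (u # ys @ [v])"
  let ?C = "cyc ` {xs. length xs = 2 * k + 1 \<and> distinct xs \<and> cyc xs \<subseteq> G}"
  have "(\<Sum>(u, v)\<in>BP. card (paths k u v)) = card ?S"
    by (subst card_SigmaI) (auto simp: finite_paths split: prod.splits intro!: sum.cong)
  also have "... \<le> card ?C"
  proof (rule card_inj_on_le)
    show "finite ?C" using finite_cycles finite_graph_on[OF graph] by auto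
    show "?f ` ?S \<subseteq> ?C"
    proof
      fix e assume "e \<in> ?f ` ?S"
      then obtain u v ys where e: "e = cyc (u # ys @ [v])" "v \<in> bn u" "ys \<in> paths k u v" by (auto simp: BP_def)
      then show "e \<in> ?C" using paths_nth[OF e(3,2) k] k by (intro image_eqI[of _ _ "u # ys @ [v]"]) auto
    qed
    show "inj_on ?f ?S"
    proof (rule inj_onI)
      fix s t assume st: "s \<in> ?S" "t \<in> ?S" "?f s = ?f t"
      obtain u v ys u' v' ys' where s: "s = ((u, v), ys)" and t: "t = ((u', v'), ys')" by (metis surj_pair)
      have b: "(u, v) \<in> BP" "(u', v') \<in> BP" and y: "ys \<in> paths k u v" "ys' \<in> paths k u' v'"
        and eq: "cyc (u # ys @ [v]) = cyc (u' # ys' @ [v'])"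
        using st unfolding s t by auto
      have b': "v \<in> bn u" "v' \<in> bn u'" "u < v" "u' < v'" using b by (auto simp: BP_def)
      note p = paths_nth[OF y(1) b'(1) k] and p' = paths_nth[OF y(2) b'(2) k]
      have len: "length (u # ys @ [v]) = 2 * k + 1" "length (u' # ys' @ [v']) = 2 * k + 1" using p(1) p'(1) k by auto
      have "{v, u} \<in> cyc (u' # ys' @ [v'])" unfolding eq[symmetric] by (subst cyc_conv) auto
      then consider "{v, u} = {v', u'}" | i where "i < 2 * k" "{v, u} = {(u' # ys' @ [v']) ! i, (u' # ys' @ [v']) ! Suc i}"
        using len(2) by (subst (asm) cyc_conv) auto
      then have uv: "u = u' \<and> v = v'"
      proof cases
        case 1
        then show ?thesis using b' by (auto simp: doubleton_eq_iff)
      next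
        case 2
        have "(u' # ys' @ [v']) ! i \<in> (if even i then same u' else opp u')"
          "(u' # ys' @ [v']) ! Suc i \<in> (if even (Suc i) then same u' else opp u')"
          using p'(3)[of i] p'(3)[of "Suc i"] 2(1) by auto
        \<comment> \<open>Consecutive vertices of the path lie on opposite sides, so this edge
          crosses the cut and cannot be the bad edge \<open>uv\<close>.\<close>
        then have "((u' # ys' @ [v']) ! i \<in> A) \<noteq> ((u' # ys' @ [v']) ! Suc i \<in> A)"
          by (auto simp: same_def opp_def split: if_splits)
        moreover have "v \<in> A \<longleftrightarrow> u \<in> A" using b' by (auto simp: bn_def same_def)
        ultimately show ?thesis using 2(2) by (metis doubleton_eq_iff)
      qed
      have "u # ys @ [v] = u' # ys' @ [v']"
        by (rule cyc_inj[OF len p(2) p'(2) _ eq]) (use uv k in auto)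
      then show "s = t" unfolding s t by simp
    qed
  qed
  also have "... = copies G (cycle_graph (2 * k + 1))" by (simp add: copies_cycle_graph)
  finally show ?thesis .
qed

text \<open>Union bound over the \<open>2 * k\<close> edges of a path. The two end edges start at
  fixed vertices, so a missing one at \<open>u\<close> excludes exactly the fraction
  \<open>card (mn u) / card (opp u)\<close> of all alternating lists, and likewise at
  \<open>v\<close>; inner edges are estimated crudely through \<open>MP\<close>.\<close>

lemma paths_ge:
  assumes k: "k \<ge> 1" and uv: "v \<in> bn u"
  defines "c \<equiv> real (altn (2 * k - 1) (card (opp u)) (card (same u) - 2))"
  shows "real (card (paths k u v)) \<ge> c * (1 - (real (card (mn u)) + real (card (mn v))) / real (card (opp u)))
      - real (2 * k - 2) * real (card MP) * real n ^ (2 * k - 3)"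
proof -
  let ?X = "opp u" and ?Y = "same u - {u, v}"
  define j where "j = k - 1"
  have kj: "2 * k - 1 = Suc (2 * j)" "2 * k - 2 = 2 * j" using k by (auto simp: j_def)
  let ?S = "alt (Suc (2 * j)) ?X ?Y"
  have disj: "?X \<inter> ?Y = {}" using same_opp by auto
  have fin: "finite ?X" "finite ?Y" by auto
  have finS: "finite ?S" using finite_alt[OF fin] by blast
  have b: "u < n" "v < n" "u \<noteq> v" "{u, v} \<in> G" "u \<in> same u" "v \<in> same u" "opp v = opp u"
    using bnD[OF uv] uv by (auto simp: bn_def same_def)
  have cY: "card ?Y = card (same u) - 2" using b by (simp add: card_Diff_subset)
  have mn: "mn u \<subseteq> ?X" "mn v \<subseteq> ?X" using b by (auto simp: mn_def)
  let ?w = "altn (2 * j) (card ?Y) (card ?X - 1)"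
  let ?S1 = "{ys \<in> ?S. hd ys \<in> mn u}" and ?S2 = "{ys \<in> ?S. last ys \<in> mn v}"
  let ?Q = "\<lambda>i. {ys \<in> ?S. (ys ! i, ys ! Suc i) \<in> MP}"
  have c1: "card ?S1 = card (mn u) * ?w" using card_alt_hd[OF fin mn(1)] .
  have c2: "card ?S2 = card (mn v) * ?w" using card_alt_last[OF fin mn(2) disj] .
  have S_in: "length ys = Suc (2*j)" "\<And>i. i < Suc (2*j) \<Longrightarrow> ys ! i \<in> (if even i then ?X else ?Y)" if "ys \<in> ?S" for ys
    using that unfolding alt_iff[OF disj] by auto
  have S_V: "set ys \<subseteq> {..<n}" if "ys \<in> ?S" for ys
  proof
    fix x assume "x \<in> set ys"
    then obtain i where "i < length ys" "x = ys ! i" by (auto simp: in_set_conv_nth)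
    then show "x \<in> {..<n}" using S_in[OF that] by (fastforce simp: same_def opp_def split: if_splits)
  qed
  have cQ: "card (?Q i) \<le> card MP * n ^ (2 * j - 1)" if "i < 2 * j" for i
  proof -
    have "?Q i \<subseteq> {ys. length ys = Suc (2*j) \<and> set ys \<subseteq> {..<n} \<and> (ys ! i, ys ! Suc i) \<in> MP}" (is "_ \<subseteq> ?Z")
      using S_V S_in(1) by blast
    moreover have "finite ?Z" by (rule finite_subset[OF _ finite_lists_length_eq[of "{..<n}" "Suc (2*j)"]]) auto
    ultimately have "card (?Q i) \<le> card ?Z" by (rule card_mono[rotated])
    also have "... \<le> card MP * card {..<n} ^ (Suc (2*j) - 2)" by (rule card_lists_consecutive) (use that in auto)
    finally show ?thesis using that by simp
  qed
  have "?S \<subseteq> paths k u v \<union> ?S1 \<union> ?S2 \<union> (\<Union>i<2*j. ?Q i)"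
  proof
    fix ys assume ys: "ys \<in> ?S"
    show "ys \<in> paths k u v \<union> ?S1 \<union> ?S2 \<union> (\<Union>i<2*j. ?Q i)"
    proof (rule ccontr)
      assume no: "\<not> ?thesis"
      have ne: "ys \<noteq> []" using S_in(1)[OF ys] by auto
      have h: "{u, ys ! 0} \<in> G"
      proof (rule ccontr)
        assume "{u, ys ! 0} \<notin> G"
        then have "hd ys \<in> mn u" using S_in(2)[OF ys, of 0] ne by (simp add: mn_def hd_conv_nth)
        then show False using no ys by blast
      qed
      have l: "{ys ! (2*j), v} \<in> G"
      proof (rule ccontr)
        assume "{ys ! (2*j), v} \<notin> G"
        then have "last ys \<in> mn v" using S_in(1)[OF ys] S_in(2)[OF ys, of "2 * j"] ne b(7) by (simp add: mn_def last_conv_nth insert_commute)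
        then show False using no ys by blast
      qed
      have m: "{ys ! i, ys ! Suc i} \<in> G" if "i < 2 * j" for i
      proof (rule ccontr)
        assume "{ys ! i, ys ! Suc i} \<notin> G"
        moreover have "ys ! i \<in> (if even i then ?X else ?Y)" "ys ! Suc i \<in> (if even (Suc i) then ?X else ?Y)"
          using S_in(2)[OF ys, of i] S_in(2)[OF ys, of "Suc i"] that by auto
        ultimately have "(ys ! i, ys ! Suc i) \<in> MP"
          by (auto simp: MP_def mn_def opp_def same_def split: if_splits)
        then show False using no ys that by blast
      qed
      have "{(u # ys @ [v]) ! i, (u # ys @ [v]) ! Suc i} \<in> G" if i: "i < 2 * k" for i
      proof (cases i)
        case 0
        then show ?thesis using h ne by (simp add: nth_append)
      next
        case (Suc r)
        show ?thesis
        proof (cases "r = 2 * j")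
          case True
          then show ?thesis using l Suc S_in(1)[OF ys] by (simp add: nth_append)
        next
          case False
          then have "r < 2 * j" using Suc i kj by linarith
          then show ?thesis using m Suc S_in(1)[OF ys] by (simp add: nth_append)
        qed
      qed
      then have "ys \<in> paths k u v" using ys kj unfolding paths_def by simp
      then show False using no by blast
    qed
  qed
  then have "card ?S \<le> card (paths k u v \<union> ?S1 \<union> ?S2 \<union> (\<Union>i<2*j. ?Q i))"
    by (rule card_mono[rotated]) (use finS in \<open>auto simp: finite_paths simp del: alt.simps\<close>)
  also have "... \<le> card (paths k u v) + card ?S1 + card ?S2 + card (\<Union>i<2*j. ?Q i)"
    by (meson add_le_mono card_Un_le le_refl order_trans)
  also have "card (\<Union>i<2*j. ?Q i) \<le> (\<Sum>i<2*j. card (?Q i))" by (rule card_UN_le) simp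
  also have "(\<Sum>i<2*j. card (?Q i)) \<le> (\<Sum>i<2*j. card MP * n ^ (2 * j - 1))"
    by (rule sum_mono) (use cQ in auto)
  finally have "card ?S \<le> card (paths k u v) + card (mn u) * ?w + card (mn v) * ?w + 2 * j * (card MP * n ^ (2 * j - 1))"
    unfolding c1 c2 by simp
  then have "real (card ?S) \<le> real (card (paths k u v) + card (mn u) * ?w + card (mn v) * ?w + 2 * j * (card MP * n ^ (2 * j - 1)))"
    by (rule of_nat_mono)
  then have main: "real (card ?S) \<le> real (card (paths k u v)) + (real (card (mn u)) + real (card (mn v))) * real ?w
     + real (2 * j) * real (card MP) * real n ^ (2 * j - 1)"
    by (simp add: algebra_simps)
  have cS: "real (card ?S) = c" unfolding c_def kj card_alt[OF fin] cY ..
  have cw: "c = real (card ?X) * real ?w" unfolding c_def kj cY by simp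
  \<comment> \<open>If \<open>opp u\<close> is empty, the quotient is 0 by convention, and the
    right-hand side vanishes because \<open>mn u\<close> and \<open>mn v\<close> are empty.\<close>
  have "c * ((real (card (mn u)) + real (card (mn v))) / real (card ?X)) = (real (card (mn u)) + real (card (mn v))) * real ?w"
  proof (cases "card ?X = 0")
    case True
    then have "opp u = {}" by simp
    then have "mn u = {}" "mn v = {}" using mn by auto
    then show ?thesis by simp
  qed (simp add: cw)
  then have "c * (1 - (real (card (mn u)) + real (card (mn v))) / real (card ?X)) = c - (real (card (mn u)) + real (card (mn v))) * real ?w"
    by (simp add: right_diff_distrib)
  \<comment> \<open>For \<open>k = 1\<close> both exponents truncate to 0, and the error term has
    the factor 0.\<close>
  moreover have "2 * j - 1 = 2 * k - 3" using kj by auto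
  ultimately show ?thesis using main unfolding cS kj by simp
qed

end

section \<open>Stability\<close>


definition nb :: "nat \<Rightarrow> nat set set \<Rightarrow> nat \<Rightarrow> nat set" where
  "nb n G x = {v \<in> {..<n}. {x, v} \<in> G}"

text \<open>Counts ordered pairs, so \<open>oe G X X\<close> is twice the number of edges inside
  \<open>X\<close>; real-valued for the averaging below.\<close>

definition oe :: "nat set set \<Rightarrow> nat set \<Rightarrow> nat set \<Rightarrow> real" where
  "oe G X Y = (\<Sum>x\<in>X. \<Sum>y\<in>Y. of_bool ({x, y} \<in> G))"

lemma oe_sym: "oe G X Y = oe G Y X"
  unfolding oe_def by (subst sum.swap) (simp add: insert_commute)

lemma oe_nonneg: "oe G X Y \<ge> 0"
  unfolding oe_def by (intro sum_nonneg) auto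

lemma oe_diff_left: "finite X \<Longrightarrow> Z \<subseteq> X \<Longrightarrow> oe G X Y = oe G (X - Z) Y + oe G Z Y"
  unfolding oe_def by (rule sum.subset_diff)

lemma oe_diff_right: "finite Y \<Longrightarrow> Z \<subseteq> Y \<Longrightarrow> oe G X Y = oe G X (Y - Z) + oe G X Z"
  using oe_diff_left[of Y Z G X] unfolding oe_sym[of G X] .

lemma oe_le:
  assumes "finite X" "finite Y"
  shows "oe G X Y \<le> real (card X) * real (card Y)"
proof -
  have "oe G X Y \<le> (\<Sum>x\<in>X. \<Sum>y\<in>Y. 1)" unfolding oe_def by (intro sum_mono) auto
  then show ?thesis by simp
qed

lemma oe_eq_card: "finite X \<Longrightarrow> finite Y \<Longrightarrow> oe G X Y = real (card {(x, y). x \<in> X \<and> y \<in> Y \<and> {x, y} \<in> G})"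
proof -
  assume f: "finite X" "finite Y"
  have "oe G X Y = (\<Sum>(x, y)\<in>X \<times> Y. of_bool ({x, y} \<in> G))"
    unfolding oe_def by (rule sum.cartesian_product)
  also have "... = (\<Sum>p\<in>{(x, y). x \<in> X \<and> y \<in> Y \<and> {x, y} \<in> G}. 1)"
    by (rule sum.mono_neutral_cong_right) (use f in auto)
  finally show ?thesis by simp
qed

lemma oe_singleton: "finite Y \<Longrightarrow> oe G {x} Y = real (card {y \<in> Y. {x, y} \<in> G})"
proof -
  assume "finite Y"
  moreover have "{y \<in> Y. {x, y} \<in> G} = Y \<inter> {y. {x, y} \<in> G}" by auto
  ultimately show ?thesis by (simp add: oe_def sum_of_bool_eq)
qed

lemma handshake:
  assumes "graph_on n G"
  shows "oe G {..<n} {..<n} = 2 * real (card G)"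
proof -
  let ?P = "\<lambda>e. {(x, y). {x, y} = (e :: nat set)}"
  have two: "finite (?P e) \<and> card (?P e) = 2" if eG: "e \<in> G" for e
  proof -
    obtain x y where e: "e = {x, y}" "x \<noteq> y" using eG assms unfolding graph_on_def by blast
    then have "?P e = {(x, y), (y, x)}" by (auto simp: doubleton_eq_iff)
    then show ?thesis using e by simp
  qed
  have "{(x, y). x \<in> {..<n} \<and> y \<in> {..<n} \<and> {x, y} \<in> G} = (\<Union>e\<in>G. ?P e)"
    using graph_onD[OF assms] by auto
  also have "card ... = (\<Sum>e\<in>G. card (?P e))"
    by (rule card_UN_disjoint) (use two finite_graph_on[OF assms] in auto)
  also have "... = 2 * card G" using two by simp
  finally show ?thesis by (subst oe_eq_card) auto
qed

text \<open>In a smallest subset of density above \<open>\<theta>\<close> no vertex can have degree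
  at most \<open>\<theta> / 2\<close>: deleting it would remove at most \<open>\<theta>\<close>
  ordered pairs and leave a smaller dense subset.\<close>

lemma min_degree_subset:
  assumes "finite W0" "oe G W0 W0 > \<theta> * real (card W0)"
  shows "\<exists>W\<subseteq>W0. W \<noteq> {} \<and> (\<forall>v\<in>W. 2 * real (card {w \<in> W. {v, w} \<in> G}) > \<theta>)"
proof -
  let ?P = "\<lambda>W. W \<subseteq> W0 \<and> oe G W W > \<theta> * real (card W)"
  obtain W where W: "?P W" "\<And>W'. ?P W' \<Longrightarrow> card W \<le> card W'"
    using ex_has_least_nat[of ?P W0 card] assms by blast
  have fin: "finite W" using W(1) assms(1) finite_subset by blast
  have "W \<noteq> {}" using W(1) by (auto simp: oe_def)
  moreover have "2 * real (card {w \<in> W. {v, w} \<in> G}) > \<theta>" if v: "v \<in> W" for v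
  proof -
    have "card (W - {v}) < card W" using v fin by (meson card_Diff1_less)
    then have "\<not> ?P (W - {v})" using W(2) by (meson not_le)
    then have a: "oe G (W - {v}) (W - {v}) \<le> \<theta> * real (card (W - {v}))" using W(1) by auto
    have c: "real (card (W - {v})) = real (card W) - 1" using v fin
      by (metis One_nat_def card_Suc_Diff1 diff_Suc_1 of_nat_Suc add_diff_cancel_left')
    have "oe G W W = oe G (W - {v}) W + oe G {v} W" using v fin by (intro oe_diff_left) auto
    also have "oe G (W - {v}) W = oe G (W - {v}) (W - {v}) + oe G (W - {v}) {v}" using v fin by (intro oe_diff_right) auto
    also have "oe G (W - {v}) {v} \<le> oe G {v} W"
      unfolding oe_sym[of G "W - {v}"] using oe_diff_right[of W "{v}" G "{v}"] v fin oe_nonneg[of G "{v}" "{v}"] by auto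
    finally have "oe G W W \<le> oe G (W - {v}) (W - {v}) + 2 * oe G {v} W" by simp
    then have "\<theta> * real (card W) < \<theta> * (real (card W) - 1) + 2 * oe G {v} W" using a c W(1) by auto
    then show ?thesis unfolding oe_singleton[OF fin] by (simp add: algebra_simps)
  qed
  ultimately show ?thesis using W(1) by blast
qed

definition plists :: "nat set set \<Rightarrow> nat set \<Rightarrow> nat \<Rightarrow> nat list set" where
  "plists G W J = {ys. length ys = J \<and> distinct ys \<and> set ys \<subseteq> W \<and> (\<forall>i. Suc i < J \<longrightarrow> {ys ! i, ys ! Suc i} \<in> G)}"

lemma finite_plists: "finite W \<Longrightarrow> finite (plists G W J)"
  by (rule finite_subset[OF _ finite_lists_length_eq[of W J]]) (auto simp: plists_def)

text \<open>Greedy extension at the front: of the at least \<open>d\<close> neighbours of the head,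
  at most as many are blocked as the list is long. Using the final length in every factor gives a
  pure power.\<close>

lemma card_plists_ge:
  assumes fin: "finite W" and ne: "W \<noteq> {}" and deg: "\<And>v. v \<in> W \<Longrightarrow> card {w \<in> W. {v, w} \<in> G} \<ge> d"
  shows "card (plists G W (Suc J)) \<ge> (d - Suc J) ^ Suc J"
proof (induction J)
  case 0
  obtain v where "v \<in> W" using ne by auto
  then have "d \<le> card W" using deg card_mono[OF fin, of "{w \<in> W. {v, w} \<in> G}"] by fastforce
  moreover have "plists G W (Suc 0) = (\<lambda>w. [w]) ` W"
    by (auto simp: plists_def length_Suc_conv)
  then have "card (plists G W (Suc 0)) = card W" by (simp add: card_image inj_on_def)
  ultimately show ?case by simp
next
  case (Suc J)
  let ?N = "\<lambda>ys. {w \<in> W. {hd ys, w} \<in> G} - set ys"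
  let ?S = "Sigma (plists G W (Suc J)) ?N"
  let ?f = "\<lambda>(ys, z). z # ys"
  have N: "d - Suc (Suc J) \<le> card (?N ys)" if ys: "ys \<in> plists G W (Suc J)" for ys
  proof -
    have "ys \<noteq> []" "set ys \<subseteq> W" "length ys = Suc J" using ys by (auto simp: plists_def)
    then have "d \<le> card {w \<in> W. {hd ys, w} \<in> G}" using deg[of "hd ys"] hd_in_set[of ys] by blast
    moreover have "card (set ys) \<le> Suc J" using card_length[of ys] \<open>length ys = Suc J\<close> by simp
    moreover have "card {w \<in> W. {hd ys, w} \<in> G} - card (set ys) \<le> card (?N ys)" by (rule diff_card_le_card_Diff) simp
    ultimately show ?thesis by linarith
  qed
  have "(d - Suc (Suc J)) ^ Suc (Suc J) = (d - Suc (Suc J)) ^ Suc J * (d - Suc (Suc J))" by simp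
  also have "... \<le> (d - Suc J) ^ Suc J * (d - Suc (Suc J))"
    by (intro mult_le_mono1 power_mono) auto
  also have "... \<le> card (plists G W (Suc J)) * (d - Suc (Suc J))" using Suc by (intro mult_le_mono1)
  also have "... = (\<Sum>ys\<in>plists G W (Suc J). d - Suc (Suc J))" by simp
  also have "... \<le> (\<Sum>ys\<in>plists G W (Suc J). card (?N ys))" by (rule sum_mono) (rule N)
  also have "... = card ?S"
    by (subst card_SigmaI) (use fin in \<open>auto simp: finite_plists\<close>)
  also have "... \<le> card (plists G W (Suc (Suc J)))"
  proof (rule card_inj_on_le[of ?f])
    show "inj_on ?f ?S" by (auto simp: inj_on_def)
    show "finite (plists G W (Suc (Suc J)))" using fin by (rule finite_plists)
    show "?f ` ?S \<subseteq> plists G W (Suc (Suc J))"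
    proof
      fix xs assume "xs \<in> ?f ` ?S"
      then obtain ys z where xs: "xs = z # ys" "ys \<in> plists G W (Suc J)" "z \<in> ?N ys" by auto
      have "{xs ! i, xs ! Suc i} \<in> G" if "Suc i < Suc (Suc J)" for i
      proof (cases i)
        case 0
        moreover have "ys \<noteq> []" using xs(2) by (auto simp: plists_def)
        ultimately show ?thesis using xs by (simp add: hd_conv_nth insert_commute)
      next
        case (Suc j)
        then show ?thesis using xs that by (auto simp: plists_def)
      qed
      then show "xs \<in> plists G W (Suc (Suc J))" using xs by (auto simp: plists_def)
    qed
  qed
  finally show ?case .
qed

lemma cyc_in_graph:
  assumes "graph_on n G" "cyc xs \<subseteq> G"
  shows "set xs \<subseteq> {..<n}"
proof -
  have "\<Union>G \<subseteq> {..<n}" using assms(1) by (auto simp: graph_on_def)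
  then show ?thesis using assms(2) Union_cyc[of xs] by blast
qed

text \<open>Lists with the same edge set share their vertex set, which has size \<open>L\<close>.
  The factor is generous; only its independence of \<open>n\<close> matters.\<close>

lemma card_cycle_lists_le:
  assumes "graph_on n G" "L \<ge> 1"
  shows "card {xs. length xs = L \<and> distinct xs \<and> cyc xs \<subseteq> G} \<le> copies G (cycle_graph L) * L ^ L"
proof -
  let ?S = "{xs. length xs = L \<and> distinct xs \<and> cyc xs \<subseteq> G}"
  let ?F = "\<lambda>e. {xs. set xs \<subseteq> \<Union>e \<and> length xs = L}"
  have fin: "finite (cyc ` ?S)" using finite_cycles finite_graph_on assms by blast
  have F: "finite (?F e) \<and> card (?F e) = L ^ L" if eS: "e \<in> cyc ` ?S" for e
  proof -
    obtain xs where xs: "e = cyc xs" "length xs = L" "distinct xs" using eS by blast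
    then have "\<Union>e = set xs" by (simp add: Union_cyc)
    then have "finite (\<Union>e)" "card (\<Union>e) = L" using xs by (auto simp: distinct_card)
    then show ?thesis by (simp add: finite_lists_length_eq card_lists_length_eq)
  qed
  have "?S \<subseteq> (\<Union>e\<in>cyc ` ?S. ?F e)"
  proof
    fix xs assume xs: "xs \<in> ?S"
    then have "xs \<in> ?F (cyc xs)" by (simp add: Union_cyc)
    then show "xs \<in> (\<Union>e\<in>cyc ` ?S. ?F e)" using xs by blast
  qed
  then have "card ?S \<le> card (\<Union>e\<in>cyc ` ?S. ?F e)"
    by (rule card_mono[rotated]) (use fin F in blast)
  also have "... \<le> (\<Sum>e\<in>cyc ` ?S. card (?F e))" by (rule card_UN_le[OF fin])
  also have "... = copies G (cycle_graph L) * L ^ L" using F by (simp add: copies_cycle_graph[OF assms(2)])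
  finally show ?thesis .
qed

text \<open>If \<open>N(x)\<close> spans many edges, it contains many paths on \<open>2k\<close> vertices, each closed up to a \<open>C\<^sub>2\<^sub>k\<^sub>+\<^sub>1\<close> by \<open>x\<close>.\<close>

lemma nbhd_sum_small:
  assumes k: "k \<ge> 1" and \<theta>: "\<theta> > 0"
  shows "\<exists>n0. \<forall>n\<ge>n0. \<forall>G. graph_on n G \<longrightarrow> real (copies G (cycle_graph (2 * k + 1))) \<le> real n ^ (2 * k) \<longrightarrow>
     (\<Sum>x<n. oe G (nb n G x) (nb n G x)) \<le> 2 * \<theta> * real n ^ 3"
proof -
  let ?L = "2 * k + 1"
  \<comment> \<open>Bounds the number of vertices with a dense neighbourhood: each starts at least
    \<open>(\<theta> * n / 4) ^ (2 * k)\<close> cycle lists, and there are at most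
    \<open>?L ^ ?L * n ^ (2 * k)\<close> of these in all.\<close>
  define K where "K = real (?L ^ ?L) * (4 / \<theta>) ^ (2 * k)"
  define n0 where "n0 = nat \<lceil>4 * (2 * real k + 1) / \<theta>\<rceil> + nat \<lceil>K / \<theta>\<rceil> + 1"
  have "(\<Sum>x<n. oe G (nb n G x) (nb n G x)) \<le> 2 * \<theta> * real n ^ 3"
    if n: "n \<ge> n0" and G: "graph_on n G" and cop: "real (copies G (cycle_graph ?L)) \<le> real n ^ (2 * k)" for n G
  proof -
    have n1: "real n \<ge> 4 * (2 * real k + 1) / \<theta>" and n2: "real n \<ge> K / \<theta>" and npos: "real n > 0"
      using n unfolding n0_def by linarith+
    have n1': "\<theta> * real n \<ge> 4 * (2 * real k + 1)" and n2': "\<theta> * real n \<ge> K"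
      using n1 n2 \<theta> by (simp_all add: field_simps)
    let ?N = "nb n G"
    have finN: "finite (?N x)" and cN: "card (?N x) \<le> n" for x
    proof -
      show "finite (?N x)" by (simp add: nb_def)
      have "?N x \<subseteq> {..<n}" by (auto simp: nb_def)
      then show "card (?N x) \<le> n" using card_mono[of "{..<n}" "?N x"] by simp
    qed
    let ?t = "\<lambda>x. oe G (?N x) (?N x)"
    define X where "X = {x. x < n \<and> ?t x > \<theta> * real n ^ 2}"
    have finX: "finite X" by (simp add: X_def)
    let ?S = "{xs. length xs = ?L \<and> distinct xs \<and> cyc xs \<subseteq> G}"
    have finS: "finite ?S"
      by (rule finite_subset[OF _ finite_lists_length_eq[of "{..<n}" ?L]]) (use cyc_in_graph[OF G] in auto)
    have big: "real (card (plists G (?N x) (2 * k))) \<ge> (\<theta> * real n / 4) ^ (2 * k)" if x: "x \<in> X" for x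
    proof -
      have "\<theta> * real n * real (card (?N x)) \<le> \<theta> * real n * real n"
        using cN[of x] \<theta> npos by (intro mult_left_mono) auto
      also have "... < ?t x" using x by (simp add: X_def power2_eq_square)
      finally obtain W where W: "W \<subseteq> ?N x" "W \<noteq> {}" "\<And>v. v \<in> W \<Longrightarrow> 2 * real (card {w \<in> W. {v, w} \<in> G}) > \<theta> * real n"
        using min_degree_subset[OF finN[of x], where \<theta> = "\<theta> * real n" and G = G] by blast
      have finW: "finite W" using W(1) finN finite_subset by blast
      define d where "d = nat \<lfloor>\<theta> * real n / 2\<rfloor>"
      have dW: "d \<le> card {w \<in> W. {v, w} \<in> G}" if "v \<in> W" for v
        using W(3)[OF that] unfolding d_def by linarith
      have k2: "2 * k = Suc (2 * k - 1)" using k by simp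
      have "(d - 2 * k) ^ (2 * k) \<le> card (plists G W (2 * k))"
        using card_plists_ge[OF finW W(2) dW, of "2 * k - 1"] k2 by metis
      also have "... \<le> card (plists G (?N x) (2 * k))"
        by (rule card_mono[OF finite_plists[OF finN]]) (use W(1) in \<open>auto simp: plists_def\<close>)
      finally have "real ((d - 2 * k) ^ (2 * k)) \<le> real (card (plists G (?N x) (2 * k)))" by (rule of_nat_mono)
      moreover have "\<theta> * real n / 4 \<le> real (d - 2 * k)"
      proof -
        have "real d > \<theta> * real n / 2 - 1" unfolding d_def using \<theta> npos by (simp add: of_nat_nat)
        then have "real d - 2 * real k \<ge> \<theta> * real n / 4" using n1' by (simp add: field_simps)
        moreover have "real d \<le> real (d - 2 * k) + 2 * real k" by linarith
        ultimately show ?thesis by linarith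
      qed
      then have "(\<theta> * real n / 4) ^ (2 * k) \<le> real (d - 2 * k) ^ (2 * k)"
        using \<theta> npos by (intro power_mono) auto
      ultimately show ?thesis unfolding of_nat_power by (rule order_trans[rotated])
    qed
    have inS: "x # ys \<in> ?S" if x: "x < n" and ys: "ys \<in> plists G (?N x) (2 * k)" for x ys
    proof -
      have len: "length ys = 2 * k" and ne: "ys \<noteq> []" using ys k by (auto simp: plists_def)
      have sub: "set ys \<subseteq> ?N x" and di: "distinct ys" using ys by (auto simp: plists_def)
      have "x \<notin> set ys" using sub graph_onD[OF G, of x x] by (auto simp: nb_def)
      moreover have "{last ys, x} \<in> G" "{x, hd ys} \<in> G"
        using sub last_in_set[OF ne] hd_in_set[OF ne] by (auto simp: nb_def insert_commute)
      moreover have "{(x # ys) ! i, (x # ys) ! Suc i} \<in> G" if "Suc i < length (x # ys)" for i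
      proof (cases i)
        case 0
        then show ?thesis using \<open>{x, hd ys} \<in> G\<close> ne by (simp add: hd_conv_nth)
      next
        case (Suc j)
        then show ?thesis using that ys len by (auto simp: plists_def)
      qed
      ultimately have "cyc (x # ys) \<subseteq> G" using ne
        by (subst cyc_conv) (auto simp del: nth_Cons_Suc)
      then show ?thesis using len di \<open>x \<notin> set ys\<close> by simp
    qed
    have "real (card X) * (\<theta> * real n / 4) ^ (2 * k) = (\<Sum>x\<in>X. (\<theta> * real n / 4) ^ (2 * k))" by simp
    also have "... \<le> (\<Sum>x\<in>X. real (card (plists G (?N x) (2 * k))))" by (rule sum_mono) (rule big)
    also have "... = real (card (Sigma X (\<lambda>x. plists G (?N x) (2 * k))))"
      by (subst card_SigmaI) (use finX finite_plists[OF finN] in auto)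
    also have "... \<le> real (card ?S)"
    proof -
      have "card (Sigma X (\<lambda>x. plists G (?N x) (2 * k))) \<le> card ?S"
        by (rule card_inj_on_le[of "\<lambda>(x, ys). x # ys"])
          (use inS finS in \<open>auto simp: inj_on_def X_def\<close>)
      then show ?thesis by simp
    qed
    also have "... \<le> real (copies G (cycle_graph ?L) * ?L ^ ?L)"
      using card_cycle_lists_le[OF G, of ?L] by (intro of_nat_mono) simp
    also have "... \<le> real n ^ (2 * k) * real (?L ^ ?L)"
      unfolding of_nat_mult using cop by (intro mult_right_mono) auto
    finally have "real (card X) * ((\<theta> / 4) ^ (2 * k)) * real n ^ (2 * k) \<le> real (?L ^ ?L) * real n ^ (2 * k)"
      by (simp add: power_mult_distrib power_divide mult_ac)
    then have "real (card X) * ((\<theta> / 4) ^ (2 * k)) \<le> real (?L ^ ?L)" using npos by simp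
    then have "real (card X) * ((\<theta> / 4) ^ (2 * k)) * (4 / \<theta>) ^ (2 * k) \<le> K"
      unfolding K_def using \<theta> by (intro mult_right_mono) auto
    moreover have "(\<theta> / 4) ^ (2 * k) * (4 / \<theta>) ^ (2 * k) = 1"
      using \<theta> by (simp add: power_mult_distrib[symmetric])
    ultimately have XK: "real (card X) \<le> K" by (simp add: mult.assoc)
    have tb: "?t x \<le> \<theta> * real n ^ 2 + (if x \<in> X then real n ^ 2 else 0)" if "x < n" for x
    proof (cases "x \<in> X")
      case True
      have "?t x \<le> real (card (?N x)) * real (card (?N x))" by (rule oe_le[OF finN finN])
      also have "... \<le> real n * real n" using cN[of x] by (intro mult_mono) auto
      finally show ?thesis using True \<theta> by (simp add: power2_eq_square) (smt (verit) mult_nonneg_nonneg of_nat_0_le_iff)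
    qed (use that in \<open>auto simp: X_def\<close>)
    have "(\<Sum>x<n. ?t x) \<le> (\<Sum>x<n. \<theta> * real n ^ 2 + (if x \<in> X then real n ^ 2 else 0))"
      by (rule sum_mono) (use tb in auto)
    also have "... = \<theta> * real n ^ 3 + real (card X) * real n ^ 2"
    proof -
      have "{..<n} \<inter> X = X" by (auto simp: X_def)
      then show ?thesis by (simp add: sum.distrib sum.If_cases power3_eq_cube power2_eq_square Int_commute)
    qed
    also have "... \<le> \<theta> * real n ^ 3 + (\<theta> * real n) * real n ^ 2"
      using XK n2' by (intro add_left_mono mult_right_mono) auto
    finally show ?thesis by (simp add: power3_eq_cube power2_eq_square)
  qed
  then show ?thesis by blast
qed

lemma sq_div4: "(n :: nat)\<^sup>2 div 4 = (n div 2) * (n - n div 2)"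
proof (cases "even n")
  case True
  then obtain m where "n = 2 * m" by blast
  then show ?thesis by (simp add: power2_eq_square)
next
  case False
  then obtain m where m: "n = 2 * m + 1" by (metis oddE)
  have "n\<^sup>2 = 4 * (m * (m + 1)) + 1" unfolding m by (simp add: power2_eq_square algebra_simps)
  then have "n\<^sup>2 div 4 = m * (m + 1)" by simp
  then show ?thesis unfolding m by simp
qed

lemma sq_div4_ge: "real n ^ 2 / 4 - 1 / 4 \<le> real (n\<^sup>2 div 4)"
proof -
  define l h where "l = n div 2" and "h = n - n div 2"
  have "n = l + h" and d: "h = l \<or> h = l + 1" unfolding l_def h_def by linarith+
  then have "real n ^ 2 = 4 * (real l * real h) + (real h - real l)\<^sup>2"
    by (simp add: power2_eq_square algebra_simps)
  moreover have "(real h - real l)\<^sup>2 \<le> 1" using d by auto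
  moreover have "real (n\<^sup>2 div 4) = real l * real h" unfolding sq_div4 l_def h_def by (rule of_nat_mult)
  ultimately show ?thesis by linarith
qed

text \<open>Furedi's cut, averaged: for the cut \<open>V = N(x) \<union> (V - N(x))\<close> the degree sum over \<open>V - N(x)\<close> compares the edges inside
  \<open>V - N(x)\<close> with those inside \<open>N(x)\<close>, and \<open>\<Sum>\<^sub>x \<Sum>\<^sub>v\<^sub>\<notin>\<^sub>N\<^sub>(\<^sub>x\<^sub>) d(v) = \<Sum>\<^sub>v d(v)(n - d(v)) \<le> n\<^sup>3/4\<close>.\<close>

lemma nbhd_cut_average:
  assumes G: "graph_on n G" and e: "card G \<ge> n\<^sup>2 div 4" and n: "n > 0"
  shows "\<exists>x<n. oe G ({..<n} - nb n G x) ({..<n} - nb n G x) + oe G (nb n G x) (nb n G x)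
     \<le> 1/2 + 2 * (\<Sum>x<n. oe G (nb n G x) (nb n G x)) / real n"
proof (rule ccontr)
  let ?V = "{..<n}"
  let ?N = "nb n G"
  let ?deg = "\<lambda>v. oe G {v} ?V"
  let ?a = "\<lambda>x. oe G (?V - ?N x) (?V - ?N x)" and ?b = "\<lambda>x. oe G (?N x) (?N x)"
  assume "\<not> ?thesis"
  then have no: "?a x + ?b x > 1/2 + 2 * (\<Sum>x<n. ?b x) / real n" if "x < n" for x using that by force
  have "(\<Sum>x<n. 1/2 + 2 * (\<Sum>x<n. ?b x) / real n) < (\<Sum>x<n. ?a x + ?b x)"
    by (rule sum_strict_mono) (use no n in auto)
  then have lt: "real n / 2 + 2 * (\<Sum>x<n. ?b x) < (\<Sum>x<n. ?a x) + (\<Sum>x<n. ?b x)"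
  proof -
    assume lt: "(\<Sum>x<n. 1/2 + 2 * (\<Sum>x<n. ?b x) / real n) < (\<Sum>x<n. ?a x + ?b x)"
    have "(\<Sum>x<n. 1/2 + 2 * (\<Sum>x<n. ?b x) / real n) = real n / 2 + 2 * (\<Sum>x<n. ?b x)"
      using n by (simp add: distrib_left)
    then show ?thesis using lt by (simp add: sum.distrib)
  qed
  \<comment> \<open>With \<open>c\<close> ordered pairs from \<open>V - N(x)\<close> to
    \<open>N(x)\<close>, the sum on the left is \<open>2 * (?a x + c)\<close> and the total is
    \<open>?a x + ?b x + 2 * c\<close>.\<close>
  have id: "2 * oe G (?V - ?N x) ?V = oe G ?V ?V + ?a x - ?b x" for x
  proof -
    have s: "?N x \<subseteq> ?V" by (auto simp: nb_def)
    have "oe G ?V ?V = oe G (?V - ?N x) ?V + oe G (?N x) ?V" using s by (intro oe_diff_left) auto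
    moreover have "oe G (?V - ?N x) ?V = ?a x + oe G (?V - ?N x) (?N x)" using s by (intro oe_diff_right) auto
    moreover have "oe G (?N x) ?V = oe G (?N x) (?V - ?N x) + ?b x" using s by (intro oe_diff_right) auto
    ultimately show ?thesis using oe_sym[of G "?N x" "?V - ?N x"] by simp
  qed
  have degV: "?deg v = (\<Sum>x<n. of_bool ({x, v} \<in> G))" for v
    by (simp add: oe_def insert_commute)
  have "oe G (?V - ?N x) ?V = (\<Sum>v<n. (1 - of_bool ({x, v} \<in> G)) * ?deg v)" for x
  proof -
    have "oe G (?V - ?N x) ?V = (\<Sum>v\<in>?V - ?N x. ?deg v)" by (simp add: oe_def)
    also have "... = (\<Sum>v<n. (1 - of_bool ({x, v} \<in> G)) * ?deg v)"
      by (rule sum.mono_neutral_cong_left) (auto simp: nb_def)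
    finally show ?thesis .
  qed
  then have "(\<Sum>x<n. oe G (?V - ?N x) ?V) = (\<Sum>x<n. \<Sum>v<n. (1 - of_bool ({x, v} \<in> G)) * ?deg v)" by simp
  also have "... = (\<Sum>v<n. \<Sum>x<n. (1 - of_bool ({x, v} \<in> G)) * ?deg v)" by (rule sum.swap)
  also have "... = (\<Sum>v<n. (real n - ?deg v) * ?deg v)"
    by (rule sum.cong) (simp_all add: sum_distrib_right[symmetric] sum_subtractf degV)
  also have "... \<le> (\<Sum>v<n. real n ^ 2 / 4)"
  proof (rule sum_mono)
    fix v
    have "0 \<le> (real n / 2 - ?deg v)\<^sup>2" by simp
    then show "(real n - ?deg v) * ?deg v \<le> real n ^ 2 / 4" by (simp add: power2_eq_square algebra_simps)
  qed
  finally have s: "(\<Sum>x<n. oe G (?V - ?N x) ?V) \<le> real n * (real n ^ 2 / 4)" by simp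
  have "(\<Sum>x<n. 2 * oe G (?V - ?N x) ?V) = real n * oe G ?V ?V + (\<Sum>x<n. ?a x) - (\<Sum>x<n. ?b x)"
    unfolding id by (simp add: sum.distrib sum_subtractf)
  then have "real n * oe G ?V ?V + (\<Sum>x<n. ?a x) - (\<Sum>x<n. ?b x) \<le> real n * (real n ^ 2 / 2)"
    using s by (simp add: sum_distrib_left[symmetric])
  moreover have "oe G ?V ?V \<ge> real n ^ 2 / 2 - 1 / 2"
  proof -
    have "real (n\<^sup>2 div 4) \<le> real (card G)" using e by (rule of_nat_mono)
    then show ?thesis using sq_div4_ge[of n] unfolding handshake[OF G] by linarith
  qed
  then have "real n * oe G ?V ?V \<ge> real n * (real n ^ 2 / 2 - 1 / 2)" using n by (intro mult_left_mono) auto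
  ultimately have "(\<Sum>x<n. ?a x) \<le> (\<Sum>x<n. ?b x) + real n / 2" by (simp add: algebra_simps)
  then show False using lt by simp
qed

section \<open>Cuts with few bad pairs\<close>

definition badp :: "nat \<Rightarrow> nat set set \<Rightarrow> nat set \<Rightarrow> (nat \<times> nat) set" where
  "badp n G A = {(x, y). x < n \<and> y < n \<and> {x, y} \<in> G \<and> (x \<in> A \<longleftrightarrow> y \<in> A)}"

lemma finite_badp: "finite (badp n G A)"
  by (rule finite_subset[of _ "{..<n} \<times> {..<n}"]) (auto simp: badp_def)

lemma badp_oe:
  assumes "A \<subseteq> {..<n}"
  shows "real (card (badp n G A)) = oe G A A + oe G ({..<n} - A) ({..<n} - A)"
proof -
  have fin: "finite A" using assms finite_subset by blast
  let ?P = "\<lambda>X. {(x, y). x \<in> X \<and> y \<in> X \<and> {x, y} \<in> G}"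
  have fP: "finite (?P X)" if "finite X" for X
    by (rule finite_subset[of _ "X \<times> X"]) (use that in auto)
  have e: "badp n G A = ?P A \<union> ?P ({..<n} - A)" using assms by (auto simp: badp_def)
  have "card (?P A \<union> ?P ({..<n} - A)) = card (?P A) + card (?P ({..<n} - A))"
    by (rule card_Un_disjoint[OF fP fP]) (use fin in auto)
  then have c: "card (badp n G A) = card (?P A) + card (?P ({..<n} - A))" unfolding e .
  have f2: "finite ({..<n} - A)" by simp
  show ?thesis unfolding oe_eq_card[OF fin fin] oe_eq_card[OF f2 f2] c of_nat_add ..
qed

context cut
begin

definition xn :: "nat \<Rightarrow> nat set" where "xn u = {v \<in> opp u. {u, v} \<in> G}"

lemma card_badp_split:
  assumes "u < n"
  shows "card (badp n G A) = card {(x, y) \<in> badp n G A. x \<noteq> u \<and> y \<noteq> u} + 2 * card (bn u)"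
proof -
  let ?R = "{(x, y) \<in> badp n G A. x \<noteq> u \<and> y \<noteq> u}"
  have loop: "{u, u} \<notin> G" using graph_onD[OF graph, of u u] by auto
  have e: "badp n G A = ?R \<union> (Pair u ` bn u \<union> (\<lambda>v. (v, u)) ` bn u)"
    using assms by (auto simp: badp_def bn_def same_def insert_commute)
  have fin: "finite ?R" by (rule finite_subset[OF _ finite_badp[of n G A]]) auto
  have "card (badp n G A) = card ?R + card (Pair u ` bn u \<union> (\<lambda>v. (v, u)) ` bn u)"
    by (subst e, rule card_Un_disjoint) (use fin in auto)
  also have "card (Pair u ` bn u \<union> (\<lambda>v. (v, u)) ` bn u) = card (Pair u ` bn u) + card ((\<lambda>v. (v, u)) ` bn u)"
    by (rule card_Un_disjoint) (use loop in \<open>auto simp: bn_def\<close>)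
  also have "... = 2 * card (bn u)" by (simp add: card_image inj_on_def)
  finally show ?thesis .
qed

lemma card_bn_sum: "(\<Sum>u<n. card (bn u)) = card (badp n G A)"
proof -
  have "badp n G A = Sigma {..<n} bn" by (auto simp: badp_def bn_def same_def)
  then show ?thesis by simp
qed

text \<open>Moving \<open>u\<close> across exchanges its bad and its cross neighbours and affects no
  pair avoiding \<open>u\<close>, so an optimal cut cannot have more of the former.\<close>

lemma local_max_cut:
  assumes min: "\<And>A'. A' \<subseteq> {..<n} \<Longrightarrow> card (badp n G A) \<le> card (badp n G A')" and u: "u < n"
  shows "card (bn u) \<le> card (xn u)"
proof -
  define A' where "A' = (if u \<in> A then A - {u} else insert u A)"
  have A': "A' \<subseteq> {..<n}" using A u by (auto simp: A'_def)
  interpret c: cut n G A' by unfold_locales (use graph A' in auto)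
  have loop: "{u, u} \<notin> G" using graph_onD[OF graph, of u u] by auto
  have mem: "v \<in> A' \<longleftrightarrow> v \<in> A" if "v \<noteq> u" for v using that by (auto simp: A'_def)
  have memu: "u \<in> A' \<longleftrightarrow> u \<notin> A" by (auto simp: A'_def)
  have "c.bn u = xn u"
    using loop mem memu unfolding c.bn_def c.same_def xn_def opp_def by auto (metis loop)+
  moreover have "{(x, y) \<in> badp n G A'. x \<noteq> u \<and> y \<noteq> u} = {(x, y) \<in> badp n G A. x \<noteq> u \<and> y \<noteq> u}"
    using mem by (auto simp: badp_def)
  ultimately have "card (badp n G A') = card {(x, y) \<in> badp n G A. x \<noteq> u \<and> y \<noteq> u} + 2 * card (xn u)"
    using c.card_badp_split[OF u] by simp
  then show ?thesis using min[OF A'] card_badp_split[OF u] by simp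
qed

end

text \<open>Some neighbourhood cut has few bad pairs; a cut minimising them has no more and is
  moreover locally optimal at each vertex. With \<open>\<theta> / 8\<close> the averaged sum
  contributes \<open>\<theta> / 2 * n^2\<close>, and the other half absorbs the additive
  1/2.\<close>

lemma stability:
  assumes k: "k \<ge> 1" and \<theta>: "\<theta> > 0"
  shows "\<exists>n0. \<forall>n\<ge>n0. \<forall>G. graph_on n G \<longrightarrow> card G \<ge> n\<^sup>2 div 4 \<longrightarrow>
     real (copies G (cycle_graph (2 * k + 1))) \<le> real n ^ (2 * k) \<longrightarrow>
     (\<exists>A\<subseteq>{..<n}. real (card (badp n G A)) \<le> \<theta> * real n ^ 2 \<and> (\<forall>u<n. card (cut.bn n G A u) \<le> card (cut.xn n G A u)))"
proof -
  obtain n0 where n0: "\<And>n G. n \<ge> n0 \<Longrightarrow> graph_on n G \<Longrightarrow> real (copies G (cycle_graph (2 * k + 1))) \<le> real n ^ (2 * k) \<Longrightarrow>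
     (\<Sum>x<n. oe G (nb n G x) (nb n G x)) \<le> 2 * (\<theta> / 8) * real n ^ 3"
    using nbhd_sum_small[OF k, of "\<theta> / 8"] \<theta> by auto
  have "\<exists>A\<subseteq>{..<n}. real (card (badp n G A)) \<le> \<theta> * real n ^ 2 \<and> (\<forall>u<n. card (cut.bn n G A u) \<le> card (cut.xn n G A u))"
    if n: "n \<ge> n0 + nat \<lceil>1 / \<theta>\<rceil> + 1" and G: "graph_on n G" and e: "card G \<ge> n\<^sup>2 div 4"
      and c: "real (copies G (cycle_graph (2 * k + 1))) \<le> real n ^ (2 * k)" for n G
  proof -
    have npos: "real n \<ge> 1" "real n \<ge> 1 / \<theta>" using n by linarith+
    have t1: "\<theta> * real n ^ 2 \<ge> 1"
    proof -
      have "1 \<le> \<theta> * real n" using npos \<theta> by (simp add: field_simps)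
      also have "... \<le> \<theta> * real n * real n" using npos \<theta> by simp
      finally show ?thesis by (simp add: power2_eq_square)
    qed
    let ?A0 = "\<lambda>x. {..<n} - nb n G x"
    obtain x where x: "x < n" "oe G (?A0 x) (?A0 x) + oe G (nb n G x) (nb n G x)
       \<le> 1/2 + 2 * (\<Sum>x<n. oe G (nb n G x) (nb n G x)) / real n"
      using nbhd_cut_average[OF G e] n by auto
    have "2 * (\<Sum>x<n. oe G (nb n G x) (nb n G x)) / real n \<le> 2 * (2 * (\<theta> / 8) * real n ^ 3) / real n"
      using n0[OF _ G c] n npos by (intro divide_right_mono mult_left_mono) auto
    also have "... = \<theta> / 2 * real n ^ 2" using npos by (simp add: power3_eq_cube power2_eq_square)
    finally have b: "oe G (?A0 x) (?A0 x) + oe G (nb n G x) (nb n G x) \<le> \<theta> * real n ^ 2"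
      using x(2) t1 by simp
    have nb_eq: "{..<n} - ?A0 x = nb n G x" by (auto simp: nb_def)
    let ?P = "\<lambda>A. A \<subseteq> {..<n}"
    obtain A where mc: "A \<subseteq> {..<n}" "\<And>A'. A' \<subseteq> {..<n} \<Longrightarrow> card (badp n G A) \<le> card (badp n G A')"
      using ex_has_least_nat[of ?P "{}" "\<lambda>A. card (badp n G A)"] by blast
    interpret cut n G A by unfold_locales (use G mc(1) in auto)
    have "card (badp n G A) \<le> card (badp n G (?A0 x))" by (rule mc(2)) auto
    then have "real (card (badp n G A)) \<le> real (card (badp n G (?A0 x)))" by simp
    also have "... \<le> \<theta> * real n ^ 2" using b badp_oe[of "?A0 x" n G] nb_eq by simp
    finally show ?thesis using mc(1) local_max_cut[OF mc(2)] by blast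
  qed
  then show ?thesis by blast
qed

section \<open>Falling factorial estimates\<close>


text \<open>\<open>cA k a b\<close> is the number of copies of \<open>C\<^sub>2\<^sub>k\<^sub>+\<^sub>1\<close> created by adding one edge to the part of size \<open>a\<close> of \<open>K\<^sub>a\<^sub>,\<^sub>b\<close>;
  \<open>cT k n\<close> is its value for the larger part of the balanced complete bipartite graph on \<open>n\<close> vertices.\<close>

definition cA :: "nat \<Rightarrow> nat \<Rightarrow> nat \<Rightarrow> nat" where
  "cA k a b = ff b k * ff (a - 2) (k - 1)"

definition cT :: "nat \<Rightarrow> nat \<Rightarrow> nat" where
  "cT k n = cA k (n - n div 2) (n div 2)"

lemma altn_cA: "k \<ge> 1 \<Longrightarrow> altn (2 * k - 1) b (a - 2) = cA k a b"
proof -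
  assume k: "k \<ge> 1"
  then have "2 * k - 1 = Suc (2 * (k - 1))" "Suc (k - 1) = k" by simp_all
  then show ?thesis using altn_odd[of "k - 1" b "a - 2"] by (simp add: cA_def del: altn.simps)
qed

lemma ff_snoc: "ff x (Suc j) = ff x j * (x - j)"
  by (simp add: ff_def)

lemma ff_le: "ff x k \<le> x ^ k"
proof -
  have "ff x k \<le> (\<Prod>i<k. x)" unfolding ff_def by (rule prod_mono) auto
  then show ?thesis by simp
qed

lemma ff_ge:
  assumes "real x - real k \<ge> y" "y \<ge> 0"
  shows "real (ff x k) \<ge> y ^ k"
proof -
  have "(\<Prod>i<k. y) \<le> (\<Prod>i<k. real (x - i))"
    by (rule prod_mono) (use assms in \<open>auto simp: of_nat_diff\<close>)
  then show ?thesis by (simp add: ff_def)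
qed

lemma cA_le: "a \<le> n \<Longrightarrow> b \<le> n \<Longrightarrow> k \<ge> 1 \<Longrightarrow> real (cA k a b) \<le> real n ^ (2 * k - 1)"
proof -
  assume h: "a \<le> n" "b \<le> n" "k \<ge> 1"
  have "cA k a b \<le> b ^ k * (a - 2) ^ (k - 1)" unfolding cA_def by (intro mult_le_mono ff_le)
  also have "... \<le> n ^ k * n ^ (k - 1)" using h by (intro mult_le_mono power_mono) auto
  also have "... = n ^ (2 * k - 1)" using h by (simp add: power_add[symmetric] mult_2)
  finally have "real (cA k a b) \<le> real (n ^ (2 * k - 1))" by (rule of_nat_mono)
  then show ?thesis by simp
qed

lemma cA_ge:
  assumes "real b - real k \<ge> y" "real a - 2 - real k \<ge> y" "y \<ge> 0" "k \<ge> 1"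
  shows "real (cA k a b) \<ge> y ^ (2 * k - 1)"
proof -
  have "y ^ (2 * k - 1) = y ^ k * y ^ (k - 1)" using assms by (simp add: power_add[symmetric] mult_2)
  also have "... \<le> real (ff b k) * real (ff (a - 2) (k - 1))"
    using assms by (intro mult_mono ff_ge) (auto simp: of_nat_diff)
  finally show ?thesis by (simp add: cA_def)
qed

text \<open>Both factors of \<open>cA\<close> have about \<open>k\<close> terms; multiplying them in pairs makes the first-order
  changes cancel, up to the one unpaired term.\<close>

lemma cA_Suc: "real (cA (Suc j) a b) = (\<Prod>i<j. real (b - i) * real (a - 2 - i)) * real (b - j)"
  by (simp add: cA_def ff_snoc) (simp add: ff_def prod.distrib)

lemma Bernoulli_prod_ge:
  fixes w :: real
  assumes "0 \<le> w" "w \<le> 1" "\<And>i. i < j \<Longrightarrow> 0 \<le> P i" "\<And>i. i < j \<Longrightarrow> Q i \<ge> P i * (1 - w)"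
  shows "(\<Prod>i<j. Q i) \<ge> (\<Prod>i<j. P i) * (1 - real j * w)"
proof -
  have "(\<Prod>i<j. P i) * (1 - real j * w) \<le> (\<Prod>i<j. P i) * (1 - w) ^ j"
    using Bernoulli_inequality[of "- w" j] assms by (intro mult_left_mono prod_nonneg) auto
  also have "... = (\<Prod>i<j. P i * (1 - w))" by (simp add: prod.distrib)
  also have "... \<le> (\<Prod>i<j. Q i)" by (rule prod_mono) (use assms in auto)
  finally show ?thesis .
qed

text \<open>Here \<open>s\<close> vertices move into the larger part, which carries the bad edge.
  Since \<open>h \<le> l + 1\<close>, the product of a pair of factors drops by at most
  \<open>s^2\<close>, a relative loss of second order because the factors are at least
  \<open>x\<close>. The unpaired factor \<open>l - j\<close> drops by \<open>s\<close> and gives the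
  main term \<open>s / x\<close>.\<close>

lemma cA_larger:
  fixes l h s j :: nat
  defines "x \<equiv> real l - real j - 3"
  assumes "x > 0" "real s \<le> x" "l \<le> h" "h \<le> l + 1"
  shows "real (cA (Suc j) (h + s) (l - s)) \<ge> real (cA (Suc j) h l) * (1 - real s / x - real j * (real s / x)\<^sup>2)"
proof -
  have ls: "l \<ge> s + j + 3" using assms(2,3) unfolding x_def by linarith
  let ?P = "\<lambda>i. real (l - i) * real (h - 2 - i)"
  let ?Q = "\<lambda>i. real (l - s - i) * real (h + s - 2 - i)"
  let ?w = "(real s / x)\<^sup>2"
  have sx: "0 \<le> real s / x" "real s / x \<le> 1" using assms(2,3) by auto
  have w: "0 \<le> ?w" "?w \<le> 1" using sx by (auto simp: power_le_one)
  have Q: "?Q i \<ge> ?P i * (1 - ?w)" if i: "i < j" for i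
  proof -
    have r: "real (l - i) = real l - real i" "real (h - 2 - i) = real h - 2 - real i"
      "real (l - s - i) = real l - real s - real i" "real (h + s - 2 - i) = real h + real s - 2 - real i"
      using ls i assms(4) by (auto simp: of_nat_diff)
    have x1: "real l - real i \<ge> x" "real h - 2 - real i \<ge> x" using i assms(4) unfolding x_def by auto
    have "x * x \<le> ?P i" unfolding r using x1 assms(2) by (intro mult_mono) auto
    then have "x * x * ?w \<le> ?P i * ?w" using w by (intro mult_right_mono) auto
    moreover have "x * x * ?w = real s * real s" using assms(2) by (simp add: power2_eq_square)
    moreover have "?Q i = ?P i + real s * (real l - real h + 2) - real s * real s" unfolding r by (simp add: algebra_simps)
    moreover have "real s * (real l - real h + 2) \<ge> 0" using assms(5) by (intro mult_nonneg_nonneg) auto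
    ultimately show ?thesis by (simp add: algebra_simps)
  qed
  have "(\<Prod>i<j. ?P i) * (1 - real j * ?w) \<le> (\<Prod>i<j. ?Q i)"
    by (rule Bernoulli_prod_ge[OF w _ Q]) auto
  then have 1: "(\<Prod>i<j. ?P i) * (1 - real j * ?w) * real (l - s - j) \<le> (\<Prod>i<j. ?Q i) * real (l - s - j)"
    by (intro mult_right_mono) auto
  have lj: "real (l - s - j) = real (l - j) - real s" "real (l - j) = real l - real j" using ls by (auto simp: of_nat_diff)
  have last: "real (l - s - j) \<ge> real (l - j) * (1 - real s / x)"
  proof -
    have "x * (real s / x) \<le> real (l - j) * (real s / x)"
      using sx lj unfolding x_def by (intro mult_right_mono) auto
    then show ?thesis unfolding lj(1) using assms(2) by (simp add: algebra_simps)
  qed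
  have big: "(1 - real j * ?w) * real (l - s - j) \<ge> real (l - j) * (1 - real s / x - real j * ?w)"
  proof -
    have "real (l - s - j) * (real j * ?w) \<le> real (l - j) * (real j * ?w)"
      using w by (intro mult_right_mono) auto
    then show ?thesis using last by (simp add: algebra_simps)
  qed
  have "real (cA (Suc j) h l) * (1 - real s / x - real j * ?w) = (\<Prod>i<j. ?P i) * (real (l - j) * (1 - real s / x - real j * ?w))"
    by (simp add: cA_Suc)
  also have "... \<le> (\<Prod>i<j. ?P i) * ((1 - real j * ?w) * real (l - s - j))"
    using big by (intro mult_left_mono prod_nonneg) auto
  also have "... \<le> (\<Prod>i<j. ?Q i) * real (l - s - j)" using 1 by (simp add: mult.assoc)
  finally show ?thesis by (simp add: cA_Suc)
qed

text \<open>Now the part carrying the bad edge shrinks from \<open>h\<close> to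
  \<open>h - t\<close>. The product of a pair of factors drops by at most
  \<open>2 * t + t^2 \<le> 3 * t^2\<close>, whereas the unpaired factor gains \<open>t\<close>; the
  bound on \<open>6 * j * t * l\<close> lets this first-order gain outweigh the second-order
  losses.\<close>

lemma cA_smaller:
  fixes l h t j :: nat
  defines "x \<equiv> real l - real j - 3"
  assumes "x > 0" "real t \<le> x / 2" "l \<le> h" "6 * real j * real t * real l \<le> x\<^sup>2"
  shows "real (cA (Suc j) (h - t) (l + t)) \<ge> real (cA (Suc j) h l)"
proof -
  have "real t \<le> x" using assms(2,3) by linarith
  then have lt: "l \<ge> t + j + 3" unfolding x_def by linarith
  let ?P = "\<lambda>i. real (l - i) * real (h - 2 - i)"
  let ?Q = "\<lambda>i. real (l + t - i) * real (h - t - 2 - i)"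
  let ?w = "3 * (real t / x)\<^sup>2"
  have tx: "0 \<le> real t / x" "real t / x \<le> 1 / 2" using assms(2,3) by (auto simp: field_simps)
  have "(real t / x)\<^sup>2 \<le> (1/2)\<^sup>2" using tx by (intro power_mono) auto
  then have w: "0 \<le> ?w" "?w \<le> 1" by (auto simp: power2_eq_square)
  have Q: "?Q i \<ge> ?P i * (1 - ?w)" if i: "i < j" for i
  proof -
    have r: "real (l - i) = real l - real i" "real (h - 2 - i) = real h - 2 - real i"
      "real (l + t - i) = real l + real t - real i" "real (h - t - 2 - i) = real h - real t - 2 - real i"
      using lt i assms(4) by (auto simp: of_nat_diff)
    have x1: "real l - real i \<ge> x" "real h - 2 - real i \<ge> x" using i assms(4) unfolding x_def by auto
    have "x * x \<le> ?P i" unfolding r using x1 assms(2) by (intro mult_mono) auto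
    then have "x * x * ?w \<le> ?P i * ?w" using w by (intro mult_right_mono) auto
    moreover have "x * x * ?w = 3 * (real t * real t)" using assms(2) by (simp add: power2_eq_square)
    moreover have "?Q i = ?P i + real t * (real h - real l) - 2 * real t - real t * real t" unfolding r by (simp add: algebra_simps)
    moreover have "real t * (real h - real l) \<ge> 0" using assms(4) by (intro mult_nonneg_nonneg) auto
    moreover have "real t \<le> real t * real t" by (cases t) auto
    ultimately show ?thesis by (simp add: algebra_simps)
  qed
  have 1: "(\<Prod>i<j. ?P i) * (1 - real j * ?w) \<le> (\<Prod>i<j. ?Q i)"
    by (rule Bernoulli_prod_ge[OF w _ Q]) auto
  have lj: "real (l + t - j) = real (l - j) + real t" "real (l - j) = real l - real j" using lt by (auto simp: of_nat_diff)
  have l0: "real l > 0" using lt by simp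
  define y where "y = real t / real l"
  define z where "z = real j * ?w"
  have y: "0 \<le> y" "y \<le> 1" using lt l0 by (auto simp: y_def)
  have z: "0 \<le> z" "z \<le> y / 2"
  proof -
    show "0 \<le> z" using w by (simp add: z_def)
    have "6 * real j * real t * real l * real t \<le> x\<^sup>2 * real t" using assms(5) by (intro mult_right_mono) auto
    then have "6 * real j * (real t)\<^sup>2 / x\<^sup>2 \<le> real t / real l" using assms(2) l0
      by (simp add: field_simps power2_eq_square)
    then show "z \<le> y / 2" unfolding z_def y_def by (simp add: power_divide)
  qed
  have "real (l - j) \<le> real (l - j) * ((1 - z) * (1 + y))"
  proof -
    have "z + z * y \<le> y" using z y mult_right_mono[of z "y/2" y] mult_left_mono[of y 1 y] by (simp add: mult.commute)
    then have "1 \<le> (1 - z) * (1 + y)" by (simp add: algebra_simps)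
    then show ?thesis by (simp add: mult_left_mono[of 1 _ "real (l - j)", simplified])
  qed
  also have "... = (1 - z) * (real (l - j) * (1 + y))" by simp
  also have "... \<le> (1 - z) * real (l + t - j)"
  proof (rule mult_left_mono)
    have "real (l - j) * y \<le> real l * y" using y by (intro mult_right_mono) auto
    also have "... = real t" using l0 by (simp add: y_def)
    finally show "real (l - j) * (1 + y) \<le> real (l + t - j)" unfolding lj(1) by (simp add: algebra_simps)
    show "0 \<le> 1 - z" using z y by simp
  qed
  finally have big: "real (l - j) \<le> (1 - z) * real (l + t - j)" .
  have "real (cA (Suc j) h l) = (\<Prod>i<j. ?P i) * real (l - j)" by (simp add: cA_Suc)
  also have "... \<le> (\<Prod>i<j. ?P i) * ((1 - z) * real (l + t - j))"
    using big by (intro mult_left_mono prod_nonneg) auto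
  also have "... \<le> (\<Prod>i<j. ?Q i) * real (l + t - j)"
    using mult_right_mono[OF 1, of "real (l + t - j)"] by (simp add: mult.assoc z_def)
  finally show ?thesis by (simp add: cA_Suc diff_right_commute)
qed

text \<open>The conclusions serve the cap on bad degrees, the size of error terms, and the
  comparison with the balanced case. In the last one the deficit of \<open>a * b\<close> counts
  additional bad edges; weighting it by \<open>1 - \<delta> / 4\<close> keeps a reserve that later
  pays for missing edges.\<close>

lemma cA_estimates:
  assumes k: "k \<ge> 1" and \<delta>: "0 < \<delta>" "\<delta> \<le> 1/2" and \<gamma>: "0 < \<gamma>" "\<gamma> \<le> \<delta> / 10" "\<gamma> \<le> 1 / (96 * real k)"
  shows "\<exists>n0. \<forall>n\<ge>n0. \<forall>a b. a + b = n \<longrightarrow> \<bar>real a - real b\<bar> \<le> 2 * \<gamma> * real n \<longrightarrow>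
     real (cA k a b) \<ge> (1 - 5 * \<gamma>) * real (cT k n) \<and>
     real (cA k a b) \<ge> (real n / 8) ^ (2 * k - 1) \<and>
     (\<forall>q. 0 \<le> q \<longrightarrow> q \<le> (1/2 - \<delta>) * real n \<longrightarrow>
        (q + (1 - \<delta> / 4) * (real (n\<^sup>2 div 4) - real a * real b)) * real (cA k a b) \<ge> q * real (cT k n))"
    (is "\<exists>n0. \<forall>n\<ge>n0. \<forall>a b. _ \<longrightarrow> _ \<longrightarrow> ?C1 n a b \<and> ?C2 n a b \<and> ?C3 n a b")
proof -
  define n0 where "n0 = nat \<lceil>1 / \<gamma>\<rceil> + nat \<lceil>(2 * real k + 6) / \<delta>\<rceil> + nat \<lceil>16 * real k / \<delta>\<rceil> + 32 * k + 100"
  define j where "j = k - 1"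
  have kj: "k = Suc j" using k by (simp add: j_def)
  show ?thesis
  proof (intro exI[of _ n0] allI impI)
    fix n a b :: nat assume n: "n0 \<le> n" and ab: "a + b = n" and d: "\<bar>real a - real b\<bar> \<le> 2 * \<gamma> * real n"
    have n_big: "real n \<ge> 1 / \<gamma>" "real n \<ge> (2 * real k + 6) / \<delta>" "real n \<ge> 16 * real k / \<delta>" "real n \<ge> 32 * real k + 100"
      using n unfolding n0_def by linarith+
    have n1: "\<gamma> * real n \<ge> 1" and n2: "\<delta> * real n \<ge> 2 * real k + 6" and n3: "\<delta> * real n \<ge> 16 * real k"
      using n_big \<delta> \<gamma> by (simp_all add: field_simps)
    define l where "l = n div 2"
    define h where "h = n - l"
    have lh: "l \<le> h" "h \<le> l + 1" "l + h = n" by (auto simp: l_def h_def)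
    have rl: "real l \<ge> real n / 2 - 1 / 2" "real l \<le> real n / 2" using lh by linarith+
    define x where "x = real l - real j - 3"
    have x: "x \<ge> real n / 4" "x > 0" using rl n_big unfolding x_def kj by auto
    have g1: "\<gamma> \<le> 1 / 96"
    proof -
      have "1 / (96 * real k) \<le> 1 / 96" using k by (simp add: field_simps)
      then show ?thesis using \<gamma> by simp
    qed
    have g2: "16 * real k * \<gamma>\<^sup>2 \<le> \<gamma>"
    proof -
      have "16 * real k * \<gamma> \<le> 16 * real k * (1 / (96 * real k))" using \<gamma> by (intro mult_left_mono) auto
      also have "... \<le> 1" using k by simp
      finally have "16 * real k * \<gamma> * \<gamma> \<le> 1 * \<gamma>" using \<gamma> by (intro mult_right_mono) auto
      then show ?thesis by (simp add: power2_eq_square)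
    qed
    have gn: "\<gamma> * real n \<le> real n / 96" using g1 by (simp add: mult_right_mono[of \<gamma> "1/96" "real n", simplified])
    have low: "real (cA k a b) \<ge> (real n / 8) ^ (2 * k - 1)"
    proof (rule cA_ge)
      have "real a + real b = real n" using ab by simp
      then have "real a \<ge> real n / 2 - \<gamma> * real n" "real b \<ge> real n / 2 - \<gamma> * real n" using d by linarith+
      then show "real n / 8 \<le> real b - real k" "real n / 8 \<le> real a - 2 - real k" using gn n_big by linarith+
    qed (use k in auto)
    have cT: "cT k n = cA (Suc j) h l" by (simp add: cT_def h_def l_def kj)
    have cT0: "real (cT k n) \<ge> 0" by simp
    have D: "real (n\<^sup>2 div 4) = real l * real h" unfolding sq_div4 by (simp add: l_def h_def)
    have main: "?C1 n a b \<and> ?C3 n a b"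
    proof (cases "a \<ge> h")
      case True
      define s where "s = a - h"
      have s: "a = h + s" "b = l - s" "s \<le> l" using True ab lh by (auto simp: s_def)
      have sg: "real s \<le> \<gamma> * real n" using d s lh by (simp add: of_nat_diff)
      have sx: "real s \<le> x" using sg gn x by linarith
      define y where "y = real s / x + real j * (real s / x)\<^sup>2"
      have c: "real (cA k a b) \<ge> real (cT k n) * (1 - y)"
        using cA_larger[of l j s h] x sx lh unfolding s cT unfolding kj x_def y_def by (simp add: diff_diff_eq)
      have s4: "real s / x \<le> 4 * \<gamma>"
      proof -
        have "real s \<le> 4 * \<gamma> * (real n / 4)" using sg by simp
        also have "... \<le> 4 * \<gamma> * x" using x \<gamma> by (intro mult_left_mono) auto
        finally show ?thesis using x by (simp add: field_simps)
      qed
      have y0: "y \<ge> 0" using x by (auto simp: y_def)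
      have y5: "y \<le> 5 * \<gamma>"
      proof -
        have "(real s / x)\<^sup>2 \<le> (4 * \<gamma>)\<^sup>2" using s4 x by (intro power_mono) auto
        then have "real j * (real s / x)\<^sup>2 \<le> real k * (4 * \<gamma>)\<^sup>2" unfolding kj by (intro mult_mono) auto
        then show ?thesis using s4 g2 unfolding y_def by (simp add: power_mult_distrib)
      qed
      have "(1 - 5 * \<gamma>) * real (cT k n) \<le> (1 - y) * real (cT k n)" using y5 by (intro mult_right_mono) auto
      then have p1: "(1 - 5 * \<gamma>) * real (cT k n) \<le> real (cA k a b)" using c by (simp add: mult.commute)
      have "(q + (1 - \<delta> / 4) * (real (n\<^sup>2 div 4) - real a * real b)) * real (cA k a b) \<ge> q * real (cT k n)"
        if q: "0 \<le> q" "q \<le> (1/2 - \<delta>) * real n" for q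
      proof -
        have "real (n\<^sup>2 div 4) - real a * real b = real s * (real h - real l) + real s * real s"
          unfolding D s(1,2) using s(3) by (simp add: of_nat_diff algebra_simps)
        moreover have "real s * (real h - real l) \<ge> 0" using lh by (intro mult_nonneg_nonneg) auto
        ultimately have Ds: "real (n\<^sup>2 div 4) - real a * real b \<ge> real s * real s" by linarith
        have qx: "q \<le> (1 - \<delta>) * x"
        proof -
          have "(1 - \<delta>) * x \<ge> (1 - \<delta>) * (real n / 2 - real k - 3)"
            using \<delta> rl unfolding x_def kj by (intro mult_left_mono) auto
          moreover have "(1 - \<delta>) * (real n / 2 - real k - 3) = (1/2 - \<delta>) * real n + \<delta> * real n / 2 - (1 - \<delta>) * (real k + 3)"
            by (simp add: field_simps)
          moreover have "(1 - \<delta>) * (real k + 3) \<le> real k + 3" using \<delta> by (simp add: mult_left_le_one_le)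
          ultimately show ?thesis using q n2 by linarith
        qed
        \<comment> \<open>Integrality of \<open>s\<close>: the linear loss of cycles is covered by
          the quadratic gain of edges. Equality at \<open>s = 1\<close> is the source of the
          threshold.\<close>
        have ss: "real s \<le> real s * real s" by (cases s) auto
        have jx: "real j / x \<le> \<delta> / 4"
        proof -
          have "real j \<le> (\<delta> / 4) * (real n / 4)" using n3 unfolding kj by simp
          also have "... \<le> (\<delta> / 4) * x" using x \<delta> by (intro mult_left_mono) auto
          finally show ?thesis using x by (simp add: field_simps)
        qed
        have "q * y \<le> (1 - \<delta>) * x * y" using qx y0 by (intro mult_right_mono) auto
        also have "... = (1 - \<delta>) * (real s + (real j / x) * (real s * real s))"
          using x unfolding y_def by (simp add: field_simps power2_eq_square)
        also have "... \<le> (1 - \<delta>) * (real s * real s + \<delta> / 4 * (real s * real s))"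
          using ss jx \<delta> by (intro mult_left_mono add_mono mult_right_mono) auto
        also have "... = ((1 - \<delta>) * (1 + \<delta> / 4)) * (real s * real s)" by (simp add: algebra_simps)
        also have "... \<le> (1 - \<delta> / 4) * (1 - y) * (real s * real s)"
        proof (rule mult_right_mono)
          have "(1 - \<delta> / 4) * (1 - y) \<ge> 1 - \<delta> / 4 - y"
          proof -
            have "\<delta> / 4 * y \<ge> 0" using \<delta> y0 by simp
            then show ?thesis by (simp add: algebra_simps)
          qed
          moreover have "(1 - \<delta>) * (1 + \<delta> / 4) \<le> 1 - 3 * \<delta> / 4"
            using \<delta> by (simp add: algebra_simps)
          ultimately show "(1 - \<delta>) * (1 + \<delta> / 4) \<le> (1 - \<delta> / 4) * (1 - y)" using y5 \<gamma> by linarith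
        qed auto
        finally have qy: "q * y \<le> (1 - \<delta> / 4) * (real s * real s) * (1 - y)" by (simp add: mult_ac)
        have y1: "1 - y \<ge> 0" using y5 g1 by simp
        have "q * real (cT k n) \<le> ((q + (1 - \<delta> / 4) * (real s * real s)) * (1 - y)) * real (cT k n)"
          using qy by (intro mult_right_mono) (auto simp: algebra_simps)
        also have "... = (q + (1 - \<delta> / 4) * (real s * real s)) * (real (cT k n) * (1 - y))" by simp
        also have "... \<le> (q + (1 - \<delta> / 4) * (real (n\<^sup>2 div 4) - real a * real b)) * real (cA k a b)"
        proof (intro mult_mono add_left_mono mult_left_mono Ds c)
          have "(1 - \<delta> / 4) * (real (n\<^sup>2 div 4) - real a * real b) \<ge> (1 - \<delta> / 4) * (real s * real s)"
            using Ds \<delta> by (intro mult_left_mono) auto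
          moreover have "(1 - \<delta> / 4) * (real s * real s) \<ge> 0" using \<delta> by (intro mult_nonneg_nonneg) auto
          ultimately show "0 \<le> q + (1 - \<delta> / 4) * (real (n\<^sup>2 div 4) - real a * real b)" using q by linarith
        qed (use \<delta> y1 in auto)
        finally show ?thesis .
      qed
      then show ?thesis using p1 by blast
    next
      case False
      define t where "t = h - a"
      have t: "a = h - t" "b = l + t" "t \<le> h" "t > 0" using False ab lh by (auto simp: t_def)
      have tg: "real t \<le> 2 * (\<gamma> * real n)"
      proof -
        have "2 * real t \<le> 2 * \<gamma> * real n + 1" using d t lh by (simp add: of_nat_diff)
        then show ?thesis using n1 by linarith
      qed
      have tx: "real t \<le> x / 2" using tg gn x by linarith
      have "6 * real j * real t * real l \<le> x\<^sup>2"
      proof -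
        have "6 * real j * real t * real l \<le> 6 * real k * (2 * (\<gamma> * real n)) * (real n / 2)"
          using tg rl \<gamma> unfolding kj by (intro mult_mono) auto
        also have "... = (96 * real k * \<gamma>) * (real n / 4)\<^sup>2" by (simp add: power2_eq_square)
        also have "... \<le> 1 * (real n / 4)\<^sup>2"
          using \<gamma>(3) k by (intro mult_right_mono) (auto simp: field_simps)
        also have "... \<le> x\<^sup>2" using x by (simp add: power_mono)
        finally show ?thesis .
      qed
      then have c: "real (cA k a b) \<ge> real (cT k n)"
        using cA_smaller[of l j t h] x tx lh unfolding t cT unfolding kj x_def by simp
      have "(1 - 5 * \<gamma>) * real (cT k n) \<le> 1 * real (cT k n)" using \<gamma> by (intro mult_right_mono) auto
      then have p1: "(1 - 5 * \<gamma>) * real (cT k n) \<le> real (cA k a b)" using c by simp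
      have "(q + (1 - \<delta> / 4) * (real (n\<^sup>2 div 4) - real a * real b)) * real (cA k a b) \<ge> q * real (cT k n)"
        if q: "0 \<le> q" for q
      proof -
        have "real (n\<^sup>2 div 4) - real a * real b = real t * (real t - (real h - real l))"
          unfolding D t(1,2) using t(3) by (simp add: of_nat_diff algebra_simps)
        moreover have "real t - (real h - real l) \<ge> 0" using t lh by linarith
        ultimately have "real (n\<^sup>2 div 4) - real a * real b \<ge> 0" by simp
        then have "(1 - \<delta> / 4) * (real (n\<^sup>2 div 4) - real a * real b) \<ge> 0" using \<delta> by (intro mult_nonneg_nonneg) auto
        then show ?thesis using c q by (intro mult_mono) auto
      qed
      then show ?thesis using p1 by blast
    qed
    show "?C1 n a b \<and> ?C2 n a b \<and> ?C3 n a b"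
      using main low by blast
  qed
qed

section \<open>Counting with respect to a cut\<close>


context cut
begin

abbreviation "dg u \<equiv> real (card (bn u))"
abbreviation "ms u \<equiv> real (card (mn u))"
abbreviation "os u \<equiv> real (card (opp u))"

definition Bd :: real where "Bd = (\<Sum>u<n. dg u) / 2"
definition Ms :: real where "Ms = (\<Sum>u<n. ms u) / 2"

lemma Bd_badp: "2 * Bd = real (card (badp n G A))"
  unfolding Bd_def card_bn_sum[symmetric] by simp

lemma Ms_MP: "2 * Ms = real (card MP)"
  unfolding Ms_def card_MP by simp

lemma Ms_nonneg: "Ms \<ge> 0" and Bd_nonneg: "Bd \<ge> 0"
  by (auto simp: Ms_def Bd_def intro!: sum_nonneg)

lemma sides:
  "u \<in> A \<Longrightarrow> opp u = {..<n} - A \<and> same u = A"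
  "u \<notin> A \<Longrightarrow> opp u = A \<and> same u = {..<n} - A"
  using A by (auto simp: opp_def same_def)

lemma card_A: "card A \<le> n" and card_B: "card ({..<n} - A) = n - card A" and finite_A: "finite A"
proof -
  show "finite A" using A finite_subset by blast
  then show "card ({..<n} - A) = n - card A" using A by (simp add: card_Diff_subset)
  show "card A \<le> n" using card_mono[OF _ A] by simp
qed

lemma card_xn: "card (xn u) + card (mn u) = card (opp u)"
proof -
  have "opp u = xn u \<union> mn u" by (auto simp: xn_def mn_def)
  moreover have "finite (xn u)" by (auto simp: xn_def)
  moreover have "xn u \<inter> mn u = {}" by (auto simp: xn_def mn_def)
  ultimately show ?thesis by (simp add: card_Un_disjoint)
qed

lemma edge_count: "real (card G) = Bd + real (card A) * real (n - card A) - Ms"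
proof -
  have fx: "finite (xn u)" for u by (auto simp: xn_def)
  have deg: "oe G {u} {..<n} = dg u + os u - ms u" if "u < n" for u
  proof -
    have "{y \<in> {..<n}. {u, y} \<in> G} = bn u \<union> xn u" using that by (auto simp: bn_def xn_def same_def opp_def)
    moreover have "bn u \<inter> xn u = {}" by (auto simp: bn_def xn_def same_def opp_def)
    ultimately have "card {y \<in> {..<n}. {u, y} \<in> G} = card (bn u) + card (xn u)"
      using fx by (simp add: card_Un_disjoint)
    then show ?thesis using card_xn[of u] by (simp add: oe_singleton)
  qed
  have "oe G {..<n} {..<n} = (\<Sum>u<n. oe G {u} {..<n})" by (simp add: oe_def)
  also have "... = (\<Sum>u<n. dg u + os u - ms u)" by (rule sum.cong) (use deg in auto)
  also have "... = 2 * Bd + (\<Sum>u<n. os u) - 2 * Ms" by (simp add: Bd_def Ms_def sum.distrib sum_subtractf)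
  also have "(\<Sum>u<n. os u) = (\<Sum>u\<in>{..<n} - A. os u) + (\<Sum>u\<in>A. os u)" using A by (intro sum.subset_diff) auto
  also have "(\<Sum>u\<in>A. os u) = (\<Sum>u\<in>A. real (n - card A))" by (rule sum.cong) (auto simp: sides card_B)
  also have "(\<Sum>u\<in>{..<n} - A. os u) = (\<Sum>u\<in>{..<n} - A. real (card A))" by (rule sum.cong) (auto simp: sides)
  finally show ?thesis unfolding handshake[OF graph] by (simp add: card_B)
qed

text \<open>Each bad edge collects the weights of its two ends. A constant weight yields the number
  of bad edges, a variable one the losses at both ends of a path.\<close>

lemma sum_BP:
  fixes f :: "nat \<Rightarrow> real"
  shows "(\<Sum>(u, v)\<in>BP. f u + f v) = (\<Sum>u<n. dg u * f u)"
proof -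
  have e: "Sigma {..<n} bn = BP \<union> prod.swap ` BP"
  proof
    show "Sigma {..<n} bn \<subseteq> BP \<union> prod.swap ` BP"
    proof
      fix p assume "p \<in> Sigma {..<n} bn"
      then obtain u v where p: "p = (u, v)" "u < n" "v \<in> bn u" by auto
      then consider "u < v" | "v < u" using bnD[of v u] by force
      then show "p \<in> BP \<union> prod.swap ` BP"
      proof cases
        case 2
        then have "(v, u) \<in> BP" using p bn_sym bnD[of v u] by (auto simp: BP_def)
        then show ?thesis using p by force
      qed (use p in \<open>auto simp: BP_def\<close>)
    qed
    show "BP \<union> prod.swap ` BP \<subseteq> Sigma {..<n} bn" using bn_sym bnD by (fastforce simp: BP_def)
  qed
  have "(\<Sum>u<n. dg u * f u) = (\<Sum>u<n. \<Sum>v\<in>bn u. f u)" by simp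
  also have "... = (\<Sum>(u, v)\<in>Sigma {..<n} bn. f u)" by (rule sum.Sigma) auto
  also have "... = (\<Sum>(u, v)\<in>BP. f u) + (\<Sum>(u, v)\<in>prod.swap ` BP. f u)"
    unfolding e by (rule sum.union_disjoint) (simp, simp, auto simp: BP_def)
  also have "(\<Sum>(u, v)\<in>prod.swap ` BP. f u) = (\<Sum>(u, v)\<in>BP. f v)"
    by (subst sum.reindex) (auto intro!: sum.cong)
  finally show ?thesis by (simp add: sum.distrib case_prod_beta)
qed

text \<open>\<open>cm\<close> bounds the count per bad edge from below on either side of the cut;
  \<open>sm\<close> is the fraction of it that missing edges in the interior of a path may
  destroy.\<close>

context
  fixes k :: nat and cm sm :: real
  assumes k: "k \<ge> 1"
    and cm: "0 \<le> cm" "cm \<le> real (cA k (card A) (n - card A))" "cm \<le> real (cA k (n - card A) (card A))"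
    and sm: "0 \<le> sm" "real (2 * k - 2) * real (card MP) * real n ^ (2 * k - 3) \<le> sm * cm"
begin

lemma paths_ge_min:
  assumes uv: "v \<in> bn u"
  shows "real (card (paths k u v)) \<ge> cm * (1 - ms u / os u - ms v / os v - sm)"
proof -
  define c where "c = real (altn (2 * k - 1) (card (opp u)) (card (same u) - 2))"
  have c: "c \<ge> cm"
    unfolding c_def altn_cA[OF k] using cm sides[of u] by (cases "u \<in> A") (auto simp: card_B)
  have ov: "os v = os u" using bnD[OF uv] by simp
  let ?r = "1 - ms u / os u - ms v / os v - sm"
  have "real (card (paths k u v)) \<ge> c * (1 - (ms u + ms v) / os u) - sm * cm"
    using paths_ge[OF k uv] sm unfolding c_def by linarith
  moreover have "sm * cm \<le> sm * c" using c sm by (intro mult_left_mono)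
  ultimately have p: "real (card (paths k u v)) \<ge> c * ?r" unfolding ov by (simp add: algebra_simps add_divide_distrib)
  \<comment> \<open>Passing from \<open>c\<close> to the smaller \<open>cm\<close> is monotone only
    for a nonnegative bracket; for a negative one the claimed bound is not positive.\<close>
  show ?thesis
  proof (cases "?r \<ge> 0")
    case True
    then show ?thesis using p c mult_right_mono[of cm c ?r] by simp
  next
    case False
    then have "cm * ?r \<le> 0" using cm by (intro mult_nonneg_nonpos) auto
    then show ?thesis by linarith
  qed
qed

lemma copies_ge_sum:
  shows "real (copies G (cycle_graph (2 * k + 1))) \<ge> cm * (Bd * (1 - sm) - (\<Sum>u<n. dg u * (ms u / os u)))"
proof -
  have one: "(\<Sum>(u, v)\<in>BP. (1 - sm) / 2 + (1 - sm) / 2) = Bd * (1 - sm)"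
    unfolding sum_BP[of "\<lambda>_. (1 - sm) / 2"] Bd_def sum_distrib_right[symmetric] by simp
  have "cm * (Bd * (1 - sm) - (\<Sum>u<n. dg u * (ms u / os u)))
    = cm * ((\<Sum>(u, v)\<in>BP. (1 - sm) / 2 + (1 - sm) / 2) - (\<Sum>(u, v)\<in>BP. ms u / os u + ms v / os v))"
    unfolding one sum_BP ..
  also have "... = (\<Sum>(u, v)\<in>BP. cm * (1 - ms u / os u - ms v / os v - sm))"
    unfolding sum_subtractf[symmetric] sum_distrib_left by (rule sum.cong) (auto simp: algebra_simps)
  also have "... \<le> (\<Sum>(u, v)\<in>BP. real (card (paths k u v)))"
    by (rule sum_mono) (auto simp: BP_def intro!: paths_ge_min)
  also have "... = real (\<Sum>(u, v)\<in>BP. card (paths k u v))" by (simp add: case_prod_beta)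
  also have "... \<le> real (copies G (cycle_graph (2 * k + 1)))" using copies_ge[OF k] by (rule of_nat_mono)
  finally show ?thesis .
qed

text \<open>At a vertex of large bad degree \<open>d\<close> the cut being locally maximal forces at least \<open>d\<close> cross neighbours, hence about
  \<open>d\<^sup>2\<close> pairs of a bad and a cross edge, each extending to many cycles. This caps the bad degrees.\<close>

lemma copies_ge_vertex:
  assumes x: "x < n" "card (bn x) \<le> card (xn x)" "os x > 0"
  shows "real (copies G (cycle_graph (2 * k + 1))) \<ge> cm * ((dg x)\<^sup>2 / os x - dg x * sm - 2 * Ms / os x)"
proof -
  let ?f = "\<lambda>v. (min x v, max x v)"
  have fBP: "?f v \<in> BP" if "v \<in> bn x" for v
    using bnD[OF that] that bn_sym[OF that] by (auto simp: BP_def min_def max_def)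
  have inj: "inj_on ?f (bn x)" by (auto simp: inj_on_def min_def max_def split: if_splits)
  have g: "cm * (1 - ms x / os x - ms v / os x - sm) \<le> real (card (paths k (min x v) (max x v)))" if v: "v \<in> bn x" for v
  proof (cases "x \<le> v")
    case True
    then show ?thesis using paths_ge_min[OF v] bnD[OF v] by (simp add: min_def max_def)
  next
    case False
    then show ?thesis using paths_ge_min[OF bn_sym[OF v]] bnD[OF v] by (simp add: min_def max_def algebra_simps)
  qed
  have "(\<Sum>v\<in>bn x. ms v) \<le> (\<Sum>v<n. ms v)"
    by (rule sum_mono2) (use bnD in auto)
  then have "(\<Sum>v\<in>bn x. ms v / os x) \<le> 2 * Ms / os x"
    unfolding Ms_def sum_divide_distrib[symmetric] using x by (intro divide_right_mono) auto
  moreover have "dg x * (1 - ms x / os x) \<ge> (dg x)\<^sup>2 / os x"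
  proof -
    have "dg x \<le> os x - ms x" using x(2) card_xn[of x] by linarith
    then have "dg x * dg x \<le> dg x * (os x - ms x)" by (intro mult_left_mono) auto
    then have "dg x * dg x / os x \<le> dg x * (os x - ms x) / os x" using x by (intro divide_right_mono) auto
    also have "... = dg x * ((os x - ms x) / os x)" by simp
    also have "(os x - ms x) / os x = 1 - ms x / os x" using x(3) by (auto simp: diff_divide_distrib)
    finally show ?thesis by (simp add: power2_eq_square)
  qed
  ultimately have "(dg x)\<^sup>2 / os x - dg x * sm - 2 * Ms / os x \<le> (\<Sum>v\<in>bn x. 1 - ms x / os x - ms v / os x - sm)"
    unfolding sum_subtractf by (simp add: right_diff_distrib)
  then have "cm * ((dg x)\<^sup>2 / os x - dg x * sm - 2 * Ms / os x) \<le> cm * (\<Sum>v\<in>bn x. 1 - ms x / os x - ms v / os x - sm)"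
    using cm by (intro mult_left_mono)
  also have "... \<le> (\<Sum>v\<in>bn x. real (card (paths k (min x v) (max x v))))"
    unfolding sum_distrib_left by (rule sum_mono) (rule g)
  also have "... = (\<Sum>(u, v)\<in>?f ` bn x. real (card (paths k u v)))"
    by (subst sum.reindex[OF inj]) simp
  also have "... \<le> (\<Sum>(u, v)\<in>BP. real (card (paths k u v)))"
    by (rule sum_mono2) (use fBP in auto)
  also have "... = real (\<Sum>(u, v)\<in>BP. card (paths k u v))" by (simp add: case_prod_beta)
  also have "... \<le> real (copies G (cycle_graph (2 * k + 1)))" using copies_ge[OF k] by (rule of_nat_mono)
  finally show ?thesis .
qed

end

lemma MP_swap: "prod.swap ` MP = MP"
proof -
  have s: "prod.swap ` MP \<subseteq> MP" using mn_sym by (fastforce simp: MP_def mn_def opp_def)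
  then have "prod.swap ` prod.swap ` MP \<subseteq> prod.swap ` MP" by blast
  then show ?thesis using s by (simp add: image_image)
qed

lemma sum_MP: "(\<Sum>u<n. dg u * ms u) = (\<Sum>(u, w)\<in>MP. dg u + dg w) / 2"
proof -
  have "(\<Sum>u<n. dg u * ms u) = (\<Sum>u<n. \<Sum>w\<in>mn u. dg u)" by (simp add: mult.commute)
  also have "... = (\<Sum>(u, w)\<in>MP. dg u)" unfolding MP_def by (rule sum.Sigma) auto
  finally have 1: "(\<Sum>u<n. dg u * ms u) = (\<Sum>(u, w)\<in>MP. dg u)" .
  have "(\<Sum>(u, w)\<in>MP. dg u) = (\<Sum>(u, w)\<in>prod.swap ` MP. dg u)" unfolding MP_swap ..
  also have "... = (\<Sum>(u, w)\<in>MP. dg w)" by (subst sum.reindex) (auto intro!: sum.cong)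
  finally show ?thesis unfolding 1 by (simp add: sum.distrib case_prod_beta)
qed

text \<open>No bad edge joins opposite sides, so the bad edges at \<open>u\<close> and those at
  \<open>w\<close> form disjoint sets.\<close>

lemma degrees_opposite:
  assumes "u < n" "w \<in> opp u"
  shows "dg u + dg w \<le> Bd"
proof -
  let ?R = "{(x, y) \<in> badp n G A. x \<noteq> u \<and> y \<noteq> u}"
  have w: "w < n" using assms by (auto simp: opp_def)
  have loop: "{w, w} \<notin> G" using graph_onD[OF graph, of w w] by auto
  have fin: "finite ?R" by (rule finite_subset[OF _ finite_badp[of n G A]]) auto
  have "Pair w ` bn w \<union> (\<lambda>v. (v, w)) ` bn w \<subseteq> ?R"
    using assms w by (auto simp: badp_def bn_def same_def opp_def insert_commute)
  then have "card (Pair w ` bn w \<union> (\<lambda>v. (v, w)) ` bn w) \<le> card ?R" by (rule card_mono[OF fin])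
  moreover have "card (Pair w ` bn w \<union> (\<lambda>v. (v, w)) ` bn w) = card (Pair w ` bn w) + card ((\<lambda>v. (v, w)) ` bn w)"
    by (rule card_Un_disjoint) (use loop in \<open>auto simp: bn_def\<close>)
  moreover have "... = 2 * card (bn w)" by (simp add: card_image inj_on_def)
  ultimately have "2 * card (bn w) + 2 * card (bn u) \<le> card (badp n G A)"
    using card_badp_split[OF assms(1)] by linarith
  then have "real (2 * card (bn w) + 2 * card (bn u)) \<le> real (card (badp n G A))" by (rule of_nat_mono)
  then show ?thesis unfolding Bd_badp[symmetric] by simp
qed

text \<open>Enough on its own while \<open>Bd\<close> stays below the part sizes by a constant
  factor: after division by the part size the loss is then less than \<open>Ms\<close>.\<close>

lemma sum_dg_ms_le: "(\<Sum>u<n. dg u * ms u) \<le> Ms * Bd"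
proof -
  have "(\<Sum>(u, w)\<in>MP. dg u + dg w) \<le> (\<Sum>(u, w)\<in>MP. Bd)"
    by (rule sum_mono) (auto simp: MP_def mn_def intro!: degrees_opposite)
  also have "... = 2 * Ms * Bd" by (simp add: Ms_MP)
  finally show ?thesis unfolding sum_MP by simp
qed

text \<open>The number of vertices of bad degree above \<open>\<tau>\<close> is at most \<open>2 Bd / \<tau>\<close>, and only the missing edges between two of them
  are counted twice.\<close>

lemma sum_dg_ms_le_max_degree:
  assumes \<tau>: "\<tau> > 0" and \<Delta>: "\<And>u. u < n \<Longrightarrow> dg u \<le> \<Delta>" "\<Delta> \<ge> 0"
  shows "(\<Sum>u<n. dg u * ms u) \<le> 2 * \<tau> * Ms + \<Delta> * (Ms + (2 * Bd / \<tau>)\<^sup>2)"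
proof -
  define X where "X = {u. u < n \<and> dg u > \<tau>}"
  have finX: "finite X" and XV: "X \<subseteq> {..<n}" by (auto simp: X_def)
  have "real (card X) * \<tau> = (\<Sum>u\<in>X. \<tau>)" by simp
  also have "... \<le> (\<Sum>u\<in>X. dg u)" by (rule sum_mono) (auto simp: X_def)
  also have "... \<le> (\<Sum>u<n. dg u)" by (rule sum_mono2) (use XV in auto)
  finally have N: "real (card X) \<le> 2 * Bd / \<tau>" using \<tau> by (simp add: Bd_def field_simps)
  \<comment> \<open>These pairs and their swaps are disjoint subsets of \<open>MP\<close>, so at
    most \<open>Ms\<close> of them exist; the other missing pairs starting in \<open>X\<close> lie
    in \<open>X \<times> X\<close>.\<close>
  let ?P = "{p \<in> MP. fst p \<in> X \<and> snd p \<notin> X}"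
  have finP: "finite ?P" by simp
  have "card (?P \<union> prod.swap ` ?P) \<le> card MP"
    by (rule card_mono) (use MP_swap in auto)
  moreover have "card (?P \<union> prod.swap ` ?P) = card ?P + card (prod.swap ` ?P)"
    by (rule card_Un_disjoint) auto
  moreover have "card (prod.swap ` ?P) = card ?P" by (rule card_image) (auto simp: inj_on_def)
  ultimately have P: "2 * card ?P \<le> card MP" by simp
  have "(\<Sum>u\<in>X. card (mn u)) = card (Sigma X mn)" by (simp add: finX)
  also have "... \<le> card (?P \<union> X \<times> X)"
    by (rule card_mono) (use finX XV in \<open>auto simp: MP_def\<close>)
  also have "... \<le> card ?P + card X * card X" using card_Un_le[of ?P "X \<times> X"] by (simp add: card_cartesian_product)
  finally have "2 * (\<Sum>u\<in>X. card (mn u)) \<le> card MP + 2 * (card X * card X)" using P by linarith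
  then have "real (2 * (\<Sum>u\<in>X. card (mn u))) \<le> real (card MP + 2 * (card X * card X))" by (rule of_nat_mono)
  then have s: "(\<Sum>u\<in>X. ms u) \<le> Ms + real (card X) * real (card X)"
    using Ms_MP by simp
  also have "... \<le> Ms + (2 * Bd / \<tau>)\<^sup>2"
    unfolding power2_eq_square using N by (intro add_left_mono mult_mono) auto
  finally have sX: "(\<Sum>u\<in>X. ms u) \<le> Ms + (2 * Bd / \<tau>)\<^sup>2" .
  have t: "dg u * ms u \<le> \<tau> * ms u + (if u \<in> X then \<Delta> * ms u else 0)" if "u < n" for u
  proof (cases "u \<in> X")
    case True
    have "dg u * ms u \<le> \<Delta> * ms u" using \<Delta>(1)[OF that] by (intro mult_right_mono) auto
    moreover have "\<tau> * ms u \<ge> 0" using \<tau> by simp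
    ultimately show ?thesis using True by simp
  next
    case False
    then have "dg u \<le> \<tau>" using that by (auto simp: X_def)
    then show ?thesis using False by (simp add: mult_right_mono)
  qed
  have "(\<Sum>u<n. dg u * ms u) \<le> (\<Sum>u<n. \<tau> * ms u + (if u \<in> X then \<Delta> * ms u else 0))"
    by (rule sum_mono) (use t in auto)
  also have "... = (\<Sum>u<n. \<tau> * ms u) + (\<Sum>u\<in>X. \<Delta> * ms u)"
  proof -
    have "{..<n} \<inter> X = X" using XV by auto
    then show ?thesis by (simp add: sum.distrib sum.If_cases)
  qed
  also have "... = 2 * \<tau> * Ms + \<Delta> * (\<Sum>u\<in>X. ms u)" unfolding Ms_def sum_distrib_left[symmetric] by simp
  also have "... \<le> 2 * \<tau> * Ms + \<Delta> * (Ms + (2 * Bd / \<tau>)\<^sup>2)"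
    using sX \<Delta>(2) by (intro add_left_mono mult_left_mono)
  finally show ?thesis .
qed

end

section \<open>The lower bound on the number of copies\<close>


text \<open>As \<open>\<gamma>\<close> tends to 0, the left-hand sides tend to
  \<open>(1 - \<delta>)^2 / 2\<close>, \<open>1 - \<delta>\<close>,
  \<open>1 - 3 * \<delta> / 4\<close> and 0, each strictly on the required side. The first
  inequality caps the bad degrees, the next two bound the loss per missing edge in two regimes, the
  last pays for missing edges between vertices of high bad degree.\<close>

lemma small_parameter:
  fixes \<delta> C :: real
  assumes "0 < \<delta>" "\<delta> \<le> 1/2" "e > 0"
  shows "\<exists>\<gamma>. 0 < \<gamma> \<and> \<gamma> < e \<and>
    (1 - 5 * \<gamma>) * ((1/2 - \<delta>/2)\<^sup>2 / (1/2 + \<gamma>) - C * \<gamma>\<^sup>2 - \<gamma>\<^sup>2 / (1/2 - \<gamma>)) > 1/2 - \<delta> \<and>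
    (1/2 - \<delta>/2) / (1/2 - \<gamma>) + C * \<gamma>\<^sup>2 < 1 - \<delta>/4 \<and>
    (1/2 - 3*\<delta>/8) / (1/2 - \<gamma>) + C * \<gamma>\<^sup>2 < 1 - \<delta>/2 \<and>
    512 * \<gamma>\<^sup>2 / \<delta>\<^sup>2 * (1 + 1/\<delta>) < \<delta>/4" (is "\<exists>\<gamma>. ?P \<gamma>")
proof -
  let ?F = "at_right (0::real)"
  have t1: "((\<lambda>\<gamma>. (1 - 5 * \<gamma>) * ((1/2 - \<delta>/2)\<^sup>2 / (1/2 + \<gamma>) - C * \<gamma>\<^sup>2 - \<gamma>\<^sup>2 / (1/2 - \<gamma>)))
     \<longlongrightarrow> (1 - 5 * 0) * ((1/2 - \<delta>/2)\<^sup>2 / (1/2 + 0) - C * 0\<^sup>2 - 0\<^sup>2 / (1/2 - 0))) ?F"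
    by (intro tendsto_intros) auto
  have "(1 - 5 * 0) * ((1/2 - \<delta>/2)\<^sup>2 / (1/2 + 0) - C * 0\<^sup>2 - 0\<^sup>2 / (1/2 - 0)) > 1/2 - \<delta>"
    using assms by (simp add: power2_eq_square field_simps)
  note e1 = order_tendstoD(1)[OF t1 this]
  have t2: "((\<lambda>\<gamma>. (1/2 - \<delta>/2) / (1/2 - \<gamma>) + C * \<gamma>\<^sup>2) \<longlongrightarrow> (1/2 - \<delta>/2) / (1/2 - 0) + C * 0\<^sup>2) ?F"
    by (intro tendsto_intros) auto
  have "(1/2 - \<delta>/2) / (1/2 - 0) + C * 0\<^sup>2 < 1 - \<delta>/4" using assms by (simp add: field_simps)
  note e2 = order_tendstoD(2)[OF t2 this]
  have t3: "((\<lambda>\<gamma>. (1/2 - 3*\<delta>/8) / (1/2 - \<gamma>) + C * \<gamma>\<^sup>2) \<longlongrightarrow> (1/2 - 3*\<delta>/8) / (1/2 - 0) + C * 0\<^sup>2) ?F"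
    by (intro tendsto_intros) auto
  have "(1/2 - 3*\<delta>/8) / (1/2 - 0) + C * 0\<^sup>2 < 1 - \<delta>/2" using assms by (simp add: field_simps)
  note e3 = order_tendstoD(2)[OF t3 this]
  have t4: "((\<lambda>\<gamma>. 512 * \<gamma>\<^sup>2 / \<delta>\<^sup>2 * (1 + 1/\<delta>)) \<longlongrightarrow> 512 * 0\<^sup>2 / \<delta>\<^sup>2 * (1 + 1/\<delta>)) ?F"
    by (intro tendsto_intros) (use assms in auto)
  have "512 * 0\<^sup>2 / \<delta>\<^sup>2 * (1 + 1/\<delta>) < \<delta>/4" using assms by simp
  note e4 = order_tendstoD(2)[OF t4 this]
  have e5: "eventually (\<lambda>\<gamma>. \<gamma> \<in> {0<..<e}) ?F" using assms by (intro eventually_at_right_real)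
  have "eventually ?P ?F"
    using e1 e2 e3 e4 e5 by eventually_elim auto
  then show ?thesis using eventually_happens trivial_limit_at_right_real by blast
qed

lemma mult_le_sq_div4: "a + b = (n::nat) \<Longrightarrow> a * b \<le> n\<^sup>2 div 4"
proof -
  assume "a + b = n"
  then have "4 * (a * b) \<le> n\<^sup>2"
  proof -
    have "0 \<le> (int a - int b)\<^sup>2" by simp
    then have "4 * (int a * int b) \<le> (int a + int b)\<^sup>2" by (simp add: power2_eq_square algebra_simps)
    then have "int (4 * (a * b)) \<le> int (n\<^sup>2)" using \<open>a + b = n\<close> by auto
    then show ?thesis by (simp only: of_nat_le_iff)
  qed
  then show ?thesis by linarith
qed

definition Kb :: "nat \<Rightarrow> nat set \<Rightarrow> nat set set" where
  "Kb n A = {{u, v} | u v. u \<in> A \<and> v \<in> {..<n} - A}"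

lemma Kb_iff: "A \<subseteq> {..<n} \<Longrightarrow> {x, y} \<in> Kb n A \<longleftrightarrow> x < n \<and> y < n \<and> (x \<in> A) \<noteq> (y \<in> A)"
proof
  assume A: "A \<subseteq> {..<n}" and "{x, y} \<in> Kb n A"
  then obtain u v where "{x, y} = {u, v}" "u \<in> A" "v < n" "v \<notin> A" by (auto simp: Kb_def)
  then show "x < n \<and> y < n \<and> (x \<in> A) \<noteq> (y \<in> A)" using A by (auto simp: doubleton_eq_iff)
next
  assume A: "A \<subseteq> {..<n}" and xy: "x < n \<and> y < n \<and> (x \<in> A) \<noteq> (y \<in> A)"
  show "{x, y} \<in> Kb n A"
  proof (cases "x \<in> A")
    case True
    then show ?thesis using xy unfolding Kb_def by blast
  next
    case False
    then have "{x, y} = {y, x}" "y \<in> A" "x \<in> {..<n} - A" using xy by auto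
    then show ?thesis unfolding Kb_def by blast
  qed
qed

lemma (in cut) complete_bipartite:
  assumes "Ms = 0" "Bd = 0"
  shows "G = Kb n A"
proof -
  have m: "mn u = {}" if "u < n" for u
  proof -
    have "(\<Sum>u<n. ms u) = 0" using assms(1) by (simp add: Ms_def)
    then have "ms u = 0" using that by (subst (asm) sum_nonneg_eq_0_iff) auto
    then show ?thesis by simp
  qed
  have b: "bn u = {}" if "u < n" for u
  proof -
    have "(\<Sum>u<n. dg u) = 0" using assms(2) by (simp add: Bd_def)
    then have "dg u = 0" using that by (subst (asm) sum_nonneg_eq_0_iff) auto
    then show ?thesis by simp
  qed
  have "{x, y} \<in> G \<longleftrightarrow> {x, y} \<in> Kb n A" for x y
    unfolding Kb_iff[OF A] using m[of x] b[of x] graph_onD[OF graph, of x y]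
    by (auto simp: mn_def opp_def bn_def same_def)
  moreover have "\<exists>x y. e = {x, y}" if "e \<in> G \<union> Kb n A" for e
    using that graph unfolding graph_on_def Kb_def by blast
  ultimately show ?thesis by blast
qed

text \<open>The premise of at most \<open>q * cT k n\<close> copies lets \<open>stability\<close>
  apply and contradicts a vertex of too large bad degree. The clause for \<open>q = 0\<close> gives
  uniqueness of the extremal graph.\<close>

lemma copies_lower_bound:
  assumes k: "k \<ge> 1" and \<delta>: "0 < \<delta>" "\<delta> \<le> 1/2"
  shows "\<exists>n0. \<forall>n\<ge>n0. \<forall>G q. graph_on n G \<longrightarrow> card G = n\<^sup>2 div 4 + q \<longrightarrow> real q \<le> (1/2 - \<delta>) * real n \<longrightarrow>
    copies G (cycle_graph (2 * k + 1)) \<le> q * cT k n \<longrightarrow>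
    q * cT k n \<le> copies G (cycle_graph (2 * k + 1)) \<and>
    (q = 0 \<longrightarrow> (\<exists>A\<subseteq>{..<n}. card A * (n - card A) = n\<^sup>2 div 4 \<and> G = Kb n A))"
proof -
  \<comment> \<open>The power of 8 comes from \<open>cm \<ge> (n / 8) ^ (2 * k - 1)\<close>;
    \<open>C\<close> turns the error of \<open>paths_ge\<close> into a relative loss.\<close>
  define C where "C = real (2 * k - 2) * 8 ^ (2 * k - 1)"
  have C0: "C \<ge> 0" by (simp add: C_def)
  obtain \<gamma> where \<gamma>: "0 < \<gamma>" "\<gamma> < min (\<delta> / 10) (1 / (96 * real k))"
    and c3: "(1 - 5 * \<gamma>) * ((1/2 - \<delta>/2)\<^sup>2 / (1/2 + \<gamma>) - C * \<gamma>\<^sup>2 - \<gamma>\<^sup>2 / (1/2 - \<gamma>)) > 1/2 - \<delta>"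
    and c1: "(1/2 - \<delta>/2) / (1/2 - \<gamma>) + C * \<gamma>\<^sup>2 < 1 - \<delta>/4"
    and c2: "(1/2 - 3*\<delta>/8) / (1/2 - \<gamma>) + C * \<gamma>\<^sup>2 < 1 - \<delta>/2"
    and c4: "512 * \<gamma>\<^sup>2 / \<delta>\<^sup>2 * (1 + 1/\<delta>) < \<delta>/4"
    using small_parameter[of \<delta> "min (\<delta> / 10) (1 / (96 * real k))" C] \<delta> k by auto
  have \<gamma>': "\<gamma> \<le> \<delta> / 10" "\<gamma> \<le> 1 / (96 * real k)" using \<gamma> by auto
  have g20: "\<gamma> \<le> 1/20" using \<gamma>' \<delta> by linarith
  obtain n1 where n1: "\<And>n G. n \<ge> n1 \<Longrightarrow> graph_on n G \<Longrightarrow> card G \<ge> n\<^sup>2 div 4 \<Longrightarrow>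
     real (copies G (cycle_graph (2 * k + 1))) \<le> real n ^ (2 * k) \<Longrightarrow>
     \<exists>A\<subseteq>{..<n}. real (card (badp n G A)) \<le> \<gamma>\<^sup>2 * real n ^ 2 \<and> (\<forall>u<n. card (cut.bn n G A u) \<le> card (cut.xn n G A u))"
    using stability[OF k, of "\<gamma>\<^sup>2"] \<gamma> by auto
  from cA_estimates[OF k \<delta> \<gamma>(1) \<gamma>'] obtain n2 where n2: "\<forall>n\<ge>n2. \<forall>a b. a + b = n \<longrightarrow> \<bar>real a - real b\<bar> \<le> 2 * \<gamma> * real n \<longrightarrow>
     real (cA k a b) \<ge> (1 - 5 * \<gamma>) * real (cT k n) \<and>
     real (cA k a b) \<ge> (real n / 8) ^ (2 * k - 1) \<and>
     (\<forall>q. 0 \<le> q \<longrightarrow> q \<le> (1/2 - \<delta>) * real n \<longrightarrow>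
        (q + (1 - \<delta> / 4) * (real (n\<^sup>2 div 4) - real a * real b)) * real (cA k a b) \<ge> q * real (cT k n))" ..
  define n0 where "n0 = n1 + n2 + nat \<lceil>1 / \<gamma>\<rceil> + 1"
  show ?thesis
  proof (intro exI[of _ n0] allI impI)
    fix n G q
    assume n: "n0 \<le> n" and G: "graph_on n G" and e: "card G = n\<^sup>2 div 4 + q"
      and q: "real q \<le> (1/2 - \<delta>) * real n" and le: "copies G (cycle_graph (2 * k + 1)) \<le> q * cT k n"
    let ?c = "real (copies G (cycle_graph (2 * k + 1)))"
    have nn: "n \<ge> n1" "n \<ge> n2" "real n \<ge> 1 / \<gamma>" "real n \<ge> 1" using n unfolding n0_def by linarith+
    have npos: "real n > 0" using nn by linarith
    have gn: "\<gamma> * real n \<ge> 1" using nn \<gamma> by (simp add: field_simps)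
    have le': "?c \<le> real q * real (cT k n)" using of_nat_mono[OF le, where 'a = real] by simp
    have cT_le: "real (cT k n) \<le> real n ^ (2 * k - 1)" unfolding cT_def by (rule cA_le) (use k in auto)
    have "?c \<le> real n * real n ^ (2 * k - 1)"
    proof -
      have "(1/2 - \<delta>) * real n \<le> 1 * real n" using \<delta> by (intro mult_right_mono) auto
      then have "real q \<le> real n" using q by linarith
      then have "real q * real (cT k n) \<le> real n * real n ^ (2 * k - 1)" using cT_le by (intro mult_mono) auto
      then show ?thesis using le' by simp
    qed
    also have "... = real n ^ (2 * k)" using k by (simp add: power_Suc[symmetric] del: power_Suc)
    finally obtain A where A: "A \<subseteq> {..<n}" and bad: "real (card (badp n G A)) \<le> \<gamma>\<^sup>2 * real n ^ 2"
      and loc: "\<And>u. u < n \<Longrightarrow> card (cut.bn n G A u) \<le> card (cut.xn n G A u)"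
      using n1[OF nn(1) G] e by auto
    interpret cut n G A by unfold_locales (use G A in auto)
    define a where "a = card A"
    define b where "b = n - card A"
    have ab: "a + b = n" "b + a = n" using card_A by (auto simp: a_def b_def)
    have rab: "real a + real b = real n" using ab by (metis of_nat_add)
    define D where "D = real (n\<^sup>2 div 4) - real a * real b"
    have D0: "D \<ge> 0"
    proof -
      have "real (a * b) \<le> real (n\<^sup>2 div 4)" using mult_le_sq_div4[OF ab(1)] by (rule of_nat_mono)
      then show ?thesis by (simp add: D_def)
    qed
    have bd: "Bd \<le> \<gamma>\<^sup>2 * real n ^ 2 / 2" using bad Bd_badp by simp
    have id: "Bd = real q + D + Ms" using edge_count unfolding e D_def a_def b_def by simp
    have q0: "real q \<ge> 0" by simp
    have MB: "Ms \<le> Bd" using id D0 q0 by linarith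
    \<comment> \<open>\<open>(a - b)^2 = n^2 - 4 * a * b\<close> is at most
      \<open>1 + 4 * D\<close>, and \<open>D \<le> Bd\<close> is already small.\<close>
    have close: "\<bar>real a - real b\<bar> \<le> 2 * \<gamma> * real n"
    proof -
      have "(real a - real b)\<^sup>2 = (real a + real b)\<^sup>2 - 4 * (real a * real b)" by (simp add: power2_eq_square algebra_simps)
      also have "... = real n ^ 2 - 4 * real (n\<^sup>2 div 4) + 4 * D" unfolding rab D_def by simp
      also have "... \<le> 1 + 4 * D" using sq_div4_ge[of n] by linarith
      also have "... \<le> 1 + 2 * (\<gamma>\<^sup>2 * real n ^ 2)" using bd id Ms_nonneg q0 by linarith
      also have "1 \<le> (\<gamma> * real n)\<^sup>2" using gn by simp
      finally have "(real a - real b)\<^sup>2 \<le> 3 * (\<gamma> * real n)\<^sup>2"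
        by (simp add: power_mult_distrib)
      also have "... \<le> 4 * (\<gamma> * real n)\<^sup>2" by (intro mult_right_mono) auto
      also have "... = (2 * \<gamma> * real n)\<^sup>2" by (simp add: power_mult_distrib)
      finally show ?thesis using \<gamma> npos by (simp add: abs_le_square_iff[symmetric])
    qed
    have close': "\<bar>real b - real a\<bar> \<le> 2 * \<gamma> * real n" using close by linarith
    define cm where "cm = min (real (cA k a b)) (real (cA k b a))"
    note E1 = n2[rule_format, OF nn(2) ab(1) close] and E2 = n2[rule_format, OF nn(2) ab(2) close']
    have cm1: "cm \<ge> (1 - 5 * \<gamma>) * real (cT k n)" and cm2: "cm \<ge> (real n / 8) ^ (2 * k - 1)"
      using E1 E2 unfolding cm_def by auto
    have cm_pos: "cm > 0"
    proof -
      have "(real n / 8) ^ (2 * k - 1) > 0" using npos by simp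
      then show ?thesis using cm2 by linarith
    qed
    have cm3: "(real q + (1 - \<delta> / 4) * D) * cm \<ge> real q * real (cT k n)"
    proof -
      have D': "D = real (n\<^sup>2 div 4) - real b * real a" by (simp add: D_def)
      have "real q * real (cT k n) \<le> (real q + (1 - \<delta> / 4) * D) * real (cA k a b)"
        using E1 q q0 unfolding D_def by blast
      moreover have "real q * real (cT k n) \<le> (real q + (1 - \<delta> / 4) * D) * real (cA k b a)"
        using E2 q q0 unfolding D' by blast
      ultimately show ?thesis unfolding cm_def min_def by presburger
    qed
    have cm': "0 \<le> cm" "cm \<le> real (cA k (card A) (n - card A))" "cm \<le> real (cA k (n - card A) (card A))"
      using cm_pos by (auto simp: cm_def a_def b_def)
    define sm where "sm = 2 * C * (Ms / real n ^ 2)"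
    have sm0: "sm \<ge> 0" using C0 Ms_nonneg by (auto simp: sm_def)
    have sm1: "real (2 * k - 2) * real (card MP) * real n ^ (2 * k - 3) \<le> sm * cm"
    proof (cases "k = 1")
      case True
      then show ?thesis using sm0 cm_pos by simp
    next
      case False
      then have p: "2 * k - 1 = 2 * k - 3 + 2" using k by linarith
      have "real (2 * k - 2) * real (card MP) * real n ^ (2 * k - 3) = 2 * (real (2 * k - 2) * Ms * real n ^ (2 * k - 3))"
        using Ms_MP by simp
      also have "... = 2 * (real (2 * k - 2) * (Ms / real n ^ 2) * real n ^ (2 * k - 1))"
        unfolding p power_add using npos by simp
      also have "... = sm * (real n / 8) ^ (2 * k - 1)"
        by (simp add: sm_def C_def power_divide)
      also have "... \<le> sm * cm" using cm2 sm0 by (intro mult_left_mono)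
      finally show ?thesis .
    qed
    have sm2: "sm \<le> C * \<gamma>\<^sup>2"
    proof -
      have "Ms / real n ^ 2 \<le> \<gamma>\<^sup>2 / 2" using MB bd npos by (simp add: field_simps)
      then have "2 * C * (Ms / real n ^ 2) \<le> 2 * C * (\<gamma>\<^sup>2 / 2)" using C0 by (intro mult_left_mono) auto
      then show ?thesis by (simp add: sm_def)
    qed
    define \<beta> where "\<beta> = (1/2 - \<gamma>) * real n"
    have \<beta>0: "\<beta> > 0" using g20 npos by (simp add: \<beta>_def)
    have os: "\<beta> \<le> os u" "os u \<le> (1/2 + \<gamma>) * real n" if "u < n" for u
    proof -
      have "os u = real a \<or> os u = real b" using sides[of u] by (cases "u \<in> A") (auto simp: a_def b_def card_B)
      then show "\<beta> \<le> os u" "os u \<le> (1/2 + \<gamma>) * real n"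
        using close rab unfolding \<beta>_def by (auto simp: algebra_simps)
    qed
    let ?\<Delta> = "(1/2 - \<delta>/2) * real n"
    have deg: "dg x \<le> ?\<Delta>" if x: "x < n" for x
    proof (rule ccontr)
      assume "\<not> dg x \<le> ?\<Delta>"
      then have big: "dg x > ?\<Delta>" by simp
      have D0': "?\<Delta> \<ge> 0" using \<delta> npos by simp
      have op: "os x > 0" using os[OF x] \<beta>0 by linarith
      have "dg x \<le> real n"
      proof -
        have "bn x \<subseteq> {..<n}" by (auto simp: bn_def same_def)
        then show ?thesis using card_mono[of "{..<n}" "bn x"] by simp
      qed
      then have i2: "dg x * sm \<le> real n * (C * \<gamma>\<^sup>2)" using sm0 sm2 by (intro mult_mono) auto
      have i1: "(dg x)\<^sup>2 / os x \<ge> real n * ((1/2 - \<delta>/2)\<^sup>2 / (1/2 + \<gamma>))"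
      proof -
        have "?\<Delta>\<^sup>2 / ((1/2 + \<gamma>) * real n) \<le> (dg x)\<^sup>2 / os x"
          using big D0' os[OF x] op by (intro frac_le power_mono) auto
        moreover have "?\<Delta>\<^sup>2 / ((1/2 + \<gamma>) * real n) = real n * ((1/2 - \<delta>/2)\<^sup>2 / (1/2 + \<gamma>))"
          using npos by (simp add: power_mult_distrib power2_eq_square)
        ultimately show ?thesis by simp
      qed
      have i3: "2 * Ms / os x \<le> real n * (\<gamma>\<^sup>2 / (1/2 - \<gamma>))"
      proof -
        have "2 * Ms / os x \<le> (\<gamma>\<^sup>2 * real n ^ 2) / \<beta>"
          using MB bd os[OF x] \<beta>0 Ms_nonneg by (intro frac_le) auto
        also have "... = real n * (\<gamma>\<^sup>2 / (1/2 - \<gamma>))" using npos by (simp add: \<beta>_def power2_eq_square)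
        finally show ?thesis .
      qed
      define br where "br = (1/2 - \<delta>/2)\<^sup>2 / (1/2 + \<gamma>) - C * \<gamma>\<^sup>2 - \<gamma>\<^sup>2 / (1/2 - \<gamma>)"
      have br0: "br > 0"
      proof -
        have "(1 - 5 * \<gamma>) * br > 0" using c3 \<delta> unfolding br_def by linarith
        moreover have "1 - 5 * \<gamma> > 0" using g20 by simp
        ultimately show ?thesis using zero_less_mult_pos by blast
      qed
      have "cm * (real n * br) \<le> cm * ((dg x)\<^sup>2 / os x - dg x * sm - 2 * Ms / os x)"
      proof (rule mult_left_mono)
        have "real n * br = real n * ((1/2 - \<delta>/2)\<^sup>2 / (1/2 + \<gamma>)) - real n * (C * \<gamma>\<^sup>2) - real n * (\<gamma>\<^sup>2 / (1/2 - \<gamma>))"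
          unfolding br_def by (simp only: right_diff_distrib)
        then show "real n * br \<le> (dg x)\<^sup>2 / os x - dg x * sm - 2 * Ms / os x" using i1 i2 i3 by linarith
      qed (use cm' in simp)
      also have "... \<le> ?c" by (rule copies_ge_vertex[OF k cm' sm0 sm1 x loc[OF x] op])
      also have "... \<le> real q * real (cT k n)" by (rule le')
      also have "... \<le> (1/2 - \<delta>) * real n * real (cT k n)" using q by (intro mult_right_mono) auto
      finally have up: "cm * (real n * br) \<le> (1/2 - \<delta>) * real n * real (cT k n)" .
      moreover have "(1 - 5 * \<gamma>) * real (cT k n) * (real n * br) \<le> cm * (real n * br)"
        using cm1 br0 npos by (intro mult_right_mono) auto
      ultimately have "((1 - 5 * \<gamma>) * br) * (real n * real (cT k n)) \<le> (1/2 - \<delta>) * (real n * real (cT k n))"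
        by (simp add: mult_ac)
      moreover have "real n * real (cT k n) > 0"
      proof -
        have "real (cT k n) \<noteq> 0"
        proof
          assume "real (cT k n) = 0"
          then have "cm * (real n * br) \<le> 0" using up by simp
          moreover have "cm * (real n * br) > 0" using cm_pos npos br0 by simp
          ultimately show False by simp
        qed
        then show ?thesis using npos by simp
      qed
      ultimately have "(1 - 5 * \<gamma>) * br \<le> 1/2 - \<delta>" by (simp only: mult_le_cancel_right_pos)
      then show False using c3 unfolding br_def by linarith
    qed
    have S: "(\<Sum>u<n. dg u * (ms u / os u)) \<le> (\<Sum>u<n. dg u * ms u) / \<beta>"
      unfolding sum_divide_distrib
    proof (rule sum_mono)
      fix u assume "u \<in> {..<n}"
      then have "ms u / os u \<le> ms u / \<beta>" using os[of u] \<beta>0 by (intro frac_le) auto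
      then have "dg u * (ms u / os u) \<le> dg u * (ms u / \<beta>)" by (intro mult_left_mono) auto
      then show "dg u * (ms u / os u) \<le> dg u * ms u / \<beta>" by simp
    qed
    have Bsm: "Bd * sm \<le> C * \<gamma>\<^sup>2 * Ms"
    proof -
      have "Bd * sm = (2 * Bd / real n ^ 2) * (C * Ms)" by (simp add: sm_def)
      also have "... \<le> \<gamma>\<^sup>2 * (C * Ms)"
        using bd npos C0 Ms_nonneg by (intro mult_right_mono) (auto simp: field_simps)
      finally show ?thesis by (simp add: mult_ac)
    qed
    \<comment> \<open>Two regimes. For few bad edges, \<open>degrees_opposite\<close> keeps the loss
      per missing edge below 1. For many, \<open>D + Ms = Bd - q\<close> is at least
      \<open>\<delta> / 2 * n\<close>, hence comparable to \<open>Bd\<close>, and a small share of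
      it pays for missing edges between vertices of high bad degree.\<close>
    have br: "Bd * (1 - sm) - (\<Sum>u<n. dg u * (ms u / os u)) \<ge> real q + (1 - \<delta>/4) * D + \<delta>/4 * Ms"
    proof (cases "Bd \<le> ?\<Delta>")
      case True
      have "(\<Sum>u<n. dg u * ms u) / \<beta> \<le> (Ms * ?\<Delta>) / \<beta>"
        using sum_dg_ms_le True Ms_nonneg \<beta>0 by (intro divide_right_mono) (auto intro: order_trans mult_left_mono)
      also have "... = ((1/2 - \<delta>/2) / (1/2 - \<gamma>)) * Ms" using npos by (simp add: \<beta>_def)
      finally have "Bd * sm + (\<Sum>u<n. dg u * (ms u / os u)) \<le> ((1/2 - \<delta>/2) / (1/2 - \<gamma>) + C * \<gamma>\<^sup>2) * Ms"
        using S Bsm unfolding distrib_right by linarith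
      also have "... \<le> (1 - \<delta>/4) * Ms" using c1 Ms_nonneg by (intro mult_right_mono) auto
      finally have "Bd * (1 - sm) - (\<Sum>u<n. dg u * (ms u / os u)) \<ge> Bd - (1 - \<delta>/4) * Ms"
        by (simp add: right_diff_distrib)
      moreover have "Bd - (1 - \<delta>/4) * Ms = real q + D + \<delta>/4 * Ms" unfolding id by (simp add: algebra_simps)
      moreover have "(1 - \<delta>/4) * D \<le> 1 * D" using D0 \<delta> by (intro mult_right_mono) auto
      ultimately show ?thesis by linarith
    next
      case False
      \<comment> \<open>With this threshold \<open>2 * \<tau>\<close> costs only
        \<open>\<delta> / 8 * n\<close>, which turns \<open>1/2 - \<delta>/2\<close> into
        \<open>1/2 - 3*\<delta>/8\<close>.\<close>
      define \<tau> where "\<tau> = \<delta> / 16 * real n"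
      have \<tau>0: "\<tau> > 0" using \<delta> npos by (simp add: \<tau>_def)
      have N: "(2 * Bd / \<tau>)\<^sup>2 \<le> 512 * \<gamma>\<^sup>2 / \<delta>\<^sup>2 * Bd"
      proof -
        have "(2 * Bd / \<tau>)\<^sup>2 = 1024 / (\<delta>\<^sup>2 * real n ^ 2) * (Bd * Bd)"
          unfolding \<tau>_def by (simp add: power2_eq_square)
        also have "... \<le> 1024 / (\<delta>\<^sup>2 * real n ^ 2) * ((\<gamma>\<^sup>2 * real n ^ 2 / 2) * Bd)"
          using bd Bd_nonneg \<delta> npos by (intro mult_left_mono mult_right_mono) auto
        also have "... = 512 * \<gamma>\<^sup>2 / \<delta>\<^sup>2 * Bd" using npos by simp
        finally show ?thesis .
      qed
      have \<Delta>0: "?\<Delta> \<ge> 0" using \<delta> npos by simp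
      have "(\<Sum>u<n. dg u * ms u) \<le> 2 * \<tau> * Ms + ?\<Delta> * (Ms + (2 * Bd / \<tau>)\<^sup>2)"
        by (rule sum_dg_ms_le_max_degree[OF \<tau>0 deg \<Delta>0])
      also have "... \<le> 2 * \<tau> * Ms + ?\<Delta> * (Ms + 512 * \<gamma>\<^sup>2 / \<delta>\<^sup>2 * Bd)"
        using N \<Delta>0 by (intro add_left_mono mult_left_mono) auto
      also have "... = (1/2 - 3*\<delta>/8) * Ms * real n + (1/2 - \<delta>/2) * (512 * \<gamma>\<^sup>2 / \<delta>\<^sup>2 * Bd) * real n"
        unfolding \<tau>_def by (simp add: algebra_simps)
      finally have "(\<Sum>u<n. dg u * ms u) / \<beta> \<le> ((1/2 - 3*\<delta>/8) * Ms * real n + (1/2 - \<delta>/2) * (512 * \<gamma>\<^sup>2 / \<delta>\<^sup>2 * Bd) * real n) / \<beta>"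
        using \<beta>0 by (intro divide_right_mono) auto
      also have "... = (1/2 - 3*\<delta>/8) / (1/2 - \<gamma>) * Ms + (1/2 - \<delta>/2) / (1/2 - \<gamma>) * (512 * \<gamma>\<^sup>2 / \<delta>\<^sup>2 * Bd)"
        using npos by (simp add: \<beta>_def add_divide_distrib mult_ac)
      also have "... \<le> (1/2 - 3*\<delta>/8) / (1/2 - \<gamma>) * Ms + 1 * (512 * \<gamma>\<^sup>2 / \<delta>\<^sup>2 * Bd)"
      proof (intro add_left_mono mult_right_mono)
        show "(1/2 - \<delta>/2) / (1/2 - \<gamma>) \<le> 1" using g20 \<gamma>' \<delta> by (simp add: field_simps)
      qed (use Bd_nonneg in auto)
      finally have "Bd * sm + (\<Sum>u<n. dg u * (ms u / os u)) \<le> ((1/2 - 3*\<delta>/8) / (1/2 - \<gamma>) + C * \<gamma>\<^sup>2) * Ms + 512 * \<gamma>\<^sup>2 / \<delta>\<^sup>2 * Bd"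
        using S Bsm unfolding distrib_right by linarith
      also have "... \<le> (1 - \<delta>/2) * Ms + 512 * \<gamma>\<^sup>2 / \<delta>\<^sup>2 * Bd"
        using c2 Ms_nonneg by (intro add_right_mono mult_right_mono) auto
      also have "512 * \<gamma>\<^sup>2 / \<delta>\<^sup>2 * Bd \<le> \<delta>/4 * (D + Ms)"
      proof -
        have DM: "D + Ms \<ge> \<delta>/2 * real n" using False id q by (simp add: algebra_simps)
        have "real n / 2 \<le> (D + Ms) / \<delta>" using DM \<delta> by (simp add: field_simps)
        moreover have "real q \<le> real n / 2" using q mult_right_mono[of "1/2 - \<delta>" "1/2" "real n"] \<delta> by linarith
        moreover have "(1 + 1/\<delta>) * (D + Ms) = (D + Ms) + (D + Ms) / \<delta>" by (simp add: distrib_right)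
        ultimately have "Bd \<le> (1 + 1/\<delta>) * (D + Ms)" unfolding id by linarith
        then have "512 * \<gamma>\<^sup>2 / \<delta>\<^sup>2 * Bd \<le> 512 * \<gamma>\<^sup>2 / \<delta>\<^sup>2 * ((1 + 1/\<delta>) * (D + Ms))"
          by (intro mult_left_mono) auto
        also have "... = (512 * \<gamma>\<^sup>2 / \<delta>\<^sup>2 * (1 + 1/\<delta>)) * (D + Ms)" by simp
        also have "... \<le> \<delta>/4 * (D + Ms)" using c4 D0 Ms_nonneg by (intro mult_right_mono) auto
        finally show ?thesis .
      qed
      finally have "Bd * (1 - sm) - (\<Sum>u<n. dg u * (ms u / os u)) \<ge> Bd - (1 - \<delta>/2) * Ms - \<delta>/4 * (D + Ms)"
        by (simp add: right_diff_distrib)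
      moreover have "Bd - (1 - \<delta>/2) * Ms - \<delta>/4 * (D + Ms) = real q + (1 - \<delta>/4) * D + \<delta>/4 * Ms"
        unfolding id by (simp add: field_simps)
      ultimately show ?thesis by linarith
    qed
    have main: "?c \<ge> cm * (real q + (1 - \<delta>/4) * D + \<delta>/4 * Ms)"
    proof -
      have "cm * (real q + (1 - \<delta>/4) * D + \<delta>/4 * Ms) \<le> cm * (Bd * (1 - sm) - (\<Sum>u<n. dg u * (ms u / os u)))"
        using br cm' by (intro mult_left_mono)
      also have "... \<le> ?c" by (rule copies_ge_sum[OF k cm' sm0 sm1])
      finally show ?thesis .
    qed
    have "cm * (\<delta>/4 * Ms) \<ge> 0" using cm_pos \<delta> Ms_nonneg by simp
    then have "?c \<ge> real q * real (cT k n)" using main cm3 by (simp add: distrib_left mult.commute)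
    then have "real (q * cT k n) \<le> ?c" by simp
    then have fin1: "q * cT k n \<le> copies G (cycle_graph (2 * k + 1))" by (simp only: of_nat_le_iff)
    \<comment> \<open>For \<open>q = 0\<close> the premise \<open>le\<close> leaves no copies at
      all, so the two nonnegative surplus terms in \<open>main\<close> must vanish.\<close>
    have fin2: "\<exists>A\<subseteq>{..<n}. card A * (n - card A) = n\<^sup>2 div 4 \<and> G = Kb n A" if "q = 0"
    proof -
      have "cm * ((1 - \<delta>/4) * D + \<delta>/4 * Ms) \<le> 0" using main le that by simp
      then have z: "(1 - \<delta>/4) * D + \<delta>/4 * Ms \<le> 0" using cm_pos by (simp add: mult_le_0_iff)
      have nn: "(1 - \<delta>/4) * D \<ge> 0" "\<delta>/4 * Ms \<ge> 0" using \<delta> D0 Ms_nonneg by simp_all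
      then have "(1 - \<delta>/4) * D = 0" "\<delta>/4 * Ms = 0" using z by linarith+
      then have "D = 0" "Ms = 0" using \<delta> by auto
      moreover from this have "Bd = 0" using id that by simp
      moreover have "card A * (n - card A) = n\<^sup>2 div 4"
      proof -
        have "real (n\<^sup>2 div 4) = real (a * b)" using \<open>D = 0\<close> by (simp add: D_def)
        then show ?thesis unfolding a_def b_def by (metis of_nat_eq_iff)
      qed
      ultimately show ?thesis using complete_bipartite A by blast
    qed
    show "q * cT k n \<le> copies G (cycle_graph (2 * k + 1)) \<and>
      (q = 0 \<longrightarrow> (\<exists>A\<subseteq>{..<n}. card A * (n - card A) = n\<^sup>2 div 4 \<and> G = Kb n A))"
      using fin1 fin2 by blast
  qed
qed

section \<open>Adding edges to a complete bipartite graph\<close>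


definition ed :: "nat list \<Rightarrow> nat \<Rightarrow> nat set" where
  "ed xs i = {xs ! i, xs ! ((i + 1) mod length xs)}"

lemma cyc_eq_image_ed: "cyc xs = ed xs ` {..<length xs}"
  unfolding cyc_def ed_def by blast

lemma inj_on_ed:
  assumes "distinct xs" "length xs \<ge> 3"
  shows "inj_on (ed xs) {..<length xs}"
proof (rule inj_onI)
  let ?L = "length xs"
  fix i j assume ij: "i \<in> {..<?L}" "j \<in> {..<?L}" "ed xs i = ed xs j"
  have m: "(i + 1) mod ?L < ?L" "(j + 1) mod ?L < ?L" using assms(2) by (auto intro!: mod_less_divisor simp del: add_Suc_right)
  have "i = j \<or> (i = (j + 1) mod ?L \<and> (i + 1) mod ?L = j)"
    using ij m assms(1) unfolding ed_def doubleton_eq_iff by (auto simp: nth_eq_iff_index_eq)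
  then show "i = j"
  proof
    assume a: "i = (j + 1) mod ?L \<and> (i + 1) mod ?L = j"
    then show "i = j" using ij assms(2) by (auto simp: mod_Suc split: if_splits)
  qed
qed

lemma card_cyc_inter:
  assumes "distinct xs" "length xs \<ge> 3"
  shows "card (cyc xs \<inter> E) = card {i. i < length xs \<and> ed xs i \<in> E}"
proof -
  have "cyc xs \<inter> E = ed xs ` {i. i < length xs \<and> ed xs i \<in> E}" by (auto simp: cyc_eq_image_ed)
  then show ?thesis
    using card_image[OF inj_on_subset[OF inj_on_ed[OF assms], of "{i. i < length xs \<and> ed xs i \<in> E}"]] by auto
qed

text \<open>Every vertex of a cycle lies on exactly two of its edges, so the number of edge ends in a given
  vertex set is even.\<close>

lemma even_edge_ends:
  assumes "length xs > 0"
  shows "even (\<Sum>i<length xs. (of_bool (xs ! i \<in> A) + of_bool (xs ! ((i + 1) mod length xs) \<in> A)) :: nat)"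
proof -
  let ?L = "length xs"
  have "(\<Sum>i<?L. of_bool (xs ! ((i + 1) mod ?L) \<in> A) :: nat) = (\<Sum>i<?L. of_bool (xs ! i \<in> A))"
    by (rule sum.reindex_bij_betw[OF bij_Suc_mod[OF assms]])
  then have "(\<Sum>i<?L. (of_bool (xs ! i \<in> A) + of_bool (xs ! ((i + 1) mod ?L) \<in> A)) :: nat) = 2 * (\<Sum>i<?L. of_bool (xs ! i \<in> A))"
    unfolding sum.distrib by simp
  then show ?thesis by simp
qed

text \<open>An edge of \<open>K\<close> has one end in \<open>A\<close> and an edge of
  \<open>E\<close> has two, so the even number of ends in \<open>A\<close> equals the length plus
  \<open>card (cyc xs \<inter> E)\<close>.\<close>

lemma odd_cyc_inter:
  assumes xs: "distinct xs" "length xs \<ge> 3" "odd (length xs)" "cyc xs \<subseteq> K \<union> E"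
    and K: "\<And>x y. {x, y} \<in> K \<Longrightarrow> (x \<in> A) \<noteq> (y \<in> A)"
    and E: "\<And>x y. {x, y} \<in> E \<Longrightarrow> x \<in> A \<and> y \<in> A"
  shows "odd (card (cyc xs \<inter> E))"
proof -
  let ?L = "length xs"
  have "(\<Sum>i<?L. (of_bool (xs ! i \<in> A) + of_bool (xs ! ((i + 1) mod ?L) \<in> A)) :: nat) = (\<Sum>i<?L. 1 + of_bool (ed xs i \<in> E))"
  proof (rule sum.cong)
    fix i assume "i \<in> {..<?L}"
    then have "ed xs i \<in> K \<union> E" using xs(4) by (auto simp: cyc_eq_image_ed)
    then show "(of_bool (xs ! i \<in> A) + of_bool (xs ! ((i + 1) mod ?L) \<in> A) :: nat) = 1 + of_bool (ed xs i \<in> E)"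
      using K[of "xs ! i" "xs ! ((i + 1) mod ?L)"] E[of "xs ! i" "xs ! ((i + 1) mod ?L)"] unfolding ed_def by auto
  qed simp
  also have "... = ?L + card {i. i < ?L \<and> ed xs i \<in> E}"
  proof -
    have "{i. i < ?L \<and> ed xs i \<in> E} = {..<?L} \<inter> {i. ed xs i \<in> E}" by auto
    then show ?thesis unfolding sum.distrib by (simp add: sum_of_bool_eq)
  qed
  finally have s: "(\<Sum>i<?L. (of_bool (xs ! i \<in> A) + of_bool (xs ! ((i + 1) mod ?L) \<in> A)) :: nat) = ?L + card {i. i < ?L \<and> ed xs i \<in> E}" .
  have "length xs > 0" using xs(2) by linarith
  from even_edge_ends[OF this, of A] have "even (?L + card (cyc xs \<inter> E))"
    unfolding s card_cyc_inter[OF xs(1,2)] .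
  then show ?thesis using xs(3) by simp
qed

text \<open>The closing edge is the one singled out by the list encodings: the bad edge when there
  is only one, an edge outside \<open>E\<close> in \<open>heavy\<close>.\<close>

lemma rotate_to_edge:
  assumes "e \<in> cyc xs"
  obtains ys where "length ys = length xs" "distinct ys = distinct xs" "cyc ys = cyc xs" "{last ys, hd ys} = e"
proof -
  let ?L = "length xs"
  obtain i where i: "i < ?L" "e = {xs ! i, xs ! ((i + 1) mod ?L)}" using assms by (auto simp: cyc_def)
  have ne: "xs \<noteq> []" using i by auto
  let ?ys = "rotate (Suc i) xs"
  have yne: "?ys \<noteq> []" using ne by simp
  have "hd ?ys = xs ! ((i + 1) mod ?L)" using ne by (simp add: hd_rotate_conv_nth del: rotate_Suc)
  moreover have "last ?ys = xs ! i"
  proof -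
    have "last ?ys = ?ys ! (?L - 1)" using last_conv_nth[OF yne] by simp
    also have "... = xs ! ((Suc i + (?L - 1)) mod ?L)" using i(1) by (subst nth_rotate) auto
    also have "Suc i + (?L - 1) = i + ?L" using i by simp
    finally show ?thesis using i by simp
  qed
  ultimately have "{last ?ys, hd ?ys} = e" using i by simp
  then show ?thesis using that[of ?ys] by (simp add: cyc_rotate del: rotate_Suc)
qed

lemma graph_on_Kb: "A \<subseteq> {..<n} \<Longrightarrow> graph_on n (Kb n A)"
  unfolding graph_on_def Kb_def by fastforce

lemma Kb_disjoint:
  assumes "A \<subseteq> {..<n}" "graph_on n Q" "\<And>x y. {x, y} \<in> Q \<Longrightarrow> x \<in> A \<and> y \<in> A"
  shows "Q \<inter> Kb n A = {}"
proof (rule ccontr)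
  assume "Q \<inter> Kb n A \<noteq> {}"
  then obtain e where e: "e \<in> Q" "e \<in> Kb n A" by blast
  then obtain x y where xy: "e = {x, y}" using assms(2) unfolding graph_on_def by blast
  have "x \<in> A" "y \<in> A" using assms(3)[of x y] e xy by auto
  then show False using e(2) Kb_iff[OF assms(1), of x y] xy by blast
qed

lemma cut_Kb: "A \<subseteq> {..<n} \<Longrightarrow> cut n (Kb n A) A"
  by (simp add: cut_def graph_on_Kb)

lemma card_Kb: "A \<subseteq> {..<n} \<Longrightarrow> card (Kb n A) = card A * (n - card A)"
proof -
  assume A: "A \<subseteq> {..<n}"
  interpret cut n "Kb n A" A using cut_Kb[OF A] .
  have "bn u = {}" for u using Kb_iff[OF A] by (auto simp: bn_def same_def)
  moreover have "mn u = {}" if "u < n" for u using that Kb_iff[OF A] by (auto simp: mn_def opp_def)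
  ultimately have "real (card (Kb n A)) = real (card A) * real (n - card A)"
    using edge_count by (simp add: Bd_def Ms_def)
  then show ?thesis by (metis of_nat_eq_iff of_nat_mult)
qed

lemma card_edge_pairs:
  assumes "graph_on n E"
  shows "finite {(u, v). u < v \<and> {u, v} \<in> E}" "card {(u, v). u < v \<and> {u, v} \<in> E} = card E"
proof -
  let ?P = "{(u, v). u < v \<and> {u, v} \<in> E}"
  have "inj_on (\<lambda>(u, v). {u, v}) ?P" by (auto simp: inj_on_def doubleton_eq_iff)
  moreover have im: "(\<lambda>(u, v). {u, v}) ` ?P = E"
  proof
    show "E \<subseteq> (\<lambda>(u, v). {u, v}) ` ?P"
    proof
      fix e assume e: "e \<in> E"
      then obtain x y where xy: "e = {x, y}" "x \<noteq> y" using assms unfolding graph_on_def by blast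
      then have "e = {min x y, max x y}" "min x y < max x y" by (auto simp: min_def max_def)
      then show "e \<in> (\<lambda>(u, v). {u, v}) ` ?P" using e by (intro image_eqI[of _ _ "(min x y, max x y)"]) auto
    qed
  qed auto
  ultimately have b: "bij_betw (\<lambda>(u, v). {u, v}) ?P E" by (simp add: bij_betw_def)
  show "card ?P = card E" using bij_betw_same_card[OF b] .
  show "finite ?P" using bij_betw_finite[OF b] finite_graph_on[OF assms] by simp
qed

text \<open>Keeping the closing edge outside \<open>E\<close> places all edges of \<open>E\<close>
  between positions \<open>i\<close> and \<open>Suc i\<close> without wrap-around, the form required
  by \<open>card_lists_restricted\<close>.\<close>

definition heavy :: "nat set set \<Rightarrow> nat set set \<Rightarrow> nat \<Rightarrow> nat list set" where
  "heavy G E L = {xs. length xs = L \<and> distinct xs \<and> cyc xs \<subseteq> G \<and> {last xs, hd xs} \<notin> E \<and> card (cyc xs \<inter> E) \<ge> 3}"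

text \<open>By parity an odd cycle has either one edge of \<open>E\<close> or at least three. The
  first kind is determined by that edge and an alternating path. The second comes from a list in
  \<open>heavy\<close>, after rotating an edge outside \<open>E\<close> to the closing position;
  \<open>noE\<close> supplies such an edge.\<close>

lemma copies_Kb_le:
  assumes k: "k \<ge> 1" and A: "A \<subseteq> {..<n}" and E: "graph_on n E" "\<And>x y. {x, y} \<in> E \<Longrightarrow> x \<in> A \<and> y \<in> A"
    and noE: "\<And>xs. length xs = 2 * k + 1 \<Longrightarrow> distinct xs \<Longrightarrow> \<not> cyc xs \<subseteq> E"
  shows "copies (Kb n A \<union> E) (cycle_graph (2 * k + 1))
     \<le> card E * cA k (card A) (n - card A) + card (heavy (Kb n A \<union> E) E (2 * k + 1))"
proof -
  let ?G = "Kb n A \<union> E" and ?L = "2 * k + 1"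
  let ?B = "{..<n} - A"
  have G: "graph_on n ?G" using graph_on_Kb[OF A] E(1) by (auto simp: graph_on_def)
  have finA: "finite A" using A finite_subset by blast
  have cB: "card ?B = n - card A" using A finA by (simp add: card_Diff_subset)
  let ?EP = "{(u, v). u < v \<and> {u, v} \<in> E}"
  let ?S = "Sigma ?EP (\<lambda>(u, v). alt (2 * k - 1) ?B (A - {u, v}))"
  let ?f = "\<lambda>((u, v), ys). cyc (u # ys @ [v])"
  let ?H = "heavy ?G E ?L"
  have finalt: "finite (alt (2 * k - 1) ?B (A - {u, v}))" for u v using finA by (intro finite_alt) auto
  have finS: "finite ?S" using card_edge_pairs(1)[OF E(1)] finalt by (intro finite_SigmaI) auto
  have finH: "finite ?H"
    by (rule finite_subset[OF _ finite_lists_length_eq[of "{..<n}" ?L]]) (use cyc_in_graph[OF G] in \<open>auto simp: heavy_def\<close>)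
  have cS: "card ?S = card E * cA k (card A) (n - card A)"
  proof -
    have c0: "card (alt (2 * k - 1) ?B (A - {u, v})) = cA k (card A) (n - card A)" if "(u, v) \<in> ?EP" for u v
    proof -
      have "u \<in> A" "v \<in> A" "u \<noteq> v" using that E(2) by auto
      then have "card (A - {u, v}) = card A - 2" using finA by (simp add: card_Diff_subset)
      then show ?thesis using finA altn_cA[OF k] by (subst card_alt) (auto simp: cB)
    qed
    have c: "card (case p of (u, v) \<Rightarrow> alt (2 * k - 1) ?B (A - {u, v})) = cA k (card A) (n - card A)" if "p \<in> ?EP" for p
    proof (cases p)
      case (Pair u v)
      then show ?thesis using c0[of u v] that by simp
    qed
    have "card ?S = (\<Sum>p\<in>?EP. card (case p of (u, v) \<Rightarrow> alt (2 * k - 1) ?B (A - {u, v})))"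
      by (rule card_SigmaI) (use card_edge_pairs(1)[OF E(1)] finalt in auto)
    also have "... = (\<Sum>p\<in>?EP. cA k (card A) (n - card A))" by (rule sum.cong[OF refl c])
    finally show ?thesis using card_edge_pairs(2)[OF E(1)] by simp
  qed
  have "cyc ` {xs. length xs = ?L \<and> distinct xs \<and> cyc xs \<subseteq> ?G} \<subseteq> ?f ` ?S \<union> cyc ` ?H"
  proof
    fix S assume "S \<in> cyc ` {xs. length xs = ?L \<and> distinct xs \<and> cyc xs \<subseteq> ?G}"
    then obtain xs where xs: "S = cyc xs" "length xs = ?L" "distinct xs" "cyc xs \<subseteq> ?G" by blast
    have L3: "length xs \<ge> 3" using xs(2) k by simp
    have "odd (card (cyc xs \<inter> E))"
      by (rule odd_cyc_inter[OF xs(3) L3 _ xs(4)]) (use xs(2) Kb_iff[OF A] E(2) in auto)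
    then consider "card (cyc xs \<inter> E) = 1" | "card (cyc xs \<inter> E) \<ge> 3"
      by (metis One_nat_def Suc_1 Suc_leI even_numeral le_neq_implies_less linorder_not_le nat_less_le numeral_3_eq_3 odd_pos)
    then show "S \<in> ?f ` ?S \<union> cyc ` ?H"
    proof cases
      case 1
      then obtain e where e: "cyc xs \<inter> E = {e}" using card_1_singletonE by blast
      obtain ys0 where ys0: "length ys0 = length xs" "distinct ys0 = distinct xs" "cyc ys0 = cyc xs" "{last ys0, hd ys0} = e"
        using rotate_to_edge[of e xs] e by blast
      \<comment> \<open>Reversal orients the edge according to the convention \<open>u < v\<close>
        of \<open>?EP\<close>.\<close>
      define ys where "ys = (if hd ys0 < last ys0 then ys0 else rev ys0)"
      have ne0: "ys0 \<noteq> []" using ys0(1) L3 by auto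
      have ld: "hd ys0 \<noteq> last ys0"
      proof -
        have "{last ys0, hd ys0} \<in> E" using ys0(4) e by blast
        then have "last ys0 \<noteq> hd ys0" using graph_onD[OF E(1)] by blast
        then show ?thesis by simp
      qed
      have ys: "length ys = ?L" "distinct ys" "cyc ys = cyc xs" "{last ys, hd ys} = e" "hd ys < last ys"
      proof -
        have "hd ys0 < last ys0 \<or> last ys0 < hd ys0" using ld by linarith
        then show "length ys = ?L" "distinct ys" "cyc ys = cyc xs" "{last ys, hd ys} = e" "hd ys < last ys"
          using ys0 xs(2,3) ne0 unfolding ys_def by (auto simp: cyc_rev hd_rev last_rev insert_commute)
      qed
      have yne: "ys \<noteq> []" using ys(1) by auto
      define zs where "zs = butlast (tl ys)"
      have tne: "tl ys \<noteq> []" using ys(1) k by (cases ys) auto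
      have dec: "ys = hd ys # zs @ [last ys]"
        unfolding zs_def using yne tne by (metis append_butlast_last_id hd_Cons_tl last_tl)
      let ?u = "hd ys" and ?v = "last ys"
      have lz: "length zs = 2 * k - 1" using ys(1) unfolding zs_def by simp
      have uvE: "{?u, ?v} \<in> E" using ys(4) e by (auto simp: insert_commute)
      have uvA: "?u \<in> A" "?v \<in> A" using E(2)[OF uvE] by auto
      have cross: "{ys ! i, ys ! Suc i} \<in> Kb n A" if i: "Suc i < ?L" for i
      proof -
        have i': "i < length ys" "length ys - 1 < length ys" using i ys(1) by auto
        have edi: "ed ys i = {ys ! i, ys ! Suc i}" using i ys(1) by (simp add: ed_def)
        have edl: "ed ys (length ys - 1) = {last ys, hd ys}"
          using yne by (simp add: ed_def last_conv_nth hd_conv_nth)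
        have "ed ys i \<noteq> ed ys (length ys - 1)"
          using inj_on_ed[OF ys(2)] ys(1) L3 xs(2) i i' by (metis (no_types, lifting) inj_on_eq_iff lessThan_iff add_diff_cancel_right' less_irrefl Suc_eq_plus1 Suc_less_eq)
        then have "ed ys i \<noteq> e" using edl ys(4) by simp
        moreover have "ed ys i \<in> cyc xs" using i' ys(3) by (metis cyc_eq_image_ed image_eqI lessThan_iff)
        ultimately have "ed ys i \<notin> E" using e by blast
        then show ?thesis using \<open>ed ys i \<in> cyc xs\<close> xs(4) edi by auto
      qed
      have alt: "ys ! i < n \<and> (ys ! i \<in> A \<longleftrightarrow> even i)" if "i < ?L" for i
        using that
      proof (induction i)
        case 0
        then show ?case using uvA A yne by (auto simp: hd_conv_nth[symmetric])
      next
        case (Suc i)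
        then show ?case using cross[of i] Kb_iff[OF A, of "ys ! i" "ys ! Suc i"] by auto
      qed
      have zi: "zs ! i = ys ! Suc i" if "i < 2 * k - 1" for i
        by (subst dec) (use that lz in \<open>simp add: nth_append\<close>)
      have "?B \<inter> (A - {?u, ?v}) = {}" by auto
      moreover have dz: "distinct (?u # zs @ [?v])" using ys(2) dec by metis
      moreover have "zs ! i \<in> (if even i then ?B else A - {?u, ?v})" if i: "i < 2 * k - 1" for i
      proof -
        have "zs ! i \<in> set zs" using i lz by simp
        then have "zs ! i \<noteq> ?u" "zs ! i \<noteq> ?v" using dz by auto
        moreover have "zs ! i < n \<and> (zs ! i \<in> A \<longleftrightarrow> odd i)" using alt[of "Suc i"] zi[OF i] i by simp
        ultimately show ?thesis by auto
      qed
      ultimately have "zs \<in> alt (2 * k - 1) ?B (A - {?u, ?v})" using lz by (simp add: alt_iff)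
      then have "((?u, ?v), zs) \<in> ?S" using uvE ys(5) by auto
      moreover have "?f ((?u, ?v), zs) = S" using dec ys(3) xs(1) by simp
      ultimately show ?thesis by (metis (no_types, lifting) UnI1 image_eqI)
    next
      case 2
      obtain e where e: "e \<in> cyc xs" "e \<notin> E" using noE[OF xs(2,3)] by blast
      obtain ys where ys: "length ys = length xs" "distinct ys = distinct xs" "cyc ys = cyc xs" "{last ys, hd ys} = e"
        using rotate_to_edge[OF e(1)] by blast
      then have "ys \<in> ?H" using xs e 2 by (simp add: heavy_def)
      then have "cyc ys \<in> cyc ` ?H" by (rule imageI)
      then show ?thesis unfolding xs(1) ys(3) by (rule UnI2)
    qed
  qed
  then have "card (cyc ` {xs. length xs = ?L \<and> distinct xs \<and> cyc xs \<subseteq> ?G}) \<le> card (?f ` ?S \<union> cyc ` ?H)"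
    by (rule card_mono[rotated]) (use finS finH in blast)
  also have "... \<le> card (?f ` ?S) + card (cyc ` ?H)" by (rule card_Un_le)
  also have "... \<le> card ?S + card ?H" using finS finH by (intro add_mono card_image_le)
  finally show ?thesis unfolding cS by (simp add: copies_cycle_graph)
qed

text \<open>A cycle passes through \<open>z\<close> at most once and so has at most two star edges.
  Nothing is heavy, and the bound carries no error term.\<close>

lemma copies_star_le:
  assumes k: "k \<ge> 1" and A: "A \<subseteq> {..<n}" and z: "z \<in> A" and N: "N \<subseteq> A - {z}"
  shows "copies (Kb n A \<union> (\<lambda>v. {z, v}) ` N) (cycle_graph (2 * k + 1)) \<le> card N * cA k (card A) (n - card A)"
    "graph_on n ((\<lambda>v. {z, v}) ` N)" "card ((\<lambda>v. {z, v}) ` N) = card N"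
proof -
  let ?E = "(\<lambda>v. {z, v}) ` N"
  show E: "graph_on n ?E" using A z N unfolding graph_on_def by fastforce
  show cE: "card ?E = card N" by (rule card_image) (use N in \<open>auto simp: inj_on_def doubleton_eq_iff\<close>)
  have le2: "card (cyc xs \<inter> ?E) \<le> 2" if xs: "length xs = 2 * k + 1" "distinct xs" for xs
  proof -
    let ?L = "length xs"
    have L3: "?L \<ge> 3" using xs k by simp
    have "card {i. i < ?L \<and> ed xs i \<in> ?E} \<le> card ({i. i < ?L \<and> xs ! i = z} \<union> {i. i < ?L \<and> xs ! ((i + 1) mod ?L) = z})"
      by (rule card_mono) (auto simp: ed_def doubleton_eq_iff)
    also have "... \<le> card {i. i < ?L \<and> xs ! i = z} + card {i. i < ?L \<and> xs ! ((i + 1) mod ?L) = z}"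
      by (rule card_Un_le)
    also have "... \<le> 1 + 1"
    proof (rule add_mono)
      show "card {i. i < ?L \<and> xs ! i = z} \<le> 1"
        using xs(2) by (auto simp: card_le_Suc0_iff_eq nth_eq_iff_index_eq)
      have b: "inj_on (\<lambda>i. (i + 1) mod ?L) {..<?L}" 
        using bij_betw_imp_inj_on[OF bij_Suc_mod[of ?L]] L3 by fastforce
      have m: "(i + 1) mod ?L < ?L" for i using L3 by (intro mod_less_divisor) linarith
      have ij_eq: "i = j" if ij: "i < ?L" "j < ?L" "xs ! ((i + 1) mod ?L) = z" "xs ! ((j + 1) mod ?L) = z" for i j
      proof -
        have "(i + 1) mod ?L = (j + 1) mod ?L"
          using ij(3,4) nth_eq_iff_index_eq[OF xs(2) m m, of i j] by simp
        then show ?thesis using inj_onD[OF b, of i j] ij(1,2) by simp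
      qed
      show "card {i. i < ?L \<and> xs ! ((i + 1) mod ?L) = z} \<le> 1"
        unfolding One_nat_def by (subst card_le_Suc0_iff_eq) (use ij_eq in auto)
    qed
    finally show ?thesis using card_cyc_inter[OF xs(2) L3] by simp
  qed
  have noE: "\<not> cyc xs \<subseteq> ?E" if xs: "length xs = 2 * k + 1" "distinct xs" for xs
  proof
    assume "cyc xs \<subseteq> ?E"
    then have "cyc xs \<inter> ?E = cyc xs" by blast
    moreover have "card (cyc xs) = length xs"
      using card_cyc_inter[OF xs(2), of UNIV] xs(1) k by simp
    ultimately show False using le2[OF xs] xs(1) k by simp
  qed
  have "heavy (Kb n A \<union> ?E) ?E (2 * k + 1) = {}" using le2 by (force simp: heavy_def)
  then show "copies (Kb n A \<union> ?E) (cycle_graph (2 * k + 1)) \<le> card N * cA k (card A) (n - card A)"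
    using copies_Kb_le[OF k A E _ noE] z N cE by (force simp: doubleton_eq_iff)
qed

lemma inj_on_butlast_last: "inj_on (\<lambda>xs. (butlast xs, last xs)) {xs. xs \<noteq> []}"
  by (rule inj_onI) (metis append_butlast_last_id mem_Collect_eq prod.inject)

text \<open>Reading from left to right, an entry that follows a position in \<open>I\<close> has at
  most \<open>D\<close> choices and every other entry at most \<open>card V\<close>.\<close>

lemma card_lists_restricted:
  assumes V: "finite V" and D: "\<And>x. finite (N x)" "\<And>x. card (N x) \<le> D" and I: "\<forall>i\<in>I. Suc i < L"
  shows "card {xs. length xs = L \<and> set xs \<subseteq> V \<and> (\<forall>i\<in>I. xs ! Suc i \<in> N (xs ! i))} \<le> D ^ card I * card V ^ (L - card I)"
  using I
proof (induction L arbitrary: I)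
  case 0
  then have "I = {}" by auto
  then have "{xs. length xs = 0 \<and> set xs \<subseteq> V \<and> (\<forall>i\<in>I. xs ! Suc i \<in> N (xs ! i))} = {[]}" by auto
  then show ?case using \<open>I = {}\<close> by simp
next
  case (Suc L)
  let ?S = "\<lambda>L I. {xs. length xs = L \<and> set xs \<subseteq> V \<and> (\<forall>i\<in>I. xs ! Suc i \<in> N (xs ! i))}"
  have finS: "finite (?S L I)" for L I
    by (rule finite_subset[OF _ finite_lists_length_eq[OF V, of L]]) auto
  let ?I = "I - {L - 1}"
  have finI: "finite I" by (rule finite_subset[of _ "{..<Suc L}"]) (use Suc.prems in auto)
  \<comment> \<open>The last entry has index \<open>L\<close> and is constrained exactly if
    \<open>L - 1 \<in> I\<close>; \<open>L > 0\<close> guards against truncation at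
    \<open>L = 0\<close>.\<close>
  show ?case
  proof (cases "L - 1 \<in> I \<and> L > 0")
    case True
    have I': "\<forall>i\<in>?I. Suc i < L" using Suc.prems True by force
    have cI: "card I = Suc (card ?I)" using True finI card_Suc_Diff1[of I "L - 1"] by simp
    have "card (?S (Suc L) I) \<le> card (Sigma (?S L ?I) (\<lambda>ys. N (ys ! (L - 1))))"
    proof (rule card_inj_on_le[of "\<lambda>xs. (butlast xs, last xs)"])
      show "inj_on (\<lambda>xs. (butlast xs, last xs)) (?S (Suc L) I)"
        by (rule inj_on_subset[OF inj_on_butlast_last]) auto
      show "finite (Sigma (?S L ?I) (\<lambda>ys. N (ys ! (L - 1))))" using finS D by (intro finite_SigmaI) auto
      show "(\<lambda>xs. (butlast xs, last xs)) ` ?S (Suc L) I \<subseteq> Sigma (?S L ?I) (\<lambda>ys. N (ys ! (L - 1)))"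
      proof
        fix p assume "p \<in> (\<lambda>xs. (butlast xs, last xs)) ` ?S (Suc L) I"
        then obtain xs where xs: "p = (butlast xs, last xs)" "xs \<in> ?S (Suc L) I" by blast
        then have ne: "xs \<noteq> []" by auto
        have l: "last xs = xs ! L" using xs(2) ne by (simp add: last_conv_nth)
        have "xs ! Suc (L - 1) \<in> N (xs ! (L - 1))" using xs(2) True by blast
        then have f1: "last xs \<in> N (butlast xs ! (L - 1))" using l True xs(2) by (simp add: nth_butlast)
        have "butlast xs ! Suc i \<in> N (butlast xs ! i)" if i: "i \<in> ?I" for i
        proof -
          have "xs ! Suc i \<in> N (xs ! i)" "Suc i < L" using xs(2) i I' by blast+
          then show ?thesis using xs(2) by (simp add: nth_butlast)
        qed
        then have f2: "butlast xs \<in> ?S L ?I"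
          using xs(2) by (auto dest: in_set_butlastD)
        show "p \<in> Sigma (?S L ?I) (\<lambda>ys. N (ys ! (L - 1)))" unfolding xs(1) by (rule SigmaI) (rule f2, rule f1)
      qed
    qed
    also have "... = (\<Sum>ys\<in>?S L ?I. card (N (ys ! (L - 1))))" using finS D by (subst card_SigmaI) auto
    also have "... \<le> (\<Sum>ys\<in>?S L ?I. D)" by (rule sum_mono) (rule D)
    also have "... = card (?S L ?I) * D" by simp
    also have "... \<le> (D ^ card ?I * card V ^ (L - card ?I)) * D" using Suc.IH[OF I'] by (rule mult_le_mono1)
    also have "... = D ^ card I * card V ^ (Suc L - card I)" unfolding cI by simp
    finally show ?thesis .
  next
    case False
    have I': "\<forall>i\<in>I. Suc i < L" using Suc.prems False by (metis Suc_lessI diff_Suc_1 less_Suc_eq_0_disj not_less_eq zero_less_Suc)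
    have "I \<subseteq> {..<L}" using I' by auto
    then have cI: "card I \<le> L" using card_mono[of "{..<L}" I] by simp
    have "card (?S (Suc L) I) \<le> card (?S L I \<times> V)"
    proof (rule card_inj_on_le[of "\<lambda>xs. (butlast xs, last xs)"])
      show "inj_on (\<lambda>xs. (butlast xs, last xs)) (?S (Suc L) I)"
        by (rule inj_on_subset[OF inj_on_butlast_last]) auto
      show "finite (?S L I \<times> V)" using finS V by auto
      show "(\<lambda>xs. (butlast xs, last xs)) ` ?S (Suc L) I \<subseteq> ?S L I \<times> V"
      proof
        fix p assume "p \<in> (\<lambda>xs. (butlast xs, last xs)) ` ?S (Suc L) I"
        then obtain xs where xs: "p = (butlast xs, last xs)" "xs \<in> ?S (Suc L) I" by blast
        then have ne: "xs \<noteq> []" by auto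
        have lV: "last xs \<in> V" using xs(2) last_in_set[OF ne] by auto
        have "butlast xs ! Suc i \<in> N (butlast xs ! i)" if i: "i \<in> I" for i
        proof -
          have "xs ! Suc i \<in> N (xs ! i)" "Suc i < L" using xs(2) i I' by blast+
          then show ?thesis using xs(2) by (simp add: nth_butlast)
        qed
        then have "butlast xs \<in> ?S L I"
          using xs(2) by (auto dest: in_set_butlastD)
        then show "p \<in> ?S L I \<times> V" unfolding xs(1) using lV by (intro SigmaI)
      qed
    qed
    also have "... = card (?S L I) * card V" by (rule card_cartesian_product)
    also have "... \<le> (D ^ card I * card V ^ (L - card I)) * card V" using Suc.IH[OF I'] by (rule mult_le_mono1)
    also have "... = D ^ card I * card V ^ (Suc L - card I)" using cI by (simp add: Suc_diff_le)
    finally show ?thesis .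
  qed
qed

text \<open>Three edges of \<open>E\<close> leave at most \<open>D\<close> choices at three steps of
  the list, and \<open>2 ^ (2 * k)\<close> bounds the choices of their positions. For constant
  \<open>D\<close> this is a factor of order \<open>n\<close> below the count per bad edge.\<close>

lemma card_heavy_le:
  assumes k: "k \<ge> 1" and G: "graph_on n G" and D: "\<And>x. finite {y. {x, y} \<in> E}" "\<And>x. card {y. {x, y} \<in> E} \<le> D"
  shows "card (heavy G E (2 * k + 1)) \<le> 2 ^ (2 * k) * (D ^ 3 * n ^ (2 * k - 2))"
proof -
  let ?L = "2 * k + 1"
  let ?S = "\<lambda>I. {xs. length xs = ?L \<and> set xs \<subseteq> {..<n} \<and> (\<forall>i\<in>I. xs ! Suc i \<in> {y. {xs ! i, y} \<in> E})}"
  let ?T = "{I. I \<subseteq> {..<2 * k} \<and> card I = 3}"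
  have finT: "finite ?T" by (rule finite_subset[of _ "Pow {..<2 * k}"]) auto
  have cT: "card ?T \<le> 2 ^ (2 * k)"
    using card_mono[of "Pow {..<2 * k}" ?T] by (auto simp: card_Pow)
  have finS: "finite (?S I)" for I
    by (rule finite_subset[OF _ finite_lists_length_eq[of "{..<n}" ?L]]) auto
  have "heavy G E ?L \<subseteq> (\<Union>I\<in>?T. ?S I)"
  proof
    fix xs assume h: "xs \<in> heavy G E ?L"
    then have xs: "length xs = ?L" "distinct xs" "cyc xs \<subseteq> G" "{last xs, hd xs} \<notin> E" "card (cyc xs \<inter> E) \<ge> 3"
      by (auto simp: heavy_def)
    have ne: "xs \<noteq> []" using xs(1) by auto
    let ?J = "{i. i < length xs \<and> ed xs i \<in> E}"
    have J3: "3 \<le> card ?J" using xs card_cyc_inter[OF xs(2), of E] k by simp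
    obtain I where I: "I \<subseteq> ?J" "card I = 3" using obtain_subset_with_card_n[OF J3] by blast
    have "2 * k \<notin> ?J" using xs(1,4) ne by (simp add: ed_def last_conv_nth hd_conv_nth)
    then have lt: "i < 2 * k" if "i \<in> I" for i using I(1) that xs(1) by (metis (mono_tags, lifting) Suc_eq_plus1 less_Suc_eq mem_Collect_eq subsetD)
    have "{xs ! i, xs ! Suc i} \<in> E" if "i \<in> I" for i
      using I(1) that lt[OF that] xs(1) by (auto simp: ed_def)
    then have "xs \<in> ?S I" using xs(1) cyc_in_graph[OF G xs(3)] by auto
    moreover have "I \<in> ?T" using I(2) lt by auto
    ultimately show "xs \<in> (\<Union>I\<in>?T. ?S I)" by blast
  qed
  then have "card (heavy G E ?L) \<le> card (\<Union>I\<in>?T. ?S I)" by (rule card_mono[rotated]) (use finT finS in blast)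
  also have "... \<le> (\<Sum>I\<in>?T. card (?S I))" by (rule card_UN_le[OF finT])
  also have "... \<le> (\<Sum>I\<in>?T. D ^ 3 * n ^ (2 * k - 2))"
  proof (rule sum_mono)
    fix I assume I: "I \<in> ?T"
    have "card (?S I) \<le> D ^ card I * card {..<n} ^ (?L - card I)"
      by (rule card_lists_restricted) (use I D in auto)
    then show "card (?S I) \<le> D ^ 3 * n ^ (2 * k - 2)" using I by simp
  qed
  also have "... \<le> 2 ^ (2 * k) * (D ^ 3 * n ^ (2 * k - 2))" using cT by simp
  finally show ?thesis .
qed

section \<open>The extremal quantities\<close>


lemma finite_graphs: "finite {E. graph_on n E}"
proof (rule finite_subset)
  show "{E. graph_on n E} \<subseteq> Pow (Pow {..<n})" by (auto simp: graph_on_def)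
qed simp

lemma card_graph_le: "graph_on n G \<Longrightarrow> card G \<le> n choose 2"
proof -
  assume G: "graph_on n G"
  have "G \<subseteq> {B. B \<subseteq> {..<n} \<and> card B = 2}"
  proof
    fix e assume "e \<in> G"
    then obtain x y where "e = {x, y}" "x \<noteq> y" "x < n" "y < n" using G unfolding graph_on_def by blast
    then show "e \<in> {B. B \<subseteq> {..<n} \<and> card B = 2}" by auto
  qed
  then have "card G \<le> card {B. B \<subseteq> {..<n} \<and> card B = 2}" by (rule card_mono[rotated]) simp
  then show ?thesis by (simp add: n_subsets)
qed

lemma graph_on_subset: "graph_on n G \<Longrightarrow> H \<subseteq> G \<Longrightarrow> graph_on n H"
  by (auto simp: graph_on_def)

lemma graph_on_Un: "graph_on n G \<Longrightarrow> graph_on n H \<Longrightarrow> graph_on n (G \<union> H)"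
  by (auto simp: graph_on_def)

lemma cT_pos:
  assumes "k \<ge> 1" "n \<ge> 2 * k + 6"
  shows "cT k n > 0"
proof -
  have "real (cT k n) \<ge> 1 ^ (2 * k - 1)"
    unfolding cT_def by (rule cA_ge) (use assms in linarith)+
  then show ?thesis by simp
qed

lemma copies_Kb: "k \<ge> 1 \<Longrightarrow> A \<subseteq> {..<n} \<Longrightarrow> A \<noteq> {} \<Longrightarrow> copies (Kb n A) (cycle_graph (2 * k + 1)) = 0"
  using copies_star_le(1)[of k A n _ "{}"] by fastforce

text \<open>A graph with more than \<open>n\<^sup>2 div 4\<close> edges contains one with exactly
  one edge above that number, and the counting bound for \<open>q = 1\<close> gives it a cycle.
  Uniqueness is the case \<open>q = 0\<close>; the choice 1/4 only has to admit these two
  values.\<close>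

lemma extremal:
  assumes k: "k \<ge> 1"
  shows "\<exists>n0. \<forall>n\<ge>n0. ex n (cycle_graph (2 * k + 1)) = n\<^sup>2 div 4 \<and>
    (\<forall>E. graph_on n E \<longrightarrow> copies E (cycle_graph (2 * k + 1)) = 0 \<longrightarrow> card E = n\<^sup>2 div 4 \<longrightarrow>
      (\<exists>A\<subseteq>{..<n}. card A * (n - card A) = n\<^sup>2 div 4 \<and> E = Kb n A))"
proof -
  let ?C = "cycle_graph (2 * k + 1)"
  from copies_lower_bound[OF k, of "1/4"] obtain n1 where n1: "\<forall>n\<ge>n1. \<forall>G q. graph_on n G \<longrightarrow> card G = n\<^sup>2 div 4 + q \<longrightarrow> real q \<le> (1/2 - 1/4) * real n \<longrightarrow>
    copies G ?C \<le> q * cT k n \<longrightarrow> q * cT k n \<le> copies G ?C \<and>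
    (q = 0 \<longrightarrow> (\<exists>A\<subseteq>{..<n}. card A * (n - card A) = n\<^sup>2 div 4 \<and> G = Kb n A))"
    by auto
  show ?thesis
  proof (intro exI[of _ "n1 + 2 * k + 6"] allI impI conjI)
    fix n assume n: "n1 + 2 * k + 6 \<le> n"
    then have nn: "n1 \<le> n" "n \<ge> 2 * k + 6" by auto
    have le: "card E \<le> n\<^sup>2 div 4" if E: "graph_on n E" "copies E ?C = 0" for E
    proof (rule ccontr)
      assume "\<not> ?thesis"
      then have "n\<^sup>2 div 4 + 1 \<le> card E" by simp
      then obtain H where H: "H \<subseteq> E" "card H = n\<^sup>2 div 4 + 1" using obtain_subset_with_card_n by metis
      have "copies H ?C \<le> copies E ?C" using H finite_graph_on[OF E(1)] by (intro copies_cycle_mono) auto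
      then have "copies H ?C = 0" using E(2) by simp
      then have "1 * cT k n \<le> copies H ?C"
        using n1[rule_format, OF nn(1) graph_on_subset[OF E(1) H(1)] H(2)] nn by simp
      then show False using \<open>copies H ?C = 0\<close> cT_pos[OF k nn(2)] by simp
    qed
    let ?A = "{..<n div 2}"
    have A: "?A \<subseteq> {..<n}" "?A \<noteq> {}" using nn by (auto simp: lessThan_empty_iff)
    show "ex n ?C = n\<^sup>2 div 4"
      unfolding ex_def
    proof (rule Max_eqI)
      show "finite {card E |E. graph_on n E \<and> copies E ?C = 0}"
        using finite_graphs[of n] by (simp add: setcompr_eq_image)
      show "y \<le> n\<^sup>2 div 4" if "y \<in> {card E |E. graph_on n E \<and> copies E ?C = 0}" for y using that le by auto
      have "card (Kb n ?A) = n\<^sup>2 div 4" using card_Kb[OF A(1)] by (simp add: sq_div4)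
      then show "n\<^sup>2 div 4 \<in> {card E |E. graph_on n E \<and> copies E ?C = 0}"
        using graph_on_Kb[OF A(1)] copies_Kb[OF k A] by (metis (mono_tags, lifting) mem_Collect_eq)
    qed
    fix E assume "graph_on n E" "copies E ?C = 0" "card E = n\<^sup>2 div 4"
    then show "\<exists>A\<subseteq>{..<n}. card A * (n - card A) = n\<^sup>2 div 4 \<and> E = Kb n A"
      using n1[rule_format, OF nn(1), of E 0] by auto
  qed
qed

section \<open>Minima over finite families of graphs\<close>

lemma h_set_finite: "finite {copies E F | E. graph_on n E \<and> card E = m}"
  using finite_graphs[of n] by (simp add: setcompr_eq_image)

abbreviation t_values :: "'b set set \<Rightarrow> nat \<Rightarrow> nat \<Rightarrow> nat set" where
  "t_values F n q \<equiv> {copies (E \<union> A) F | E A. graph_on n E \<and> copies E F = 0 \<and> card E = ex n F \<and> graph_on n A \<and> A \<inter> E = {} \<and> card A = q}"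

lemma t_set_subset:
  "t_values F n q \<subseteq> {copies E F | E. graph_on n E \<and> card E = ex n F + q}"
proof
  fix c assume "c \<in> t_values F n q"
  then obtain E A where c: "c = copies (E \<union> A) F" "graph_on n E" "card E = ex n F" "graph_on n A" "A \<inter> E = {}" "card A = q" by blast
  then have "card (E \<union> A) = ex n F + q"
    using finite_graph_on card_Un_disjoint[of E A] by (metis Int_commute)
  then show "c \<in> {copies E F | E. graph_on n E \<and> card E = ex n F + q}" using c graph_on_Un by blast
qed

lemma h_le_t:
  assumes "graph_on n E" "copies E F = 0" "card E = ex n F" "graph_on n A" "A \<inter> E = {}" "card A = q"
  shows "h_F F n q \<le> t_F F n q" "t_F F n q \<le> copies (E \<union> A) F"
proof -
  have mem: "copies (E \<union> A) F \<in> t_values F n q" using assms by blast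
  have fin: "finite (t_values F n q)" by (rule finite_subset[OF t_set_subset h_set_finite])
  show "h_F F n q \<le> t_F F n q" unfolding h_F_def t_F_def
    by (rule Min_antimono[OF t_set_subset _ h_set_finite]) (use mem in blast)
  show "t_F F n q \<le> copies (E \<union> A) F" unfolding t_F_def by (rule Min_le[OF fin mem])
qed

text \<open>The witness in the first two premises ensures that \<open>Min\<close> is taken over a
  nonempty set; the witnesses in \<open>t_F_ge\<close> have the same purpose.\<close>

lemma h_F_ge:
  assumes "graph_on n E" "card E = ex n F + q"
    and "\<And>G. graph_on n G \<Longrightarrow> card G = ex n F + q \<Longrightarrow> c \<le> copies G F"
  shows "c \<le> h_F F n q"
proof -
  have "h_F F n q \<in> {copies E F | E. graph_on n E \<and> card E = ex n F + q}"
    unfolding h_F_def by (rule Min_in[OF h_set_finite]) (use assms in blast)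
  then obtain G where "h_F F n q = copies G F" "graph_on n G" "card G = ex n F + q" by blast
  then show ?thesis using assms(3)[of G] by simp
qed

lemma t_F_ge:
  assumes "graph_on n E" "copies E F = 0" "card E = ex n F" "graph_on n A" "A \<inter> E = {}" "card A = q"
    and "\<And>E A. graph_on n E \<Longrightarrow> copies E F = 0 \<Longrightarrow> card E = ex n F \<Longrightarrow> graph_on n A \<Longrightarrow> A \<inter> E = {} \<Longrightarrow> card A = q
       \<Longrightarrow> c \<le> copies (E \<union> A) F"
  shows "c \<le> t_F F n q"
proof -
  have "t_F F n q \<in> t_values F n q"
    unfolding t_F_def by (rule Min_in[OF finite_subset[OF t_set_subset h_set_finite]]) (use assms(1-6) in blast)
  then obtain E A where EA: "t_F F n q = copies (E \<union> A) F" "graph_on n E" "copies E F = 0" "card E = ex n F"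
    "graph_on n A" "A \<inter> E = {}" "card A = q" by blast
  show ?thesis using assms(7)[OF EA(2-7)] EA(1) by simp
qed

text \<open>A star in the larger part of the balanced graph attains the lower bound, so
  \<open>h_F\<close> and \<open>t_F\<close> both equal \<open>q * cT k n\<close>. Its existence also
  shows that \<open>q\<close> respects the cap in \<open>q_F\<close>.\<close>

lemma q_F_lower:
  assumes k: "k \<ge> 1" and \<delta>: "0 < \<delta>" "\<delta> \<le> 1/2"
  shows "\<exists>n0. \<forall>n\<ge>n0. \<forall>q. real q \<le> (1/2 - \<delta>) * real n \<longrightarrow> q \<le> (n choose 2) - ex n (cycle_graph (2 * k + 1)) \<and>
    h_F (cycle_graph (2 * k + 1)) n q = t_F (cycle_graph (2 * k + 1)) n q"
proof -
  let ?C = "cycle_graph (2 * k + 1)"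
  from copies_lower_bound[OF k \<delta>] obtain n1 where n1: "\<forall>n\<ge>n1. \<forall>G q. graph_on n G \<longrightarrow> card G = n\<^sup>2 div 4 + q \<longrightarrow> real q \<le> (1/2 - \<delta>) * real n \<longrightarrow>
    copies G ?C \<le> q * cT k n \<longrightarrow> q * cT k n \<le> copies G ?C \<and>
    (q = 0 \<longrightarrow> (\<exists>A\<subseteq>{..<n}. card A * (n - card A) = n\<^sup>2 div 4 \<and> G = Kb n A))" ..
  from extremal[OF k] obtain n2 where n2: "\<And>n. n \<ge> n2 \<Longrightarrow> ex n ?C = n\<^sup>2 div 4" by blast
  show ?thesis
  proof (intro exI[of _ "n1 + n2 + nat \<lceil>1 / \<delta>\<rceil> + 2"] allI impI)
    fix n q assume n: "n1 + n2 + nat \<lceil>1 / \<delta>\<rceil> + 2 \<le> n" and q: "real q \<le> (1/2 - \<delta>) * real n"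
    have nn: "n1 \<le> n" "n2 \<le> n" "real n \<ge> 1 / \<delta>" "n \<ge> 2" using n by linarith+
    have dn: "\<delta> * real n \<ge> 1" using nn(3) \<delta> by (simp add: field_simps)
    note ex = n2[OF nn(2)]
    define l where "l = n div 2"
    define h where "h = n - l"
    have lh: "l + h = n" "l \<le> h" by (auto simp: l_def h_def)
    have "real q + 1 \<le> real n / 2" using q dn by (simp add: left_diff_distrib)
    \<comment> \<open>Room for the centre 0 and the leaves \<open>1..q\<close> in the larger part;
      here a star requires \<open>q\<close> below about \<open>n / 2\<close>.\<close>
    then have qh: "q + 1 \<le> h" using lh by linarith
    let ?A = "{..<h}" and ?N = "{1..q}"
    let ?E = "(\<lambda>v. {0, v}) ` ?N"
    have A: "?A \<subseteq> {..<n}" "0 \<in> ?A" "?N \<subseteq> ?A - {0}" "?A \<noteq> {}" using lh qh by (auto simp: lessThan_empty_iff)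
    note star = copies_star_le[OF k A(1-3)]
    have nh: "n - h = l" using lh by simp
    have cK: "card (Kb n ?A) = ex n ?C" using card_Kb[OF A(1)] lh nh unfolding ex sq_div4 by (simp add: l_def h_def mult.commute)
    have dis: "?E \<inter> Kb n ?A = {}"
    proof -
      have "{0, v} \<notin> Kb n ?A" if "v \<in> ?N" for v using Kb_iff[OF A(1), of 0 v] qh that by auto
      then show ?thesis by blast
    qed
    have cE: "card ?E = q" using star(3) by simp
    note ht = h_le_t[OF graph_on_Kb[OF A(1)] copies_Kb[OF k A(1,4)] cK star(2) dis cE]
    have "t_F ?C n q \<le> q * cT k n"
    proof -
      have "cA k (card ?A) (n - card ?A) = cT k n" using nh by (simp add: cT_def h_def l_def)
      then show ?thesis using ht(2) star(1) by simp
    qed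
    moreover have G: "graph_on n (Kb n ?A \<union> ?E)" "card (Kb n ?A \<union> ?E) = ex n ?C + q"
    proof -
      show "graph_on n (Kb n ?A \<union> ?E)" by (rule graph_on_Un[OF graph_on_Kb[OF A(1)] star(2)])
      have "card (Kb n ?A \<union> ?E) = card (Kb n ?A) + card ?E"
        by (rule card_Un_disjoint) (use dis finite_graph_on[OF graph_on_Kb[OF A(1)]] in auto)
      then show "card (Kb n ?A \<union> ?E) = ex n ?C + q" using cK cE by simp
    qed
    moreover have "q * cT k n \<le> h_F ?C n q"
    proof (rule h_F_ge[OF G])
      fix G assume "graph_on n G" "card G = ex n ?C + q"
      \<comment> \<open>Either there are at least \<open>q * cT k n\<close> copies anyway, or the
        premise of the conditional bound holds.\<close>
      then show "q * cT k n \<le> copies G ?C"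
        using n1[rule_format, OF nn(1), of G q] q unfolding ex by (metis nle_le)
    qed
    ultimately have "h_F ?C n q = t_F ?C n q" using ht(1) by linarith
    moreover have "q \<le> (n choose 2) - ex n ?C" using card_graph_le[OF G(1)] G(2) by linarith
    ultimately show "q \<le> (n choose 2) - ex n ?C \<and> h_F ?C n q = t_F ?C n q" by blast
  qed
qed

text \<open>A bipartite graph of maximum degree 4 with about \<open>2a\<close> edges. Since its degrees are bounded, only \<open>O(n\<^sup>2\<^sup>k\<^sup>-\<^sup>2)\<close> copies of
  \<open>C\<^sub>2\<^sub>k\<^sub>+\<^sub>1\<close> use three or more of its edges; a star would be too small to supply \<open>(1 + \<epsilon>) n / 2\<close> edges.\<close>

definition E0 :: "nat \<Rightarrow> nat set set" where
  "E0 a = (\<lambda>i. {i, i + 1}) ` {..<a - 1} \<union> (\<lambda>i. {i, i + 3}) ` {..<a - 3}"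

lemma E0_D: "{x, y} \<in> E0 a \<Longrightarrow> x < a \<and> y < a \<and> odd (x + y) \<and> (y = x + 1 \<or> x = y + 1 \<or> y = x + 3 \<or> x = y + 3)"
  by (auto simp: E0_def doubleton_eq_iff)

lemma card_E0: "card (E0 a) = (a - 1) + (a - 3)"
proof -
  have "card (E0 a) = card ((\<lambda>i. {i, i + 1}) ` {..<a - 1}) + card ((\<lambda>i. {i, i + 3}) ` {..<a - 3})"
    unfolding E0_def by (rule card_Un_disjoint) (auto simp: doubleton_eq_iff)
  moreover have "card ((\<lambda>i. {i, i + 1}) ` {..<a - 1}) = a - 1"
    by (subst card_image) (auto simp: inj_on_def doubleton_eq_iff)
  moreover have "card ((\<lambda>i. {i, i + 3}) ` {..<a - 3}) = a - 3"
    by (subst card_image) (auto simp: inj_on_def doubleton_eq_iff)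
  ultimately show ?thesis by simp
qed

lemma graph_on_E0: "a \<le> n \<Longrightarrow> graph_on n (E0 a)"
  unfolding graph_on_def E0_def by fastforce

lemma E0_degree: "finite {y. {x, y} \<in> E0 a}" "card {y. {x, y} \<in> E0 a} \<le> 4"
proof -
  have s: "{y. {x, y} \<in> E0 a} \<subseteq> {x + 1, x - 1, x + 3, x - 3}" using E0_D by fastforce
  then show "finite {y. {x, y} \<in> E0 a}" by (rule finite_subset) simp
  have "card {x + 1, x - 1, x + 3, x - 3} \<le> 4" by (simp add: card_insert_if)
  then show "card {y. {x, y} \<in> E0 a} \<le> 4" using card_mono[OF _ s] by simp
qed

text \<open>Neighbours differ by 1 or 3, so every edge has exactly one odd end; an odd cycle would
  have an odd number of edge ends at odd vertices.\<close>

lemma E0_no_odd_cycle: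
  assumes "odd (length xs)"
  shows "\<not> cyc xs \<subseteq> E0 a"
proof
  assume c: "cyc xs \<subseteq> E0 a"
  let ?L = "length xs" and ?O = "{x. odd x}"
  have "(\<Sum>i<?L. (of_bool (xs ! i \<in> ?O) + of_bool (xs ! ((i + 1) mod ?L) \<in> ?O)) :: nat) = (\<Sum>i<?L. 1)"
  proof (rule sum.cong)
    fix i assume "i \<in> {..<?L}"
    then have "{xs ! i, xs ! ((i + 1) mod ?L)} \<in> E0 a" using c by (auto simp: cyc_eq_image_ed ed_def)
    then have "odd (xs ! i + xs ! ((i + 1) mod ?L))" using E0_D by blast
    then show "(of_bool (xs ! i \<in> ?O) + of_bool (xs ! ((i + 1) mod ?L) \<in> ?O) :: nat) = 1" by auto
  qed simp
  moreover have "?L > 0" using assms by (cases xs) auto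
  ultimately show False using even_edge_ends[of xs ?O] assms by simp
qed

text \<open>Two absorptions: \<open>m * ff (m - 1) (k - 1) = ff m k\<close> and
  \<open>ff (m - 1) k = (m - 1) * ff (m - 2) (k - 1)\<close>. The comparison at the threshold needs
  the ratio up to \<open>o(1 / m)\<close>; here it is exact.\<close>

lemma cA_shift: "k \<ge> 1 \<Longrightarrow> m \<ge> 2 \<Longrightarrow> m * cA k (m + 1) (m - 1) = (m - 1) * cA k m m"
proof -
  assume k: "k \<ge> 1" and m: "m \<ge> 2"
  then obtain j where j: "k = Suc j" using Suc_le_D by auto
  have "m + 1 - 2 = m - 1" "m - 1 - 1 = m - 2" using m by auto
  then have "m * cA k (m + 1) (m - 1) = ff (m - 1) (Suc j) * (m * ff (m - 1) j)"
    unfolding cA_def j by simp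
  also have "... = ((m - 1) * ff (m - 2) j) * ff m (Suc j)"
    unfolding ff_Suc[of "m - 1"] ff_Suc[of m] using m by (simp add: numeral_2_eq_2)
  also have "... = (m - 1) * cA k m m" unfolding cA_def j by simp
  finally show ?thesis .
qed

text \<open>A single \<open>q\<close> with \<open>h_F < t_F\<close> bounds \<open>q_F\<close>,
  because agreement is required at all smaller values. For even \<open>n\<close> the extremal graph
  is balanced and moving one vertex costs just one edge, against two for odd
  \<open>n\<close>.\<close>

lemma q_F_upper:
  assumes k: "k \<ge> 1" and \<epsilon>: "0 < \<epsilon>" "\<epsilon> \<le> 1/2"
  shows "\<exists>m0. \<forall>m\<ge>m0. real (q_F (cycle_graph (2 * k + 1)) (2 * m)) \<le> (1 + \<epsilon>) * real m"
proof -
  let ?C = "cycle_graph (2 * k + 1)"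
  from extremal[OF k] obtain n1 where n1: "\<forall>n\<ge>n1. ex n ?C = n\<^sup>2 div 4 \<and>
    (\<forall>E. graph_on n E \<longrightarrow> copies E ?C = 0 \<longrightarrow> card E = n\<^sup>2 div 4 \<longrightarrow>
      (\<exists>A\<subseteq>{..<n}. card A * (n - card A) = n\<^sup>2 div 4 \<and> E = Kb n A))" ..
  \<comment> \<open>With 1/2 only \<open>q = 0\<close> remains; it shows that the set in
    \<open>q_F\<close> is nonempty.\<close>
  from q_F_lower[OF k, of "1/2"] obtain n2 where n2: "\<And>n q. n \<ge> n2 \<Longrightarrow> real q \<le> (1/2 - 1/2) * real n \<Longrightarrow>
     q \<le> (n choose 2) - ex n ?C \<and> h_F ?C n q = t_F ?C n q" by auto
  \<comment> \<open>\<open>4 ^ k * 64\<close> stems from the bound on heavy cycles with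
    \<open>D = 4\<close>, the power of 8 from \<open>c \<ge> (n / 8) ^ (2 * k - 1)\<close>;
    \<open>n > R / \<epsilon>\<close> makes the heavy cycles fewer than
    \<open>\<epsilon> * c\<close>.\<close>
  define R where "R = (4 :: real) ^ k * 64 * 8 ^ (2 * k - 1)"
  define m0 where "m0 = n1 + n2 + 2 * k + 20 + nat \<lceil>R / \<epsilon>\<rceil>"
  show ?thesis
  proof (intro exI[of _ m0] allI impI)
    fix m assume m: "m0 \<le> m"
    define n where "n = 2 * m"
    define q where "q = nat \<lceil>(1 + \<epsilon>) * real m\<rceil>"
    have mm: "n1 \<le> n" "n2 \<le> n" "m \<ge> 20" "real m \<ge> R / \<epsilon>" "m \<ge> 2 * k + 20"
      using m unfolding m0_def n_def by linarith+
    have mpos: "real m > 0" using mm by simp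
    have q1: "real q \<ge> (1 + \<epsilon>) * real m" unfolding q_def by linarith
    have q2: "real q < (1 + \<epsilon>) * real m + 1"
    proof -
      have "(1 + \<epsilon>) * real m \<ge> 0" using \<epsilon> by simp
      then show ?thesis unfolding q_def by linarith
    qed
    have "\<epsilon> * real m \<le> real m / 2" using \<epsilon> mult_right_mono[of \<epsilon> "1/2" "real m"] by simp
    then have "real q < 3/2 * real m + 1" using q2 unfolding distrib_right by linarith
    then have q3: "q + 1 \<le> 2 * m - 6" using mm(3) by linarith
    have n4: "n\<^sup>2 div 4 = m * m" by (simp add: n_def power2_eq_square)
    have ex: "ex n ?C = m * m" using n1 mm(1) n4 by simp
    have uniq: "\<forall>E. graph_on n E \<longrightarrow> copies E ?C = 0 \<longrightarrow> card E = n\<^sup>2 div 4 \<longrightarrow>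
      (\<exists>A\<subseteq>{..<n}. card A * (n - card A) = n\<^sup>2 div 4 \<and> E = Kb n A)"
      using n1[rule_format, OF mm(1)] by (rule conjunct2)
    have cT: "cT k n = cA k m m" by (simp add: cT_def n_def)
    define c where "c = real (cA k m m)"
    have c_ge: "c \<ge> (real n / 8) ^ (2 * k - 1)"
      unfolding c_def by (rule cA_ge) (use mm(5) k in \<open>auto simp: n_def\<close>)
    have c_pos: "c > 0"
    proof -
      have "(real n / 8) ^ (2 * k - 1) > 0" using mpos by (simp add: n_def)
      then show ?thesis using c_ge by linarith
    qed

    have t_ge: "q * cT k n \<le> t_F ?C n q"
    proof -
      have A: "{..<m} \<subseteq> {..<n}" "{..<m} \<noteq> {}" using mm(3) by (auto simp: n_def lessThan_empty_iff)
      \<comment> \<open>A witness that \<open>q\<close> edges can be added at all, so that the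
        minimum in \<open>t_F\<close> ranges over a nonempty set.\<close>
      obtain Q where Q: "Q \<subseteq> E0 m" "card Q = q"
      proof -
        have "q \<le> card (E0 m)" using q3 mm(3) by (simp add: card_E0)
        then show ?thesis using obtain_subset_with_card_n that by metis
      qed
      have gQ: "graph_on n Q" using graph_on_subset[OF graph_on_E0 Q(1)] by (simp add: n_def)
      have dis: "Q \<inter> Kb n {..<m} = {}"
        by (rule Kb_disjoint[OF A(1) gQ]) (use E0_D Q(1) in blast)
      have cK: "card (Kb n {..<m}) = ex n ?C" unfolding ex using card_Kb[OF A(1)] by (simp add: n_def)
      show ?thesis
      proof (rule t_F_ge[OF graph_on_Kb[OF A(1)] copies_Kb[OF k A] cK gQ dis Q(2)])
        fix E S assume E: "graph_on n E" "copies E ?C = 0" "card E = ex n ?C" and S: "graph_on n S" "S \<inter> E = {}" "card S = q"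
        obtain A where Ax: "A \<subseteq> {..<n}" "card A * (n - card A) = m * m" "E = Kb n A"
          using uniq[rule_format, OF E(1,2)] E(3) unfolding ex n4 by auto
        have cAm: "card A = m"
        proof -
          have "card A \<le> n" using card_mono[OF _ Ax(1)] by simp
          then have "int (card A) * (int n - int (card A)) = int (card A * (n - card A))" by (simp add: of_nat_diff)
          also have "... = int m * int m" unfolding Ax(2) by simp
          finally have "int (card A) * (2 * int m - int (card A)) = int m * int m" by (simp add: n_def)
          then have "(int m - int (card A))\<^sup>2 = 0" by (simp add: power2_eq_square algebra_simps)
          then show ?thesis by simp
        qed
        interpret cut n "E \<union> S" A by unfold_locales (use graph_on_Un[OF E(1) S(1)] Ax(1) in auto)
        have KE: "{x, y} \<in> E \<longleftrightarrow> x < n \<and> y < n \<and> (x \<in> A) \<noteq> (y \<in> A)" for x y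
          unfolding Ax(3) by (rule Kb_iff[OF Ax(1)])
        have mne: "mn u = {}" if "u < n" for u
          using that KE by (auto simp: mn_def opp_def)
        have Ms: "Ms = 0" by (simp add: Ms_def mne)
        have "card (E \<union> S) = m * m + q"
          using card_Un_disjoint[of E S] finite_graph_on[OF E(1)] finite_graph_on[OF S(1)] S E(3) ex by (auto simp: Int_commute)
        then have Bd: "Bd = real q" using edge_count Ms cAm by (simp add: n_def)
        \<comment> \<open>No edge across is missing, so \<open>cm = c\<close> and
          \<open>sm = 0\<close> are admissible and each bad edge yields its full \<open>c\<close>
          cycles.\<close>
        have "real (copies (E \<union> S) ?C) \<ge> c * (Bd * (1 - 0) - (\<Sum>u<n. dg u * (ms u / os u)))"
          by (rule copies_ge_sum[OF k]) (use cAm Ms Ms_MP in \<open>auto simp: c_def n_def\<close>)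
        also have "(\<Sum>u<n. dg u * (ms u / os u)) = 0" by (simp add: mne)
        finally have "real (q * cT k n) \<le> real (copies (E \<union> S) ?C)" by (simp add: Bd cT c_def mult.commute)
        then show "q * cT k n \<le> copies (E \<union> S) ?C" by (simp only: of_nat_le_iff)
      qed
    qed

    have h_less: "h_F ?C n q < q * cT k n"
    proof -
      let ?A = "{..<m + 1}"
      have A: "?A \<subseteq> {..<n}" using mm(3) by (auto simp: n_def)
      \<comment> \<open>\<open>q + 1\<close> edges, since \<open>(m + 1) * (m - 1)\<close> falls one
        short of \<open>m * m\<close>.\<close>
      obtain Q where Q: "Q \<subseteq> E0 (m + 1)" "card Q = q + 1"
      proof -
        have "q + 1 \<le> card (E0 (m + 1))" using q3 mm(3) by (simp add: card_E0)
        then show ?thesis using obtain_subset_with_card_n that by metis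
      qed
      have gQ: "graph_on n Q" using graph_on_subset[OF graph_on_E0 Q(1)] mm(3) by (simp add: n_def)
      have QA: "x \<in> ?A \<and> y \<in> ?A" if "{x, y} \<in> Q" for x y
        using E0_D[of x y "m + 1"] Q(1) that by auto
      have dis: "Kb n ?A \<inter> Q = {}" using Kb_disjoint[OF A gQ QA] by blast
      let ?G = "Kb n ?A \<union> Q"
      have G: "graph_on n ?G" by (rule graph_on_Un[OF graph_on_Kb[OF A] gQ])
      have "card ?G = card (Kb n ?A) + card Q"
        by (rule card_Un_disjoint) (use dis finite_graph_on[OF graph_on_Kb[OF A]] finite_graph_on[OF gQ] in auto)
      also have "card (Kb n ?A) = (m + 1) * (m - 1)" using card_Kb[OF A] by (simp add: n_def)
      also have "(m + 1) * (m - 1) + card Q = m * m + q"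
      proof -
        obtain r where "m = Suc r" using mm(3) by (cases m) auto
        then show ?thesis using Q(2) by simp
      qed
      finally have cG: "card ?G = ex n ?C + q" unfolding ex .
      have "h_F ?C n q \<le> copies ?G ?C"
        unfolding h_F_def by (rule Min_le[OF h_set_finite]) (use G cG in blast)
      also have "... \<le> card Q * cA k (card ?A) (n - card ?A) + card (heavy ?G Q (2 * k + 1))"
      proof (rule copies_Kb_le[OF k A gQ QA])
        fix xs :: "nat list" assume "length xs = 2 * k + 1"
        then show "\<not> cyc xs \<subseteq> Q" using E0_no_odd_cycle[of xs "m + 1"] Q(1) by auto
      qed
      also have "card (heavy ?G Q (2 * k + 1)) \<le> 2 ^ (2 * k) * (4 ^ 3 * n ^ (2 * k - 2))"
      proof (rule card_heavy_le[OF k G])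
        fix x
        have s: "{y. {x, y} \<in> Q} \<subseteq> {y. {x, y} \<in> E0 (m + 1)}" using Q(1) by auto
        show "finite {y. {x, y} \<in> Q}" by (rule finite_subset[OF s E0_degree(1)])
        show "card {y. {x, y} \<in> Q} \<le> 4" using card_mono[OF E0_degree(1) s] E0_degree(2)[of x "m + 1"] by linarith
      qed
      finally have "h_F ?C n q \<le> (q + 1) * cA k (m + 1) (m - 1) + 2 ^ (2 * k) * (4 ^ 3 * n ^ (2 * k - 2))"
        using Q(2) by (simp add: n_def)
      moreover have "(2 :: nat) ^ (2 * k) = 4 ^ k" by (simp add: power_mult)
      ultimately have "h_F ?C n q \<le> (q + 1) * cA k (m + 1) (m - 1) + 4 ^ k * (4 ^ 3 * n ^ (2 * k - 2))" by simp
      then have "real (h_F ?C n q) \<le> real ((q + 1) * cA k (m + 1) (m - 1) + 4 ^ k * (4 ^ 3 * n ^ (2 * k - 2)))"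
        by (rule of_nat_mono)
      then have h1: "real (h_F ?C n q) \<le> (real q + 1) * real (cA k (m + 1) (m - 1)) + 4 ^ k * 64 * real n ^ (2 * k - 2)"
        by (simp add: algebra_simps)
      have sh: "real (cA k (m + 1) (m - 1)) = c * (1 - 1 / real m)"
      proof -
        have "m * cA k (m + 1) (m - 1) = (m - 1) * cA k m m" using cA_shift[OF k] mm(3) by simp
        then have "real (m * cA k (m + 1) (m - 1)) = real ((m - 1) * cA k m m)" by simp
        then have "real m * real (cA k (m + 1) (m - 1)) = (real m - 1) * c" using mm(3) by (simp add: c_def of_nat_diff)
        then show ?thesis using mpos by (simp add: field_simps)
      qed
      have "(real q + 1) * (1 - 1 / real m) = real q - ((real q + 1) / real m - 1)" by (simp add: algebra_simps add_divide_distrib)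
      moreover have "(real q + 1) / real m - 1 \<ge> \<epsilon>" using q1 mpos by (simp add: field_simps)
      ultimately have "(real q + 1) * (1 - 1 / real m) \<le> real q - \<epsilon>" by linarith
      then have "c * ((real q + 1) * (1 - 1 / real m)) \<le> c * (real q - \<epsilon>)" using c_pos by (intro mult_left_mono) auto
      then have h2: "(real q + 1) * real (cA k (m + 1) (m - 1)) \<le> c * real q - \<epsilon> * c" unfolding sh by (simp add: algebra_simps)
      have "4 ^ k * 64 * real n ^ (2 * k - 2) < \<epsilon> * c"
      proof -
        have np: "real n > 0" using mpos by (simp add: n_def)
        have p: "2 * k - 1 = Suc (2 * k - 2)" using k by simp
        have "real n > R / \<epsilon>" using mm(4) mpos by (simp add: n_def)
        then have "R < \<epsilon> * real n" using \<epsilon> by (simp add: field_simps)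
        then have "R * real n ^ (2 * k - 2) < \<epsilon> * real n * real n ^ (2 * k - 2)" using np by (intro mult_strict_right_mono) auto
        then have "4 ^ k * 64 * real n ^ (2 * k - 2) * 8 ^ (2 * k - 1) < \<epsilon> * real n ^ (2 * k - 1)"
          unfolding R_def p by (simp add: mult_ac)
        then have "4 ^ k * 64 * real n ^ (2 * k - 2) < \<epsilon> * (real n / 8) ^ (2 * k - 1)"
          by (simp add: power_divide field_simps)
        also have "... \<le> \<epsilon> * c" using c_ge \<epsilon> by (intro mult_left_mono) auto
        finally show ?thesis .
      qed
      then have "real (h_F ?C n q) < c * real q" using h1 h2 by linarith
      then have "real (h_F ?C n q) < real (q * cT k n)" by (simp add: cT c_def mult.commute)
      then show ?thesis by (simp only: of_nat_less_iff)
    qed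

    let ?S = "{q. q \<le> (n choose 2) - ex n ?C \<and> (\<forall>q'\<le>q. h_F ?C n q' = t_F ?C n q')}"
    have "finite ?S" by simp
    moreover have "0 \<in> ?S" using n2[OF mm(2), of 0] by simp
    ultimately have "q_F ?C n \<in> ?S" unfolding q_F_def by (intro Min_in Max_in) auto
    then have "\<not> q \<le> q_F ?C n" using t_ge h_less by auto
    then have "real (q_F ?C n) < (1 + \<epsilon>) * real m" unfolding q_def by linarith
    then show "real (q_F ?C (2 * m)) \<le> (1 + \<epsilon>) * real m" by (simp add: n_def)
  qed
qed

theorem theorem3:
  fixes k :: nat
  assumes "k \<ge> 1"
  shows "c1 (cycle_graph (2 * k + 1)) = ereal (1 / 2)"
proof (rule antisym)
  let ?C = "cycle_graph (2 * k + 1)"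
  let ?X = "\<lambda>n. ereal (real (q_F ?C n) / real n)"
  \<comment> \<open>One \<open>\<delta>\<close> comes from \<open>q_F_lower\<close>, the other
    absorbs the rounding of \<open>q\<close>.\<close>
  have low: "ereal (1 / 2 - 2 * \<delta>) \<le> liminf ?X" if \<delta>: "0 < \<delta>" "\<delta> \<le> 1/2" for \<delta>
  proof (rule Liminf_bounded)
    from q_F_lower[OF assms \<delta>] obtain n0 where n0: "\<And>n q. n \<ge> n0 \<Longrightarrow> real q \<le> (1/2 - \<delta>) * real n \<Longrightarrow>
      q \<le> (n choose 2) - ex n ?C \<and> h_F ?C n q = t_F ?C n q" by blast
    have "ereal (1 / 2 - 2 * \<delta>) \<le> ?X n" if n: "n \<ge> n0 + nat \<lceil>1 / \<delta>\<rceil> + 1" for n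
    proof -
      have nn: "n \<ge> n0" "real n \<ge> 1 / \<delta>" "real n > 0" using n by linarith+
      have dn: "\<delta> * real n \<ge> 1" using nn \<delta> by (simp add: field_simps)
      define q where "q = nat \<lfloor>(1/2 - \<delta>) * real n\<rfloor>"
      have pos: "(1/2 - \<delta>) * real n \<ge> 0" using \<delta> by simp
      have q1: "real q \<le> (1/2 - \<delta>) * real n" and q2: "real q > (1/2 - \<delta>) * real n - 1"
        using pos unfolding q_def by linarith+
      let ?S = "{q. q \<le> (n choose 2) - ex n ?C \<and> (\<forall>q'\<le>q. h_F ?C n q' = t_F ?C n q')}"
      have "q' \<le> q \<Longrightarrow> real q' \<le> (1/2 - \<delta>) * real n" for q' using q1 by linarith
      then have "q \<in> ?S" using n0[OF nn(1)] by blast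
      then have "q \<le> q_F ?C n" unfolding q_F_def by (intro Max_ge) auto
      then have "real (q_F ?C n) \<ge> (1/2 - \<delta>) * real n - 1" using q2 by linarith
      moreover have "(1/2 - \<delta>) * real n - 1 \<ge> (1/2 - 2 * \<delta>) * real n" using dn by (simp add: algebra_simps)
      ultimately have "real (q_F ?C n) \<ge> (1/2 - 2 * \<delta>) * real n" by linarith
      then show ?thesis using nn(3) by (simp add: field_simps)
    qed
    then show "\<forall>\<^sub>F n in sequentially. ereal (1 / 2 - 2 * \<delta>) \<le> ?X n"
      unfolding eventually_sequentially by blast
  qed
  show "ereal (1 / 2) \<le> c1 ?C"
    unfolding c1_def
  proof (rule ereal_le_epsilon2)
    fix e :: real assume e: "0 < e"
    define \<delta> where "\<delta> = min (e / 2) (1 / 2)"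
    have "ereal (1/2) \<le> ereal (1 / 2 - 2 * \<delta>) + ereal e" by (simp add: \<delta>_def min_def)
    also have "... \<le> liminf ?X + ereal e" using low[of \<delta>] e by (intro add_right_mono) (auto simp: \<delta>_def)
    finally show "ereal (1 / 2) \<le> liminf ?X + ereal e" .
  qed
  have up: "liminf ?X \<le> ereal ((1 + \<epsilon>) / 2)" if \<epsilon>: "0 < \<epsilon>" "\<epsilon> \<le> 1/2" for \<epsilon>
  proof -
    from q_F_upper[OF assms \<epsilon>] obtain m0 where m0: "\<And>m. m \<ge> m0 \<Longrightarrow> real (q_F ?C (2 * m)) \<le> (1 + \<epsilon>) * real m" by blast
    \<comment> \<open>Passing to even \<open>n\<close> can only raise the limit inferior, so an
      upper bound along these suffices.\<close>
    have "liminf ?X \<le> liminf (?X \<circ> (\<lambda>m. 2 * m))" by (rule liminf_subseq_mono) (auto simp: strict_mono_def)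
    also have "... \<le> liminf (\<lambda>m. ereal ((1 + \<epsilon>) / 2))"
    proof (rule Liminf_mono)
      have "(?X \<circ> (\<lambda>m. 2 * m)) m \<le> ereal ((1 + \<epsilon>) / 2)" if "m \<ge> m0 + 1" for m
      proof -
        have "real m > 0" using that by simp
        then show ?thesis using m0[of m] that by (simp add: field_simps)
      qed
      then show "\<forall>\<^sub>F m in sequentially. (?X \<circ> (\<lambda>m. 2 * m)) m \<le> ereal ((1 + \<epsilon>) / 2)"
        unfolding eventually_sequentially by blast
    qed
    also have "... = ereal ((1 + \<epsilon>) / 2)" by (rule Liminf_const) simp
    finally show ?thesis .
  qed
  show "c1 ?C \<le> ereal (1 / 2)"
    unfolding c1_def
  proof (rule ereal_le_epsilon2)
    fix e :: real assume e: "0 < e"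
    define \<epsilon> where "\<epsilon> = min e (1 / 2)"
    have "liminf ?X \<le> ereal ((1 + \<epsilon>) / 2)" using e by (intro up) (auto simp: \<epsilon>_def)
    also have "... \<le> ereal (1 / 2) + ereal e" using e by (simp add: \<epsilon>_def min_def)
    finally show "liminf ?X \<le> ereal (1 / 2) + ereal e" .
  qed
qed

end
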